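(* A non-tubular umbilic-free linear Weingarten surface (in a Riemannian or Lorentzian space form) possesses a $3$-parameter family of Darboux transforms (Darboux transforms of its Legendre lift, which is an $\Omega$-surface) that satisfy the same linear Weingarten condition as the initial surface.
   Context: $\mathbb{R}^{4,2}$ is a 6-dimensional real vector space with a non-degenerate symmetric bilinear form $(\,,\,)$ of signature $(4,2)$, $\mathcal{L}$ its lightcone; $\wedge^2\mathbb{R}^{4,2}\cong\mathfrak{o}(4,2)$ via $a\wedge b\,(c)=(a,c)b-(b,c)a$; $a\odot b=\frac12(a\otimes b+b\otimes a)$. $\Sigma$ is a smooth 2-manifold, $d$ the trivial connection on $\underline{\mathbb{R}}^{4,2}=\Sigma\times\mathbb{R}^{4,2}$; $W^{(1)}$ is spanned by sections of a subbundle $W$ and their derivatives. A smooth isotropic rank 2 subbundle $f$ is a Legendre map if $f^{(1)}\le f^\perp$ and no non-zero $X\in T\Sigma$ satisfies $d_X\sigma\in f$ for all $\sigma\in\Gamma f$. A curvature sphere at $p$ is a line $s(p)\le f(p)$ killed by $\sigma\mapsto d_X\sigma\bmod f$ for all $X$ in some non-zero (maximal) subspace $T_{s(p)}\le T_p\Sigma$; $f$ is umbilic-free if there are exactly two at each point, forming rank 1 bundles $s_1,s_2$ with curvature subbundles $T_1,T_2$. Space forms: a point sphere complex $\mathfrak{p}$ with $(\mathfrak{p},\mathfrak{p})=\pm1$ and a non-zero space form vector $\mathfrak{q}\in\langle\mathfrak{p}\rangle^\perp$ give $\mathfrak{Q}^3=\{y\in\mathcal{L}:(y,\mathfrak{q})=-1,(y,\mathfrak{p})=0\}$,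 a (Riemannian or Lorentzian) space form. The projection $\mathfrak{f}$ and tangent plane congruence $\mathfrak{t}$ of a Legendre map $f$ are the sections of $f$ with $(\mathfrak{f},\mathfrak{q})=-1,(\mathfrak{f},\mathfrak{p})=0$ and $(\mathfrak{t},\mathfrak{q})=0,(\mathfrak{t},\mathfrak{p})=-1$; $f=\langle\mathfrak{f},\mathfrak{t}\rangle$ is the Legendre lift of $\mathfrak{f}$. Principal curvatures $\kappa_i$: $d_X\mathfrak{t}+\kappa_id_X\mathfrak{f}=0$ for $X\in T_i$; $K=\kappa_1\kappa_2$, $H=\frac12(\kappa_1+\kappa_2)$. $\mathfrak{f}$ is linear Weingarten if, where it immerses, $aK+2bH+c=0$ for constants $a,b,c\in\mathbb{R}$, not all zero; the linear Weingarten condition is the class of $W=a\,\mathfrak{q}\odot\mathfrak{q}+2b\,\mathfrak{q}\odot\mathfrak{p}+c\,\mathfrak{p}\odot\mathfrak{p}$ in $\mathbb{P}(S^2\mathbb{R}^{4,2})$. It is non-tubular if $b^2-ac\neq0$. The Legendre lift $f$ of an umbilic-free non-tubular linear Weingarten surface is an $\Omega$-surface, i.e. there is a closed $\eta\in\Omega^1(f\wedge f^\perp)$ with $[\eta\wedge\eta]=0$ whose quadratic differential $q(X,Y)=\mathrm{tr}(\sigma\mapsto\eta(X)d_Y\sigma:f\to f)$ is non-degenerate on a dense open set; here one takes $\eta=\eta^{mid}=c\,\mathfrak{f}\wedge d\mathfrak{f}-b(\mathfrak{f}\wedge d\mathfrak{t}+\mathfrak{t}\wedge d\mathfrak{f})+a\,\mathfrak{t}\wedge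 d\mathfrak{t}$. The sections $p(t)=\mathfrak{p}+t(-b\mathfrak{f}+a\mathfrak{t})$ and $q(t)=\mathfrak{q}+t(c\mathfrak{f}-b\mathfrak{t})$ are parallel for $d+t\eta$ for all $t$. Darboux transforms: for $m\in\mathbb{R}\setminus\{0\}$ let $\hat s$ be a null rank 1 subbundle parallel for the flat connection $d+m\eta$ and nowhere orthogonal to the curvature spheres of $f$; then $\hat f:=(f\cap\hat s^\perp)\oplus\hat s$ is a Darboux transform of $f$ with parameter $m$ (taken umbilic-free, and projected to the same space form). Parameters are counted as follows: one for $m$, plus the number of parameters in the choice of $\hat s$, the parallel null lines of $d+m\eta$ being in bijection (via a trivialisation $T(m)$ with $T(m)\cdot(d+m\eta)=d$, $\hat s=T(m)^{-1}\hat L$) with constant $\hat L\in\mathbb{P}(\mathcal{L})$, which has dimension 4. Thus the 3-parameter family consists, for each $m$, of a 2-parameter family of such $\hat s$.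
   Formalization: The surface immerses on a dense set; the transforms are found near each point, not on the whole surface; m ranges over the open non-empty set where the space orthogonal to p(m), q(m) has a timelike vector, as for other m (small m in the 3-sphere) no 2-parameter family of null lines exists. *)

theory Defs
  imports "HOL-Analysis.Analysis"
begin

section \<open>Smooth maps and smooth surfaces\<close>

text \<open>Only used for open subsets \<open>S\<close> of Euclidean spaces, where \<open>C\<^sup>k\<close> in the sense of iterated
  directional derivatives is the usual notion.\<close>

primrec Ck_on :: "nat \<Rightarrow> 'a::real_normed_vector set \<Rightarrow> ('a \<Rightarrow> 'b::real_normed_vector) \<Rightarrow> bool" where
  "Ck_on 0 S g \<longleftrightarrow> continuous_on S g"
| "Ck_on (Suc k) S g \<longleftrightarrow>
     g differentiable_on S \<and> (\<forall>v. Ck_on k S (\<lambda>x. frechet_derivative g (at x) v))"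

definition smooth_on :: "'a::real_normed_vector set \<Rightarrow> ('a \<Rightarrow> 'b::real_normed_vector) \<Rightarrow> bool" where
  "smooth_on S g \<longleftrightarrow> (\<forall>k. Ck_on k S g)"

text \<open>A chart is a pair of its domain and its coordinate map.\<close>

type_synonym 'p chart = "'p set \<times> ('p \<Rightarrow> real^2)"

abbreviation dom_chart :: "'p chart \<Rightarrow> 'p set" where "dom_chart \<phi> \<equiv> fst \<phi>"
abbreviation coord :: "'p chart \<Rightarrow> 'p \<Rightarrow> real^2" where "coord \<phi> \<equiv> snd \<phi>"
abbreviation point :: "'p chart \<Rightarrow> real^2 \<Rightarrow> 'p" where "point \<phi> \<equiv> inv_into (dom_chart \<phi>) (coord \<phi>)"

text \<open>The surface \<open>\<Sigma>\<close> is the whole type \<open>'p\<close>, with the smooth structure given by the atlas.\<close>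

definition smooth_surface :: "('p::{t2_space,second_countable_topology}) chart set \<Rightarrow> bool" where
  "smooth_surface A \<longleftrightarrow>
     (\<Union>\<phi>\<in>A. dom_chart \<phi>) = UNIV \<and>
     (\<forall>\<phi>\<in>A. open (dom_chart \<phi>) \<and> open (coord \<phi> ` dom_chart \<phi>) \<and>
        homeomorphism (dom_chart \<phi>) (coord \<phi> ` dom_chart \<phi>) (coord \<phi>) (point \<phi>)) \<and>
     (\<forall>\<phi>\<in>A. \<forall>\<psi>\<in>A.
        smooth_on (coord \<phi> ` (dom_chart \<phi> \<inter> dom_chart \<psi>)) (coord \<psi> \<circ> point \<phi>))"

definition smooth_map :: "'p chart set \<Rightarrow> 'p set \<Rightarrow> ('p \<Rightarrow> 'b::real_normed_vector) \<Rightarrow> bool" where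
  "smooth_map A S \<sigma> \<longleftrightarrow> (\<forall>\<phi>\<in>A. smooth_on (coord \<phi> ` (dom_chart \<phi> \<inter> S)) (\<sigma> \<circ> point \<phi>))"

text \<open>A tangent vector at \<open>x\<close> is given by its components \<open>v\<close> in a chart \<open>\<phi>\<close> around \<open>x\<close>;
  \<open>D \<phi> \<sigma> x v\<close> is the derivative of \<open>\<sigma>\<close> along it.\<close>

definition D :: "'p chart \<Rightarrow> ('p \<Rightarrow> 'b::real_normed_vector) \<Rightarrow> 'p \<Rightarrow> real^2 \<Rightarrow> 'b" where
  "D \<phi> \<sigma> x v = frechet_derivative (\<sigma> \<circ> point \<phi>) (at (coord \<phi> x)) v"


section \<open>The space $\mathbb{R}^{4,2}$ and its subbundles\<close>

type_synonym R42 = "(real^4) \<times> (real^2)"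

definition lip :: "R42 \<Rightarrow> R42 \<Rightarrow> real" where
  "lip v w = fst v \<bullet> fst w - snd v \<bullet> snd w"

definition lightcone :: "R42 set" where
  "lightcone = {y. y \<noteq> 0 \<and> lip y y = 0}"

definition perp :: "R42 set \<Rightarrow> R42 set" where
  "perp W = {v. \<forall>w\<in>W. lip v w = 0}"

definition isotropic :: "R42 set \<Rightarrow> bool" where
  "isotropic W \<longleftrightarrow> (\<forall>v\<in>W. \<forall>w\<in>W. lip v w = 0)"

text \<open>The element \<open>a \<and> b\<close> of \<open>\<and>\<^sup>2 \<real>\<^sup>4\<^sup>,\<^sup>2\<close>, viewed as an element of \<open>\<o>(4,2)\<close>.\<close>

definition wedge :: "R42 \<Rightarrow> R42 \<Rightarrow> R42 \<Rightarrow> R42" where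
  "wedge a b z = lip a z *\<^sub>R b - lip b z *\<^sub>R a"

text \<open>The subspace \<open>V \<and> W\<close>; scalars in linear combinations are absorbed into the factors.\<close>

definition wedge_space :: "R42 set \<Rightarrow> R42 set \<Rightarrow> (R42 \<Rightarrow> R42) set" where
  "wedge_space V W = {\<theta>. \<exists>(n::nat) u w. (\<forall>i<n. u i \<in> V \<and> w i \<in> W) \<and>
     \<theta> = (\<lambda>z. \<Sum>i<n. wedge (u i) (w i) z)}"

type_synonym 'p vbundle = "'p \<Rightarrow> R42 set"

definition section_of :: "'p chart set \<Rightarrow> 'p set \<Rightarrow> 'p vbundle \<Rightarrow> ('p \<Rightarrow> R42) \<Rightarrow> bool" where
  "section_of A S W \<sigma> \<longleftrightarrow> smooth_map A S \<sigma> \<and> (\<forall>x\<in>S. \<sigma> x \<in> W x)"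

definition local_section ::
  "'p::topological_space chart set \<Rightarrow> 'p set \<Rightarrow> 'p vbundle \<Rightarrow> 'p \<Rightarrow> ('p \<Rightarrow> R42) \<Rightarrow> bool" where
  "local_section A S W x \<sigma> \<longleftrightarrow> (\<exists>N. open N \<and> x \<in> N \<and> N \<subseteq> S \<and> section_of A N W \<sigma>)"

definition subbundle :: "'p::topological_space chart set \<Rightarrow> 'p set \<Rightarrow> nat \<Rightarrow> 'p vbundle \<Rightarrow> bool" where
  "subbundle A S n W \<longleftrightarrow>
     (\<forall>x\<in>S. subspace (W x) \<and> dim (W x) = n \<and>
        (\<exists>N \<sigma>. open N \<and> x \<in> N \<and> N \<subseteq> S \<and> (\<forall>i<n. section_of A N W (\<sigma> i)) \<and>
           (\<forall>y\<in>N. W y = span ((\<lambda>i. \<sigma> i y) ` {..<n}))))"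

text \<open>The fibre of \<open>W\<^sup>(\<^sup>1\<^sup>)\<close> at \<open>x\<close>.\<close>

definition derived :: "'p::topological_space chart set \<Rightarrow> 'p set \<Rightarrow> 'p vbundle \<Rightarrow> 'p vbundle" where
  "derived A S W x = span
     ({\<sigma> x | \<sigma>. local_section A S W x \<sigma>} \<union>
      {D \<phi> \<sigma> x v | \<phi> \<sigma> v. \<phi> \<in> A \<and> x \<in> dom_chart \<phi> \<and> local_section A S W x \<sigma>})"


section \<open>Legendre maps and curvature spheres\<close>

definition legendre_map :: "'p::topological_space chart set \<Rightarrow> 'p set \<Rightarrow> 'p vbundle \<Rightarrow> bool" where
  "legendre_map A S f \<longleftrightarrow>
     subbundle A S 2 f \<and> (\<forall>x\<in>S. isotropic (f x)) \<and>
     (\<forall>x\<in>S. derived A S f x \<subseteq> perp (f x)) \<and>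
     (\<forall>x\<in>S. \<forall>\<phi>\<in>A. x \<in> dom_chart \<phi> \<longrightarrow>
        (\<forall>v. (\<forall>\<sigma>. local_section A S f x \<sigma> \<longrightarrow> D \<phi> \<sigma> x v \<in> f x) \<longrightarrow> v = 0))"

text \<open>For a line \<open>L \<le> f(x)\<close>, the maximal subspace \<open>T\<^sub>L\<close> of the tangent space at \<open>x\<close> along which
  \<open>\<sigma> \<mapsto> d\<^sub>X \<sigma> mod f\<close> kills \<open>L\<close>. This map only depends on the value of the section at \<open>x\<close>.\<close>

definition curvature_space ::
  "'p::topological_space chart set \<Rightarrow> 'p set \<Rightarrow> 'p vbundle \<Rightarrow> 'p chart \<Rightarrow> 'p \<Rightarrow> R42 set \<Rightarrow> (real^2) set" where
  "curvature_space A S f \<phi> x L =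
     {v. \<forall>\<sigma>. local_section A S f x \<sigma> \<and> \<sigma> x \<in> L \<longrightarrow> D \<phi> \<sigma> x v \<in> f x}"

definition curvature_sphere ::
  "'p::topological_space chart set \<Rightarrow> 'p set \<Rightarrow> 'p vbundle \<Rightarrow> 'p \<Rightarrow> R42 set \<Rightarrow> bool" where
  "curvature_sphere A S f x L \<longleftrightarrow>
     subspace L \<and> dim L = 1 \<and> L \<subseteq> f x \<and>
     (\<forall>\<phi>\<in>A. x \<in> dom_chart \<phi> \<longrightarrow> curvature_space A S f \<phi> x L \<noteq> {0})"

definition umbilic_free :: "'p::topological_space chart set \<Rightarrow> 'p set \<Rightarrow> 'p vbundle \<Rightarrow> bool" where
  "umbilic_free A S f \<longleftrightarrow>
     (\<exists>s1 s2. subbundle A S 1 s1 \<and> subbundle A S 1 s2 \<and>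
        (\<forall>x\<in>S. s1 x \<noteq> s2 x \<and> {L. curvature_sphere A S f x L} = {s1 x, s2 x}))"


section \<open>Linear Weingarten surfaces in space forms\<close>

definition space_form_vectors :: "R42 \<Rightarrow> R42 \<Rightarrow> bool" where
  "space_form_vectors \<pp> \<qq> \<longleftrightarrow> \<bar>lip \<pp> \<pp>\<bar> = 1 \<and> \<qq> \<noteq> 0 \<and> lip \<qq> \<pp> = 0"

definition space_form :: "R42 \<Rightarrow> R42 \<Rightarrow> R42 set" where
  "space_form \<pp> \<qq> = {y\<in>lightcone. lip y \<qq> = -1 \<and> lip y \<pp> = 0}"

text \<open>\<open>\<ff>\<close> is the projection and \<open>\<tt>\<close> the tangent plane congruence of \<open>f\<close> on \<open>S\<close>.\<close>

definition projects_to ::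
  "'p chart set \<Rightarrow> 'p set \<Rightarrow> 'p vbundle \<Rightarrow> R42 \<Rightarrow> R42 \<Rightarrow> ('p \<Rightarrow> R42) \<Rightarrow> ('p \<Rightarrow> R42) \<Rightarrow> bool" where
  "projects_to A S f \<pp> \<qq> \<ff> \<tt> \<longleftrightarrow>
     section_of A S f \<ff> \<and> section_of A S f \<tt> \<and>
     (\<forall>x\<in>S. \<ff> x \<in> space_form \<pp> \<qq> \<and> lip (\<tt> x) \<qq> = 0 \<and> lip (\<tt> x) \<pp> = -1)"

definition immerses_at :: "'p chart set \<Rightarrow> ('p \<Rightarrow> R42) \<Rightarrow> 'p \<Rightarrow> bool" where
  "immerses_at A \<ff> x \<longleftrightarrow>
     (\<forall>\<phi>\<in>A. x \<in> dom_chart \<phi> \<longrightarrow> (\<forall>v. D \<phi> \<ff> x v = 0 \<longrightarrow> v = 0))"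

definition principal_curvatures ::
  "'p::topological_space chart set \<Rightarrow> 'p set \<Rightarrow> 'p vbundle \<Rightarrow> ('p \<Rightarrow> R42) \<Rightarrow> ('p \<Rightarrow> R42) \<Rightarrow> 'p \<Rightarrow>
     real \<Rightarrow> real \<Rightarrow> bool" where
  "principal_curvatures A S f \<ff> \<tt> x \<kappa>1 \<kappa>2 \<longleftrightarrow>
     (\<exists>L1 L2. L1 \<noteq> L2 \<and> {L. curvature_sphere A S f x L} = {L1, L2} \<and>
        (\<forall>\<phi>\<in>A. x \<in> dom_chart \<phi> \<longrightarrow>
           (\<forall>v\<in>curvature_space A S f \<phi> x L1. D \<phi> \<tt> x v + \<kappa>1 *\<^sub>R D \<phi> \<ff> x v = 0) \<and>
           (\<forall>v\<in>curvature_space A S f \<phi> x L2. D \<phi> \<tt> x v + \<kappa>2 *\<^sub>R D \<phi> \<ff> x v = 0)))"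

text \<open>The equation \<open>a K + 2 b H + c = 0\<close> where \<open>\<ff>\<close> immerses. As a surface may fail to immerse
  somewhere, but not on an open set (there the equation would be void), the points where it
  immerses are required to be dense.\<close>

definition linear_weingarten ::
  "'p::topological_space chart set \<Rightarrow> 'p set \<Rightarrow> 'p vbundle \<Rightarrow> ('p \<Rightarrow> R42) \<Rightarrow> ('p \<Rightarrow> R42) \<Rightarrow>
     real \<Rightarrow> real \<Rightarrow> real \<Rightarrow> bool" where
  "linear_weingarten A S f \<ff> \<tt> a b c \<longleftrightarrow>
     (a, b, c) \<noteq> (0, 0, 0) \<and>
     S \<subseteq> closure {x\<in>S. immerses_at A \<ff> x} \<and>
     (\<forall>x\<in>S. immerses_at A \<ff> x \<longrightarrow>
        (\<exists>\<kappa>1 \<kappa>2. principal_curvatures A S f \<ff> \<tt> x \<kappa>1 \<kappa>2 \<and>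
           (let K = \<kappa>1 * \<kappa>2; H = (\<kappa>1 + \<kappa>2) / 2 in a * K + 2 * b * H + c = 0)))"

text \<open>\<open>f\<close> is the Legendre lift of an umbilic-free linear Weingarten surface \<open>\<ff>\<close> in the space form of
  \<open>\<pp>, \<qq>\<close>. Since \<open>\<pp>, \<qq>\<close> are linearly independent, the linear Weingarten condition, i.e. the class of
  \<open>a \<qq>\<odot>\<qq> + 2 b \<qq>\<odot>\<pp> + c \<pp>\<odot>\<pp>\<close>, is the triple \<open>a, b, c\<close> up to scale.\<close>

definition umbilic_free_lw_surface ::
  "'p::topological_space chart set \<Rightarrow> 'p set \<Rightarrow> 'p vbundle \<Rightarrow> R42 \<Rightarrow> R42 \<Rightarrow>
     ('p \<Rightarrow> R42) \<Rightarrow> ('p \<Rightarrow> R42) \<Rightarrow> real \<Rightarrow> real \<Rightarrow> real \<Rightarrow> bool" where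
  "umbilic_free_lw_surface A S f \<pp> \<qq> \<ff> \<tt> a b c \<longleftrightarrow>
     legendre_map A S f \<and> umbilic_free A S f \<and> projects_to A S f \<pp> \<qq> \<ff> \<tt> \<and>
     linear_weingarten A S f \<ff> \<tt> a b c"

definition non_tubular :: "real \<Rightarrow> real \<Rightarrow> real \<Rightarrow> bool" where
  "non_tubular a b c \<longleftrightarrow> b\<^sup>2 - a * c \<noteq> 0"


section \<open>$\Omega$-surfaces and their Darboux transforms\<close>

text \<open>A 1-form with values in \<open>\<o>(4,2)\<close> is given by its value \<open>\<eta> \<phi> x v\<close> on the tangent vector at \<open>x\<close>
  with components \<open>v\<close> in the chart \<open>\<phi>\<close>.\<close>

type_synonym 'p form = "'p chart \<Rightarrow> 'p \<Rightarrow> real^2 \<Rightarrow> R42 \<Rightarrow> R42"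

definition one_form :: "'p chart set \<Rightarrow> 'p set \<Rightarrow> 'p form \<Rightarrow> bool" where
  "one_form A S \<eta> \<longleftrightarrow>
     (\<forall>\<phi>\<in>A. \<forall>x\<in>S \<inter> dom_chart \<phi>. \<forall>z. linear (\<lambda>v. \<eta> \<phi> x v z)) \<and>
     (\<forall>\<phi>\<in>A. \<forall>v z. smooth_on (coord \<phi> ` (dom_chart \<phi> \<inter> S)) ((\<lambda>x. \<eta> \<phi> x v z) \<circ> point \<phi>)) \<and>
     (\<forall>\<phi>\<in>A. \<forall>\<psi>\<in>A. \<forall>x\<in>S \<inter> dom_chart \<phi> \<inter> dom_chart \<psi>. \<forall>v.
        \<eta> \<phi> x v = \<eta> \<psi> x (D \<phi> (coord \<psi>) x v))"

text \<open>\<open>d\<eta>(X,Y) = 0\<close> for coordinate vector fields \<open>X, Y\<close>, whose Lie bracket vanishes.\<close>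

definition closed_form :: "'p chart set \<Rightarrow> 'p set \<Rightarrow> 'p form \<Rightarrow> bool" where
  "closed_form A S \<eta> \<longleftrightarrow>
     (\<forall>\<phi>\<in>A. \<forall>x\<in>S \<inter> dom_chart \<phi>. \<forall>v w z.
        D \<phi> (\<lambda>y. \<eta> \<phi> y w z) x v - D \<phi> (\<lambda>y. \<eta> \<phi> y v z) x w = 0)"

definition trace_on :: "'a::real_vector set \<Rightarrow> ('a \<Rightarrow> 'a) \<Rightarrow> real" where
  "trace_on W g =
     (let B = (SOME B. independent B \<and> span B = W) in \<Sum>b\<in>B. representation B (g b) b)"

text \<open>\<open>q(X,Y) = tr(\<sigma> \<mapsto> \<eta>(X) d\<^sub>Y \<sigma> : f \<rightarrow> f)\<close>. A vector of \<open>f(x)\<close> is extended to a local section in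
  order to be differentiated; as \<open>\<eta>\<close> takes values in \<open>f \<and> f\<^sup>\<bottom>\<close>, the choice does not matter.\<close>

definition quadratic_differential ::
  "'p::topological_space chart set \<Rightarrow> 'p set \<Rightarrow> 'p vbundle \<Rightarrow> 'p form \<Rightarrow> 'p chart \<Rightarrow> 'p \<Rightarrow>
     real^2 \<Rightarrow> real^2 \<Rightarrow> real" where
  "quadratic_differential A S f \<eta> \<phi> x v w =
     trace_on (f x)
       (\<lambda>u. \<eta> \<phi> x v (D \<phi> (SOME \<sigma>. local_section A S f x \<sigma> \<and> \<sigma> x = u) x w))"

definition omega_surface ::
  "'p::topological_space chart set \<Rightarrow> 'p set \<Rightarrow> 'p vbundle \<Rightarrow> 'p form \<Rightarrow> bool" where
  "omega_surface A S f \<eta> \<longleftrightarrow>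
     legendre_map A S f \<and> one_form A S \<eta> \<and>
     (\<forall>\<phi>\<in>A. \<forall>x\<in>S \<inter> dom_chart \<phi>. \<forall>v. \<eta> \<phi> x v \<in> wedge_space (f x) (perp (f x))) \<and>
     closed_form A S \<eta> \<and>
     (\<forall>\<phi>\<in>A. \<forall>x\<in>S \<inter> dom_chart \<phi>. \<forall>v w. \<eta> \<phi> x v \<circ> \<eta> \<phi> x w = \<eta> \<phi> x w \<circ> \<eta> \<phi> x v) \<and>
     (\<exists>G. open G \<and> G \<subseteq> S \<and> S \<subseteq> closure G \<and>
        (\<forall>x\<in>G. \<forall>\<phi>\<in>A. x \<in> dom_chart \<phi> \<longrightarrow>
           (\<forall>v. v \<noteq> 0 \<longrightarrow> (\<exists>w. quadratic_differential A S f \<eta> \<phi> x v w \<noteq> 0))))"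

definition eta_mid :: "('p \<Rightarrow> R42) \<Rightarrow> ('p \<Rightarrow> R42) \<Rightarrow> real \<Rightarrow> real \<Rightarrow> real \<Rightarrow> 'p form" where
  "eta_mid \<ff> \<tt> a b c \<phi> x v = (\<lambda>z.
     c *\<^sub>R wedge (\<ff> x) (D \<phi> \<ff> x v) z
     - b *\<^sub>R (wedge (\<ff> x) (D \<phi> \<tt> x v) z + wedge (\<tt> x) (D \<phi> \<ff> x v) z)
     + a *\<^sub>R wedge (\<tt> x) (D \<phi> \<tt> x v) z)"

definition parallel_subbundle ::
  "'p::topological_space chart set \<Rightarrow> 'p set \<Rightarrow> 'p form \<Rightarrow> real \<Rightarrow> 'p vbundle \<Rightarrow> bool" where
  "parallel_subbundle A S \<eta> m s \<longleftrightarrow>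
     (\<forall>x\<in>S. \<forall>\<phi>\<in>A. x \<in> dom_chart \<phi> \<longrightarrow>
        (\<forall>\<sigma> v. local_section A S s x \<sigma> \<longrightarrow> D \<phi> \<sigma> x v + m *\<^sub>R \<eta> \<phi> x v (\<sigma> x) \<in> s x))"

text \<open>On the open set \<open>S\<close>, \<open>f'\<close> is the Darboux transform of \<open>f\<close> with parameter \<open>m\<close> given by the
  parallel null line bundle \<open>s\<close>.\<close>

definition darboux_transform ::
  "'p::topological_space chart set \<Rightarrow> 'p set \<Rightarrow> 'p vbundle \<Rightarrow> 'p form \<Rightarrow> real \<Rightarrow> 'p vbundle \<Rightarrow>
     'p vbundle \<Rightarrow> bool" where
  "darboux_transform A S f \<eta> m s f' \<longleftrightarrow>
     m \<noteq> 0 \<and> subbundle A S 1 s \<and> (\<forall>x\<in>S. isotropic (s x)) \<and> parallel_subbundle A S \<eta> m s \<and>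
     (\<forall>x\<in>S. \<forall>L. curvature_sphere A S f x L \<longrightarrow> \<not> s x \<subseteq> perp L) \<and>
     (\<forall>x\<in>S. f' x = {u + w | u w. u \<in> f x \<inter> perp (s x) \<and> w \<in> s x})"

text \<open>\<open>T\<close> is an orthogonal gauge transformation with \<open>T \<sqdot> (d + m \<eta>) = d\<close>.\<close>

definition trivialisation ::
  "'p chart set \<Rightarrow> 'p set \<Rightarrow> 'p form \<Rightarrow> real \<Rightarrow> ('p \<Rightarrow> R42 \<Rightarrow> R42) \<Rightarrow> bool" where
  "trivialisation A S \<eta> m T \<longleftrightarrow>
     (\<forall>x\<in>S. linear (T x) \<and> (\<forall>v w. lip (T x v) (T x w) = lip v w)) \<and>
     (\<forall>w. smooth_map A S (\<lambda>x. T x w)) \<and>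
     (\<forall>\<sigma>. smooth_map A S \<sigma> \<longrightarrow>
        (\<forall>\<phi>\<in>A. \<forall>x\<in>S \<inter> dom_chart \<phi>. \<forall>v.
           D \<phi> (\<lambda>y. T y (\<sigma> y)) x v = T x (D \<phi> \<sigma> x v + m *\<^sub>R \<eta> \<phi> x v (\<sigma> x))))"

text \<open>\<open>u \<mapsto> \<langle>l u\<rangle>\<close> is an injective immersion of a non-empty open set of the plane into
  \<open>\<P>(\<L>)\<close>.\<close>

definition two_parameter_family :: "(real^2) set \<Rightarrow> (real^2 \<Rightarrow> R42) \<Rightarrow> bool" where
  "two_parameter_family V l \<longleftrightarrow>
     open V \<and> V \<noteq> {} \<and> smooth_on V l \<and> l ` V \<subseteq> lightcone \<and>
     (\<forall>u\<in>V. \<forall>u'\<in>V. span {l u} = span {l u'} \<longrightarrow> u = u') \<and>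
     (\<forall>u\<in>V. \<forall>w. frechet_derivative l (at u) w \<in> span {l u} \<longrightarrow> w = 0)"

text \<open>The values of the \<open>d + t \<eta>\<close>-parallel sections \<open>p(t) = \<pp> + t (- b \<ff> + a \<tt>)\<close> and
  \<open>q(t) = \<qq> + t (c \<ff> - b \<tt>)\<close>.\<close>

definition p_of :: "R42 \<Rightarrow> ('p \<Rightarrow> R42) \<Rightarrow> ('p \<Rightarrow> R42) \<Rightarrow> real \<Rightarrow> real \<Rightarrow> real \<Rightarrow> 'p \<Rightarrow> R42" where
  "p_of \<pp> \<ff> \<tt> a b t x = \<pp> + t *\<^sub>R (- b *\<^sub>R \<ff> x + a *\<^sub>R \<tt> x)"

definition q_of :: "R42 \<Rightarrow> ('p \<Rightarrow> R42) \<Rightarrow> ('p \<Rightarrow> R42) \<Rightarrow> real \<Rightarrow> real \<Rightarrow> real \<Rightarrow> 'p \<Rightarrow> R42" where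
  "q_of \<qq> \<ff> \<tt> b c t x = \<qq> + t *\<^sub>R (c *\<^sub>R \<ff> x - b *\<^sub>R \<tt> x)"

text \<open>The null lines orthogonal to \<open>p(m)\<close> and \<open>q(m)\<close> form a quadric, which has real dimension 2
  precisely when \<open>\<langle>p(m), q(m)\<rangle>\<^sup>\<bottom>\<close> contains a timelike vector. It may fail to do so: for surfaces in the
  3-sphere and small \<open>m\<close> this orthogonal complement is positive definite and contains no null line.\<close>

definition real_parameters ::
  "R42 \<Rightarrow> R42 \<Rightarrow> ('p \<Rightarrow> R42) \<Rightarrow> ('p \<Rightarrow> R42) \<Rightarrow> real \<Rightarrow> real \<Rightarrow> real \<Rightarrow> real set" where
  "real_parameters \<pp> \<qq> \<ff> \<tt> a b c =
     {m. m \<noteq> 0 \<and> (\<forall>x. \<exists>w. lip w (p_of \<pp> \<ff> \<tt> a b m x) = 0 \<and> lip w (q_of \<qq> \<ff> \<tt> b c m x) = 0 \<and>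
        lip w w < 0)}"

end

theory Submission
  imports Defs
begin

text \<open>A line of the contact element \<open>f(x)\<close> is spanned by some
  \<open>\<kappa> \<ff> + \<mu> \<tt>\<close>. For a curvature sphere \<open>s\<^sub>i\<close> the ratio \<open>\<kappa>\<^sub>i : \<mu>\<^sub>i\<close> is the principal curvature; the pair
  makes sense where \<open>\<ff>\<close> fails to immerse as well. Along the curvature directions \<open>X\<^sub>1, X\<^sub>2\<close> one has
  \<open>d\<ff> = \<mu>\<^sub>i \<xi>\<^sub>i\<close> and \<open>d\<tt> = - \<kappa>\<^sub>i \<xi>\<^sub>i\<close> with orthogonal spacelike vectors \<open>\<xi>\<^sub>1, \<xi>\<^sub>2\<close>
  (\<open>principal_frame\<close>), and the linear Weingarten equation becomes \<open>W(s\<^sub>1, s\<^sub>2) = 0\<close> for the symmetric form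
  \<open>W\<close> on \<open>f\<close> with matrix \<open>(a, b; b, c)\<close>; by continuity it holds at every point
  (\<open>weingarten_everywhere\<close>). Non-tubular means that this form is non-degenerate.

  In these terms \<open>d\<eta>(X\<^sub>1, X\<^sub>2) = 2 W(s\<^sub>1, s\<^sub>2) \<xi>\<^sub>1 \<and> \<xi>\<^sub>2 = 0\<close>, and the quadratic
  differential is diagonal with entries \<open>- W(s\<^sub>i, s\<^sub>i) |\<xi>\<^sub>i|\<^sup>2\<close>, which do not vanish because a non-degenerate form
  on a plane has no null vector among two conjugate independent ones.

  For a Darboux transform, let \<open>\<sigma>\<close> be a null section with \<open>d\<sigma> + m \<eta> \<sigma> = 0\<close>, orthogonal to the parallel sections
  \<open>p(m)\<close> and \<open>q(m)\<close>, and put \<open>\<tau> = (\<sigma>, \<tt>) \<ff> - (\<sigma>, \<ff>) \<tt>\<close>, so that the transform is \<open>\<langle>\<tau>, \<sigma>\<rangle>\<close>. The orthogonality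
  gives \<open>(\<sigma>, \<pp>)\<close> and \<open>(\<sigma>, \<qq>)\<close> in terms of \<open>(\<sigma>, \<ff>)\<close> and \<open>(\<sigma>, \<tt>)\<close>, and with them \<open>W(\<tau>, \<sigma>) = 0\<close> and
  \<open>W(\<sigma>, \<sigma>) = m\<^sup>2 (a c - b\<^sup>2) W(\<tau>, \<tau>)\<close>. The curvature spheres of the transform are \<open>\<Lambda>\<^sub>i \<tau> + (S\<^sub>i / m) \<sigma>\<close>,
  where \<open>S\<^sub>i\<close> and \<open>\<Lambda>\<^sub>i\<close> are the values of \<open>\<sigma>\<close> on \<open>s\<^sub>i\<close> and on its \<open>W\<close>-conjugate
  (\<open>new_sphere\<close>), and a computation shows that \<open>W\<close> takes the value \<open>W(\<tau>, \<tau>)\<^sup>2 W(s\<^sub>1, s\<^sub>2) = 0\<close> on them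
  (\<open>new_weingarten\<close>): the transform satisfies the same condition. What could go wrong (the transform is umbilic, has
  no projection or a projection that does not immerse, or \<open>\<sigma>\<close> is orthogonal to a curvature sphere) is
  the vanishing of one of five non-zero homogeneous polynomials in \<open>(\<sigma>, \<ff>)\<close> and \<open>(\<sigma>, \<tt>)\<close>.

  As \<open>d + m \<eta>\<close> is flat, its parallel sections are found by a Frobenius theorem for linear
  total differential equations (\<open>frobenius_ball\<close>), and a null vector at one point \<open>x\<^sub>0\<close> orthogonal to
  \<open>p(m), q(m)\<close> extends to a suitable \<open>\<sigma>\<close>. Such null vectors exist for every \<open>((\<sigma>, \<ff>), (\<sigma>, \<tt>))\<close> on which the
  Gram form of \<open>q(m), p(m)\<close> is positive, hence for a generic one, and stereographic projection from one
  of them gives a two-parameter family; the five polynomials stay non-zero near \<open>x\<^sub>0\<close> and near that null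
  vector. The third parameter is \<open>m\<close>: the Gram form is affine in \<open>m\<close> with slope \<open>- 2 W\<close>, so that the set of
  admissible \<open>m\<close> is open and not empty.\<close>

section \<open>Calculus of smooth maps\<close>

lemma Ck_on_cong:
  assumes "open S" "Ck_on k S g" "\<And>x. x \<in> S \<Longrightarrow> g x = h x"
  shows "Ck_on k S h"
  using assms(2,3)
proof (induction k arbitrary: g h)
  case 0
  then show ?case using continuous_on_cong[of S S g h] by auto
next
  case (Suc k)
  have der: "(h has_derivative frechet_derivative g (at x)) (at x)" if "x \<in> S" for x
    using Suc.prems that assms(1)
    by (metis Ck_on.simps(2) differentiable_on_eq_differentiable_at frechet_derivative_works
        has_derivative_transform_within_open)
  have "frechet_derivative h (at x) v = frechet_derivative g (at x) v" if "x \<in> S" for x v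
    using frechet_derivative_at[OF der[OF that]] by simp
  moreover have "h differentiable_on S"
    using der assms(1) by (auto simp: differentiable_on_eq_differentiable_at differentiable_def)
  ultimately show ?case
    using Suc.prems Suc.IH[of "\<lambda>x. frechet_derivative g (at x) v" "\<lambda>x. frechet_derivative h (at x) v" for v]
    by auto
qed

lemma Ck_on_subset: "Ck_on k S g \<Longrightarrow> T \<subseteq> S \<Longrightarrow> Ck_on k T g"
  by (induction k arbitrary: g) (auto intro: continuous_on_subset differentiable_on_subset)

lemma Ck_on_has_derivative:
  assumes "open S" "Ck_on (Suc k) S g" "x \<in> S"
  shows "(g has_derivative frechet_derivative g (at x)) (at x)"
  using assms by (auto simp: differentiable_on_eq_differentiable_at frechet_derivative_works)

text \<open>The form in which smoothness is established below: any explicit derivative may replace the Frechet derivative of the definition.\<close>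

lemma Ck_on_SucI:
  assumes "open S" "\<And>x. x \<in> S \<Longrightarrow> (g has_derivative g' x) (at x)"
    and "\<And>v. Ck_on k S (\<lambda>x. g' x v)"
  shows "Ck_on (Suc k) S g"
proof -
  have "g' x v = frechet_derivative g (at x) v" if "x \<in> S" for x v
    using frechet_derivative_at[OF assms(2)[OF that]] by simp
  moreover have "g differentiable_on S"
    using assms(1,2) by (auto simp: differentiable_on_eq_differentiable_at differentiable_def)
  ultimately show ?thesis
    using Ck_on_cong[OF assms(1) assms(3)] by simp
qed

lemma Ck_on_Suc_imp: "Ck_on (Suc k) S g \<Longrightarrow> Ck_on k S g"
  by (induction k arbitrary: g) (auto intro: differentiable_imp_continuous_on)

lemma Ck_on_const: "Ck_on k S (\<lambda>x. y)"
  by (induction k arbitrary: y) (simp_all add: frechet_derivative_const)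

lemma Ck_on_add:
  assumes "open S" "Ck_on k S g" "Ck_on k S h"
  shows "Ck_on k S (\<lambda>x. g x + h x)"
  using assms(2,3)
proof (induction k arbitrary: g h)
  case 0
  then show ?case by (auto intro: continuous_on_add)
next
  case (Suc k)
  show ?case
  proof (rule Ck_on_SucI[OF assms(1)])
    show "((\<lambda>x. g x + h x) has_derivative
        (\<lambda>v. frechet_derivative g (at x) v + frechet_derivative h (at x) v)) (at x)" if "x \<in> S" for x
      using Ck_on_has_derivative[OF assms(1) _ that] Suc.prems by (blast intro: has_derivative_add)
  qed (use Suc in auto)
qed

text \<open>This single product rule covers scalar multiples, scalar products and wedge products.\<close>

lemma Ck_on_bilinear:
  assumes bl: "bounded_bilinear pr" and "open S" "Ck_on k S g" "Ck_on k S h"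
  shows "Ck_on k S (\<lambda>x. pr (g x) (h x))"
  using assms(3,4)
proof (induction k arbitrary: g h)
  case 0
  then show ?case using bounded_bilinear.continuous_on[OF bl] by auto
next
  case (Suc k)
  show ?case
  proof (rule Ck_on_SucI[OF assms(2)])
    show "((\<lambda>x. pr (g x) (h x)) has_derivative
        (\<lambda>v. pr (g x) (frechet_derivative h (at x) v) + pr (frechet_derivative g (at x) v) (h x))) (at x)"
      if "x \<in> S" for x
      by (rule bounded_bilinear.FDERIV[OF bl])
        (use Ck_on_has_derivative[OF assms(2) _ that] Suc.prems in auto)
    show "Ck_on k S (\<lambda>x. pr (g x) (frechet_derivative h (at x) v) +
        pr (frechet_derivative g (at x) v) (h x))" for v
      using Suc.prems Suc.prems[THEN Ck_on_Suc_imp] by (intro Ck_on_add[OF assms(2)] Suc.IH) simp_all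
  qed
qed

lemma Ck_on_inverse:
  fixes g :: "'a::real_normed_vector \<Rightarrow> real"
  assumes "open S" "Ck_on k S g" "\<And>x. x \<in> S \<Longrightarrow> g x \<noteq> 0"
  shows "Ck_on k S (\<lambda>x. inverse (g x))"
  using assms(2)
proof (induction k)
  case 0
  then show ?case using assms(3) by (auto intro: continuous_on_inverse)
next
  case (Suc k)
  note mult = Ck_on_bilinear[OF bounded_bilinear_mult assms(1)]
  show ?case
  proof (rule Ck_on_SucI[OF assms(1)])
    show "((\<lambda>x. inverse (g x)) has_derivative
        (\<lambda>v. - 1 * (inverse (g x) * (frechet_derivative g (at x) v * inverse (g x))))) (at x)"
      if "x \<in> S" for x
      using Ck_on_has_derivative[OF assms(1) Suc.prems that] assms(3)[OF that]
      by (auto intro!: derivative_eq_intros simp: mult.assoc)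
    show "Ck_on k S (\<lambda>x. - 1 * (inverse (g x) * (frechet_derivative g (at x) v * inverse (g x))))" for v
      using Suc Suc.prems[THEN Ck_on_Suc_imp] by (intro mult Ck_on_const) simp_all
  qed
qed

lemma smooth_on_cong:
  "open S \<Longrightarrow> smooth_on S g \<Longrightarrow> (\<And>x. x \<in> S \<Longrightarrow> g x = h x) \<Longrightarrow> smooth_on S h"
  unfolding smooth_on_def using Ck_on_cong by blast

lemma smooth_on_subset: "smooth_on S g \<Longrightarrow> T \<subseteq> S \<Longrightarrow> smooth_on T g"
  unfolding smooth_on_def using Ck_on_subset by blast

lemma smooth_on_has_derivative:
  "open S \<Longrightarrow> smooth_on S g \<Longrightarrow> x \<in> S \<Longrightarrow> (g has_derivative frechet_derivative g (at x)) (at x)"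
  unfolding smooth_on_def using Ck_on_has_derivative by blast

lemma smooth_on_continuous: "smooth_on S g \<Longrightarrow> continuous_on S g"
  unfolding smooth_on_def by (metis Ck_on.simps(1))

lemma smooth_on_derivative: "smooth_on S g \<Longrightarrow> smooth_on S (\<lambda>x. frechet_derivative g (at x) v)"
  unfolding smooth_on_def by (metis Ck_on.simps(2))

lemma smooth_on_const: "smooth_on S (\<lambda>x. y)"
  by (simp add: smooth_on_def Ck_on_const)

lemma smooth_on_add: "open S \<Longrightarrow> smooth_on S g \<Longrightarrow> smooth_on S h \<Longrightarrow> smooth_on S (\<lambda>x. g x + h x)"
  by (simp add: smooth_on_def Ck_on_add)

lemma smooth_on_bilinear:
  "bounded_bilinear pr \<Longrightarrow> open S \<Longrightarrow> smooth_on S g \<Longrightarrow> smooth_on S h \<Longrightarrow>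
    smooth_on S (\<lambda>x. pr (g x) (h x))"
  by (simp add: smooth_on_def Ck_on_bilinear)

lemma smooth_on_inverse:
  fixes g :: "'a::real_normed_vector \<Rightarrow> real"
  shows "open S \<Longrightarrow> smooth_on S g \<Longrightarrow> (\<And>x. x \<in> S \<Longrightarrow> g x \<noteq> 0) \<Longrightarrow> smooth_on S (\<lambda>x. inverse (g x))"
  by (simp add: smooth_on_def Ck_on_inverse)

lemma smooth_on_bounded_linear:
  assumes "bounded_linear g"
  shows "smooth_on S g"
proof -
  have "Ck_on k S g" for k
  proof (cases k)
    case 0
    then show ?thesis using assms linear_continuous_on by auto
  next
    case (Suc k)
    have "frechet_derivative g (at x) = g" for x
      using frechet_derivative_at[OF bounded_linear_imp_has_derivative[OF assms]] by metis
    then show ?thesis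
      using Suc Ck_on_const assms by (auto intro: bounded_linear_imp_differentiable_on)
  qed
  then show ?thesis by (simp add: smooth_on_def)
qed

text \<open>Both iterated derivatives are the limit of the second difference quotient
  \<open>(g (x + s v + s w) - g (x + s v) - g (x + s w) + g x) / s\<^sup>2\<close>.\<close>

lemma second_difference_estimate:
  fixes g :: "'a::real_normed_vector \<Rightarrow> 'b::real_normed_vector"
  assumes "open S" "x \<in> S" and g: "\<And>y. y \<in> S \<Longrightarrow> (g has_derivative g' y) (at y)"
    and g2: "((\<lambda>y. g' y v) has_derivative h) (at x)" and "e > 0"
  shows "\<forall>\<^sub>F s in at_right 0.
    norm (g (x + s *\<^sub>R v + s *\<^sub>R w) - g (x + s *\<^sub>R v) - g (x + s *\<^sub>R w) + g x - (s * s) *\<^sub>R h w) \<le> e * (s * s)"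
proof -
  define L where "L = norm v + norm w + 1"
  have L: "L > 0" "norm v + norm w \<le> L" by (simp_all add: L_def add_nonneg_pos)
  define e' where "e' = e / (2 * L)"
  have e': "e' > 0" using \<open>e > 0\<close> L by (simp add: e'_def)
  obtain d where d: "d > 0" and dS: "ball x d \<subseteq> S"
    using assms(1,2) open_contains_ball by blast
  obtain d' where d': "d' > 0"
    and lin: "\<And>y. norm (y - x) < d' \<Longrightarrow> norm (g' y v - g' x v - h (y - x)) \<le> e' * norm (y - x)"
    using g2 e' unfolding has_derivative_at_alt by blast
  interpret h: bounded_linear h using g2 by (rule has_derivative_bounded_linear)
  define r where "r = min d d' / L"
  have r: "r > 0" using d d' L by (simp add: r_def)
  have "norm (g (x + s *\<^sub>R v + s *\<^sub>R w) - g (x + s *\<^sub>R v) - g (x + s *\<^sub>R w) + g x - (s * s) *\<^sub>R h w) \<le> e * (s * s)"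
    if s: "0 < s" "s < r" for s
  proof -
    have sL: "s * L < min d d'" using s(2) L by (simp add: r_def pos_less_divide_eq)
    have small: "norm (t *\<^sub>R v + t' *\<^sub>R w) \<le> s * L" if "t \<in> {0..s}" "t' \<in> {0..s}" for t t'
    proof -
      have "norm (t *\<^sub>R v + t' *\<^sub>R w) \<le> t * norm v + t' * norm w"
        using that norm_triangle_ineq[of "t *\<^sub>R v" "t' *\<^sub>R w"] by simp
      also have "\<dots> \<le> s * norm v + s * norm w" using that by (intro add_mono mult_right_mono) auto
      also have "\<dots> \<le> s * L" using L s by (simp add: ring_distribs(1)[symmetric])
      finally show ?thesis .
    qed
    have inS: "x + t *\<^sub>R v + t' *\<^sub>R w \<in> S" if "t \<in> {0..s}" "t' \<in> {0..s}" for t t'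
    proof -
      have "norm (t *\<^sub>R v + t' *\<^sub>R w) < d" using small[OF that] sL by linarith
      then have "x + (t *\<^sub>R v + t' *\<^sub>R w) \<in> ball x d"
        using norm_minus_cancel[of "t *\<^sub>R v + t' *\<^sub>R w"] by (simp add: dist_norm)
      then show ?thesis using dS by (auto simp: add.assoc)
    qed
    define k where "k t = g (x + t *\<^sub>R v + s *\<^sub>R w) - g (x + t *\<^sub>R v) - (t * s) *\<^sub>R h w" for t
    have kd: "(k has_derivative (\<lambda>u. u *\<^sub>R (g' (x + t *\<^sub>R v + s *\<^sub>R w) v - g' (x + t *\<^sub>R v) v - s *\<^sub>R h w)))
        (at t within {0..s})" if t: "t \<in> {0..s}" for t
    proof -
      have in1: "x + t *\<^sub>R v + s *\<^sub>R w \<in> S" and in2: "x + t *\<^sub>R v \<in> S"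
        using inS[OF t, of s] inS[OF t, of 0] s by auto
      interpret g1: bounded_linear "g' (x + t *\<^sub>R v + s *\<^sub>R w)"
        using g[OF in1] by (rule has_derivative_bounded_linear)
      interpret g2: bounded_linear "g' (x + t *\<^sub>R v)"
        using g[OF in2] by (rule has_derivative_bounded_linear)
      have "((\<lambda>t. g (x + t *\<^sub>R v + s *\<^sub>R w)) has_derivative (\<lambda>u. g' (x + t *\<^sub>R v + s *\<^sub>R w) (u *\<^sub>R v))) (at t within {0..s})"
        by (rule has_derivative_compose[where g = g and f = "\<lambda>t. x + t *\<^sub>R v + s *\<^sub>R w", OF _ g[OF in1]]) (auto intro!: derivative_eq_intros)
      moreover have "((\<lambda>t. g (x + t *\<^sub>R v)) has_derivative (\<lambda>u. g' (x + t *\<^sub>R v) (u *\<^sub>R v))) (at t within {0..s})"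
        by (rule has_derivative_compose[where g = g and f = "\<lambda>t. x + t *\<^sub>R v", OF _ g[OF in2]]) (auto intro!: derivative_eq_intros)
      moreover have "((\<lambda>t. (t * s) *\<^sub>R h w) has_derivative (\<lambda>u. (u * s) *\<^sub>R h w)) (at t within {0..s})"
        by (auto intro!: derivative_eq_intros)
      ultimately have "(k has_derivative (\<lambda>u. g' (x + t *\<^sub>R v + s *\<^sub>R w) (u *\<^sub>R v) - g' (x + t *\<^sub>R v) (u *\<^sub>R v) - (u * s) *\<^sub>R h w)) (at t within {0..s})"
        unfolding k_def by (intro has_derivative_diff)
      then show ?thesis by (simp add: g1.scaleR g2.scaleR scaleR_diff_right)
    qed
    have bound: "onorm (\<lambda>u. u *\<^sub>R (g' (x + t *\<^sub>R v + s *\<^sub>R w) v - g' (x + t *\<^sub>R v) v - s *\<^sub>R h w)) \<le> e * s"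
      if t: "t \<in> {0..s}" for t
    proof -
      have a: "norm (g' (x + t *\<^sub>R v + s *\<^sub>R w) v - g' x v - h (t *\<^sub>R v + s *\<^sub>R w)) \<le> e' * (s * L)"
      proof -
        have n: "norm (t *\<^sub>R v + s *\<^sub>R w) \<le> s * L" using small[OF t, of s] s by simp
        have "norm (g' (x + t *\<^sub>R v + s *\<^sub>R w) v - g' x v - h (t *\<^sub>R v + s *\<^sub>R w)) \<le> e' * norm (t *\<^sub>R v + s *\<^sub>R w)"
          using lin[of "x + t *\<^sub>R v + s *\<^sub>R w"] n sL by (simp add: add.assoc)
        also have "\<dots> \<le> e' * (s * L)" using n e' by (intro mult_left_mono) auto
        finally show ?thesis .
      qed
      have b: "norm (g' (x + t *\<^sub>R v) v - g' x v - h (t *\<^sub>R v)) \<le> e' * (s * L)"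
      proof -
        have n: "norm (t *\<^sub>R v) \<le> s * L" using small[OF t, of 0] s by simp
        have "norm (g' (x + t *\<^sub>R v) v - g' x v - h (t *\<^sub>R v)) \<le> e' * norm (t *\<^sub>R v)"
          using lin[of "x + t *\<^sub>R v"] n sL by (simp add: add.assoc)
        also have "\<dots> \<le> e' * (s * L)" using n e' by (intro mult_left_mono) auto
        finally show ?thesis .
      qed
      have "g' (x + t *\<^sub>R v + s *\<^sub>R w) v - g' (x + t *\<^sub>R v) v - s *\<^sub>R h w =
          (g' (x + t *\<^sub>R v + s *\<^sub>R w) v - g' x v - h (t *\<^sub>R v + s *\<^sub>R w)) -
          (g' (x + t *\<^sub>R v) v - g' x v - h (t *\<^sub>R v))" (is "?l = ?a - ?b")
        by (simp add: h.add h.scaleR)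
      then have "norm ?l \<le> norm ?a + norm ?b"
        by (metis norm_triangle_ineq4)
      also have "\<dots> \<le> 2 * (e' * (s * L))" using a b by linarith
      also have "\<dots> = e * s" using L by (simp add: e'_def)
      finally show ?thesis
        by (intro onorm_le) (simp add: mult.commute mult_left_mono)
    qed
    have "norm (k s - k 0) \<le> (e * s) * norm (s - 0)"
      by (rule differentiable_bound[of "{0..s}", OF _ kd bound]) (use s in auto)
    then show ?thesis using s by (simp add: k_def algebra_simps)
  qed
  then show ?thesis
    unfolding eventually_at_right_field using r by (auto intro!: exI[of _ r])
qed

lemma symmetric_second_derivative:
  fixes g :: "'a::real_normed_vector \<Rightarrow> 'b::real_normed_vector"
  assumes "open S" "x \<in> S" "\<And>y. y \<in> S \<Longrightarrow> (g has_derivative g' y) (at y)"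
    and "((\<lambda>y. g' y v) has_derivative h) (at x)" "((\<lambda>y. g' y w) has_derivative k) (at x)"
  shows "h w = k v"
proof (rule ccontr)
  assume "h w \<noteq> k v"
  define e where "e = norm (h w - k v) / 3"
  have e: "e > 0" using \<open>h w \<noteq> k v\<close> by (simp add: e_def)
  have "\<forall>\<^sub>F s in at_right 0.
      norm (g (x + s *\<^sub>R v + s *\<^sub>R w) - g (x + s *\<^sub>R v) - g (x + s *\<^sub>R w) + g x - (s * s) *\<^sub>R h w) \<le> e * (s * s)"
    by (rule second_difference_estimate[where g' = g' and v = v and h = h]) (use assms e in auto)
  moreover have "\<forall>\<^sub>F s in at_right 0.
      norm (g (x + s *\<^sub>R w + s *\<^sub>R v) - g (x + s *\<^sub>R w) - g (x + s *\<^sub>R v) + g x - (s * s) *\<^sub>R k v) \<le> e * (s * s)"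
    by (rule second_difference_estimate[where g' = g' and v = w and h = k]) (use assms e in auto)
  moreover note eventually_at_right_less[of "0::real"]
  ultimately have "\<forall>\<^sub>F s in at_right (0::real). False"
  proof eventually_elim
    case (elim s)
    let ?d = "g (x + s *\<^sub>R v + s *\<^sub>R w) - g (x + s *\<^sub>R v) - g (x + s *\<^sub>R w) + g x"
    have eq: "g (x + s *\<^sub>R w + s *\<^sub>R v) - g (x + s *\<^sub>R w) - g (x + s *\<^sub>R v) + g x = ?d"
      by (simp add: algebra_simps)
    have "norm ((s * s) *\<^sub>R (h w - k v)) \<le> norm (?d - (s * s) *\<^sub>R k v) + norm (?d - (s * s) *\<^sub>R h w)"
      using norm_triangle_ineq4[of "?d - (s * s) *\<^sub>R k v" "?d - (s * s) *\<^sub>R h w"]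
      by (simp add: algebra_simps)
    also have "\<dots> \<le> 2 * (e * (s * s))" using elim(1,2) eq by simp
    finally have "(s * s) * norm (h w - k v) \<le> (s * s) * (2 * e)"
      using elim(3) by (simp only: norm_scaleR) (simp add: mult_ac)
    then have "norm (h w - k v) \<le> 2 * e" using elim(3) by simp
    then show ?case using e by (simp add: e_def)
  qed
  then show False by simp
qed

section \<open>Linear differential equations and the Frobenius theorem\<close>

lemma norm_sum_basis_le:
  fixes b :: "'a::euclidean_space \<Rightarrow> 'b::real_normed_vector"
  assumes "linear b" "\<And>i. i \<in> Basis \<Longrightarrow> norm (b i) \<le> c"
  shows "norm (b v) \<le> (real DIM('a) * c) * norm v"
proof -
  have "b v = (\<Sum>i\<in>Basis. (v \<bullet> i) *\<^sub>R b i)"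
    using arg_cong[OF euclidean_representation[of v, symmetric], of b] assms(1)
    by (simp add: linear_sum linear_cmul)
  also have "norm \<dots> \<le> (\<Sum>i\<in>(Basis::'a set). c * norm v)"
    by (rule sum_norm_le)
      (simp add: mult.commute mult_mono' Basis_le_norm assms(2))
  finally show ?thesis by (simp add: mult_ac)
qed

text \<open>The linear equation on a time interval so short that the coefficients have norm at most
  one half: the series of iterated integrals converges geometrically.\<close>

lemma linear_ode_exists:
  fixes C :: "real \<Rightarrow> 'b::banach \<Rightarrow>\<^sub>L 'b"
  assumes cont: "continuous_on {0..1} C" and bound: "\<And>t. t \<in> {0..1} \<Longrightarrow> norm (C t) \<le> 1/2"
  shows "\<exists>F. F 0 = w \<and> (\<forall>t\<in>{0..1}. (F has_vector_derivative C t (F t)) (at t within {0..1}))"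
proof -
  define I where "I = rec_nat (\<lambda>t. w) (\<lambda>n g t. integral {0..t} (\<lambda>s. blinfun_apply (C s) (g s)))"
  have I0: "I 0 = (\<lambda>t. w)" and IS: "I (Suc n) = (\<lambda>t. integral {0..t} (\<lambda>s. C s (I n s)))" for n
    by (simp_all add: I_def)
  have Icont: "continuous_on {0..1} (I n)" for n
  proof (induction n)
    case (Suc n)
    then have "continuous_on {0..1} (\<lambda>s. C s (I n s))" by (intro continuous_intros cont)
    then show ?case unfolding IS
      by (intro indefinite_integral_continuous_1 integrable_continuous_real)
  qed (simp add: I0)
  have Icont': "continuous_on {0..1} (\<lambda>s. C s (I n s))" for n
    by (intro continuous_intros cont Icont)
  have Ib: "norm (I n t) \<le> norm w * (1/2) ^ n" if "t \<in> {0..1}" for n t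
    using that
  proof (induction n arbitrary: t)
    case (Suc n)
    have "norm (C s (I n s)) \<le> (norm w * (1/2) ^ n) * (1/2)" if "s \<in> {0..t}" for s
    proof -
      have "s \<in> {0..1}" using that Suc.prems by auto
      then show ?thesis
        using norm_blinfun[of "C s" "I n s"] mult_mono[OF bound Suc.IH, of s s]
        by (simp add: mult_ac)
    qed
    then have "norm (I (Suc n) t) \<le> (norm w * (1/2) ^ n) * (1/2) * (t - 0)"
      unfolding IS using Suc.prems
      by (intro integral_bound continuous_on_subset[OF Icont']) auto
    also have "\<dots> \<le> (norm w * (1/2) ^ n) * (1/2) * 1"
      using Suc.prems by (intro mult_left_mono) auto
    finally show ?case by (simp add: mult_ac)
  qed (simp add: I0)
  have ul: "uniform_limit {0..1} (\<lambda>n t. \<Sum>i<n. I i t) (\<lambda>t. \<Sum>i. I i t) sequentially"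
    by (rule Weierstrass_m_test[OF Ib]) (auto intro: summable_mult)
  define D' where "D' n t = (case n of 0 \<Rightarrow> 0 | Suc k \<Rightarrow> blinfun_apply (C t) (I k t))" for n t
  have der: "(I n has_derivative (\<lambda>h. h *\<^sub>R D' n t)) (at t within {0..1})" if "t \<in> {0..1}" for n t
  proof (cases n)
    case (Suc k)
    then show ?thesis
      using integral_has_vector_derivative[OF Icont' that, of k]
      by (simp add: IS D'_def has_vector_derivative_def)
  qed (simp add: I0 D'_def)
  have sumD: "(\<Sum>i<Suc n. D' i t) = C t (\<Sum>i<n. I i t)" for n t
    by (subst sum.lessThan_Suc_shift) (simp add: D'_def blinfun.sum_right)
  have "\<exists>g. \<forall>t\<in>{0..1}. (\<lambda>n. I n t) sums (g t) \<and>
      (g has_derivative (\<lambda>h. h *\<^sub>R C t (\<Sum>i. I i t))) (at t within {0..1})"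
  proof (rule has_derivative_series[where f = I and f' = "\<lambda>n t h. h *\<^sub>R D' n t" and x = 0])
    show "(\<lambda>n. I n 0) sums (\<Sum>n. I n 0)"
      by (rule summable_sums, rule summable_comparison_test'[of "\<lambda>n. norm w * (1/2) ^ n" 0])
        (auto intro: summable_mult Ib)
    fix e :: real assume "e > 0"
    then have "\<forall>\<^sub>F k in sequentially. \<forall>t\<in>{0..1}. dist (\<Sum>i<k. I i t) (\<Sum>i. I i t) < e"
      using ul by (auto simp: uniform_limit_iff)
    then have "\<forall>\<^sub>F k in sequentially. \<forall>t\<in>{0..1}. \<forall>h.
        norm ((\<Sum>i<Suc k. h *\<^sub>R D' i t) - h *\<^sub>R C t (\<Sum>i. I i t)) \<le> e * norm h"
    proof eventually_elim
      case (elim k)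
      show ?case
      proof (intro ballI allI)
        fix t h :: real assume t: "t \<in> {0..1}"
        have "norm (C t ((\<Sum>i<k. I i t) - (\<Sum>i. I i t))) \<le> (1/2) * e"
          using norm_blinfun[of "C t" "(\<Sum>i<k. I i t) - (\<Sum>i. I i t)"]
            mult_mono[OF bound[OF t], of "norm ((\<Sum>i<k. I i t) - (\<Sum>i. I i t))" e] elim t
          by (fastforce simp: dist_norm)
        then have le: "norm ((\<Sum>i<Suc k. D' i t) - C t (\<Sum>i. I i t)) \<le> e"
          using \<open>e > 0\<close> by (simp add: sumD blinfun.diff_right del: sum.lessThan_Suc)
        have "norm ((\<Sum>i<Suc k. h *\<^sub>R D' i t) - h *\<^sub>R C t (\<Sum>i. I i t)) =
            \<bar>h\<bar> * norm ((\<Sum>i<Suc k. D' i t) - C t (\<Sum>i. I i t))"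
          by (simp only: scaleR_sum_right[symmetric] scaleR_diff_right[symmetric] norm_scaleR)
        also have "\<dots> \<le> e * norm h" using mult_left_mono[OF le, of "\<bar>h\<bar>"] by (simp add: mult.commute)
        finally show "norm ((\<Sum>i<Suc k. h *\<^sub>R D' i t) - h *\<^sub>R C t (\<Sum>i. I i t)) \<le> e * norm h" .
      qed
    qed
    then show "\<forall>\<^sub>F n in sequentially. \<forall>t\<in>{0..1}. \<forall>h.
        norm ((\<Sum>i<n. h *\<^sub>R D' i t) - h *\<^sub>R C t (\<Sum>i. I i t)) \<le> e * norm h"
      by (rule iffD1[OF eventually_sequentially_Suc])
  qed (use der in auto)
  then obtain g where g: "\<And>t. t \<in> {0..1} \<Longrightarrow> (\<lambda>n. I n t) sums (g t)"
    and gd: "\<And>t. t \<in> {0..1} \<Longrightarrow> (g has_derivative (\<lambda>h. h *\<^sub>R C t (\<Sum>i. I i t))) (at t within {0..1})"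
    by blast
  have "I (Suc n) 0 = 0" for n by (simp add: IS)
  then have "(\<lambda>n. I n 0) sums (\<Sum>n<1. I n 0)"
    by (intro sums_finite) (auto simp: gr0_conv_Suc Suc_le_eq not_less)
  then have "g 0 = w" using g[of 0] sums_unique2 by (fastforce simp: I0)
  moreover have "(g has_vector_derivative C t (g t)) (at t within {0..1})" if "t \<in> {0..1}" for t
    using gd[OF that] sums_unique[OF g[OF that]] by (simp add: has_vector_derivative_def)
  ultimately show ?thesis by blast
qed

text \<open>A Gronwall estimate: on so short an interval the maximum \<open>M\<close> of \<open>|E|\<close> satisfies \<open>M \<le> |E 0| + M / 2 + e\<close>.\<close>

lemma linear_ode_bound:
  fixes C :: "real \<Rightarrow> 'b::banach \<Rightarrow>\<^sub>L 'b"
  assumes der: "\<And>t. t \<in> {0..1} \<Longrightarrow> (E has_vector_derivative C t (E t) + \<rho> t) (at t within {0..1})"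
    and bound: "\<And>t. t \<in> {0..1} \<Longrightarrow> norm (C t) \<le> 1/2"
    and \<rho>: "\<And>t. t \<in> {0..1} \<Longrightarrow> norm (\<rho> t) \<le> e" and t: "t \<in> {0..1}"
  shows "norm (E t) \<le> 2 * (norm (E 0) + e)"
proof -
  have "continuous_on {0..1} E"
    unfolding continuous_on_eq_continuous_within using der has_vector_derivative_continuous by blast
  then have "continuous_on {0..1} (\<lambda>t. norm (E t))" by (rule continuous_on_norm)
  then obtain T where T: "T \<in> {0..1}" and max: "\<And>t. t \<in> {0..1} \<Longrightarrow> norm (E t) \<le> norm (E T)"
    using continuous_attains_sup[of "{0..1::real}" "\<lambda>t. norm (E t)"] by auto
  have e: "0 \<le> e" using \<rho>[OF t] norm_ge_zero[of "\<rho> t"] by linarith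
  have "norm (E T - E 0) \<le> (norm (E T) / 2 + e) * norm (T - 0)"
  proof (rule differentiable_bound[of "{0..1}"])
    show "(E has_derivative (\<lambda>h. h *\<^sub>R (C s (E s) + \<rho> s))) (at s within {0..1})" if "s \<in> {0..1}" for s
      using der[OF that] by (simp add: has_vector_derivative_def)
    show "onorm (\<lambda>h. h *\<^sub>R (C s (E s) + \<rho> s)) \<le> norm (E T) / 2 + e" if s: "s \<in> {0..1}" for s
    proof (rule onorm_le)
      fix h :: real
      have "norm (C s (E s)) \<le> (1/2) * norm (E T)"
        using norm_blinfun[of "C s" "E s"] mult_mono[OF bound[OF s] max[OF s]] by simp
      then have "norm (C s (E s) + \<rho> s) \<le> norm (E T) / 2 + e"
        using norm_triangle_ineq[of "C s (E s)" "\<rho> s"] \<rho>[OF s] by simp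
      then show "norm (h *\<^sub>R (C s (E s) + \<rho> s)) \<le> (norm (E T) / 2 + e) * norm h"
        by (simp add: mult.commute mult_left_mono)
    qed
  qed (use T in auto)
  also have "\<dots> \<le> (norm (E T) / 2 + e) * 1" using T e by (intro mult_left_mono) auto
  finally have "norm (E T) \<le> norm (E 0) + norm (E T) / 2 + e"
    using norm_triangle_sub[of "E T" "E 0"] by simp
  then show ?thesis using max[OF t] by simp
qed

text \<open>By compactness the derivative is uniformly continuous, and the mean value inequality applies to
  segments in \<open>K\<close>.\<close>

lemma uniform_linearization:
  fixes g :: "'a::euclidean_space \<Rightarrow> 'b::real_normed_vector"
  assumes K: "compact K" "convex K"
    and der: "\<And>y. y \<in> K \<Longrightarrow> (g has_derivative g' y) (at y)"
    and cont: "\<And>u. continuous_on K (\<lambda>y. g' y u)" and "e > 0"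
  shows "\<exists>d>0. \<forall>y\<in>K. \<forall>h. norm h < d \<longrightarrow> y + h \<in> K \<longrightarrow> norm (g (y + h) - g y - g' y h) \<le> e * norm h"
proof -
  define e' where "e' = e / real DIM('a)"
  have e': "e' > 0" using \<open>e > 0\<close> by (simp add: e'_def)
  have "\<exists>d>0. \<forall>y\<in>K. \<forall>z\<in>K. dist z y < d \<longrightarrow> dist (g' z i) (g' y i) < e'" for i
    using compact_uniformly_continuous[OF cont K(1), of i] e' unfolding uniformly_continuous_on_def by blast
  then obtain \<delta> where \<delta>: "\<And>i. \<delta> i > 0"
    and unif: "\<And>i y z. y \<in> K \<Longrightarrow> z \<in> K \<Longrightarrow> dist z y < \<delta> i \<Longrightarrow> dist (g' z i) (g' y i) < e'" by metis
  define d where "d = Min (\<delta> ` (Basis :: 'a set))"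
  have d: "d > 0" "\<And>i. i \<in> Basis \<Longrightarrow> d \<le> \<delta> i" using \<delta> by (simp_all add: d_def)
  have "norm (g (y + h) - g y - g' y h) \<le> e * norm h"
    if y: "y \<in> K" and h: "norm h < d" and yh: "y + h \<in> K" for y h
  proof -
    let ?S = "closed_segment y (y + h)"
    have SK: "?S \<subseteq> K" using K(2) y yh by (simp add: closed_segment_subset)
    have on: "onorm (g' z - g' y) \<le> e" if z: "z \<in> ?S" for z
    proof (rule onorm_le)
      fix v
      have lin: "linear (g' z - g' y)"
        using has_derivative_linear[OF der] SK z y
        by (simp add: fun_diff_def subset_eq linear_compose_sub)
      have "dist z y \<le> norm h"
        using segment_bound(1)[OF z] by (simp add: dist_norm norm_minus_commute)
      then have "norm ((g' z - g' y) i) \<le> e'" if "i \<in> Basis" for i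
        using unif[OF y, of z i] SK z h d(2)[OF that] by (auto simp: dist_norm less_imp_le)
      from norm_sum_basis_le[OF lin this]
      show "norm ((g' z - g' y) v) \<le> e * norm v" by (simp add: e'_def)
    qed
    have "norm (g (y + h) - g y - g' y (y + h - y)) \<le> norm (y + h - y) * e"
    proof (rule differentiable_bound_linearization[where S = ?S])
      show "y + t *\<^sub>R (y + h - y) \<in> ?S" if "t \<in> {0..1}" for t
        using that by (auto simp: closed_segment_def algebra_simps intro!: exI[of _ t])
    qed (use der SK on in \<open>auto intro: has_derivative_at_withinI\<close>)
    then show ?thesis by (simp add: mult.commute)
  qed
  then show ?thesis using d(1) by blast
qed

text \<open>Along the ray from \<open>y0\<close> to \<open>y\<close> the solution is determined by an ordinary differential equation.
  Let \<open>F\<close> solve it; flatness says that \<open>t \<mapsto> F t + t B(y0 + t (y - y0)) h (F t)\<close> solves the equation of the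
  neighbouring ray to \<open>y + h\<close> up to an error of size \<open>o(h)\<close>. Hence the two end points differ by
  \<open>B y h (F 1) + o(h)\<close>, so that the solution is differentiable in \<open>y\<close>.\<close>

lemma frobenius_ball:
  fixes B :: "'a::euclidean_space \<Rightarrow> 'a \<Rightarrow>\<^sub>L 'b::banach \<Rightarrow>\<^sub>L 'b"
  assumes "open S" "y0 \<in> S"
    and der: "\<And>y. y \<in> S \<Longrightarrow> (B has_derivative B' y) (at y)"
    and cont: "\<And>u. continuous_on S (\<lambda>y. B' y u)"
    and flat: "\<And>y u v z. y \<in> S \<Longrightarrow> B' y u v z + B y v (B y u z) = B' y v u z + B y u (B y v z)"
  shows "\<exists>r>0. ball y0 r \<subseteq> S \<and> (\<forall>w. \<exists>s. s y0 = w \<and>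
    (\<forall>y\<in>ball y0 r. (s has_derivative (\<lambda>v. B y v (s y))) (at y)))"
proof -
  obtain R where R: "R > 0" and RS: "cball y0 R \<subseteq> S"
    using assms(1,2) open_contains_cball by blast
  let ?K = "cball y0 R"
  have Bcont: "continuous_on S B"
    using der by (meson continuous_at_imp_continuous_on has_derivative_continuous)
  obtain k where k: "k > 0" and Bk: "\<And>y. y \<in> ?K \<Longrightarrow> norm (B y) \<le> k"
  proof -
    have "bounded (B ` ?K)"
      by (intro compact_imp_bounded compact_continuous_image continuous_on_subset[OF Bcont RS] compact_cball)
    then show ?thesis using that unfolding bounded_pos by auto
  qed
  obtain k' where k': "k' > 0" and Bk': "\<And>y u. y \<in> ?K \<Longrightarrow> norm (B' y u) \<le> k' * norm u"
  proof -
    have "bounded ((\<lambda>y. B' y i) ` ?K)" for i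
      by (intro compact_imp_bounded compact_continuous_image continuous_on_subset[OF cont RS] compact_cball)
    then have "\<exists>c>0. \<forall>y\<in>?K. norm (B' y i) \<le> c" for i
      unfolding bounded_pos by auto
    then obtain c where c: "\<And>i. c i > 0" "\<And>i y. y \<in> ?K \<Longrightarrow> norm (B' y i) \<le> c i" by metis
    have "norm (B' y i) \<le> (\<Sum>i\<in>Basis. c i)" if "y \<in> ?K" "i \<in> Basis" for y i
      using c(2)[OF that(1), of i] member_le_sum[of i Basis c] c(1) that(2) by (simp add: less_imp_le)
    then have "norm (B' y u) \<le> (real DIM('a) * (\<Sum>i\<in>Basis. c i)) * norm u" if "y \<in> ?K" for y u
      using that RS by (intro norm_sum_basis_le has_derivative_linear[OF der]) auto
    moreover have "real DIM('a) * (\<Sum>i\<in>(Basis :: 'a set). c i) > 0"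
      using c(1) by (simp add: sum_pos)
    ultimately show ?thesis using that by blast
  qed
  \<comment> \<open>Within this radius the equations along the rays have coefficients of norm at most one half.\<close>
  define r where "r = min (min R 1) (1 / (2 * k))"
  have r: "r > 0" "r \<le> R" "r \<le> 1" "k * r \<le> 1/2"
  proof -
    show "r > 0" "r \<le> R" "r \<le> 1" using R k by (auto simp: r_def)
    have "k * r \<le> k * (1 / (2 * k))" using k by (intro mult_left_mono) (auto simp: r_def)
    then show "k * r \<le> 1/2" using k by simp
  qed
  define P where "P x t = y0 + t *\<^sub>R x" for x t
  have P: "P x t \<in> ?K" if "norm x < r" "t \<in> {0..1}" for x t
  proof -
    have "t * norm x \<le> 1 * norm x" using that by (intro mult_right_mono) auto
    then show ?thesis using that r by (auto simp: P_def dist_norm)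
  qed
  have Ball: "P x t \<in> S" if "norm x < r" "t \<in> {0..1}" for x t
    using P[OF that] RS by auto
  have Cb: "norm (B (P x t) x) \<le> 1/2" if "norm x < r" "t \<in> {0..1}" for x t
  proof -
    have "norm (B (P x t) x) \<le> k * r"
      using norm_blinfun[of "B (P x t)" x] mult_mono[OF Bk[OF P[OF that]], of "norm x" r] that r k by force
    then show ?thesis using r(4) by linarith
  qed
  have Pder: "(P x has_derivative (\<lambda>d. d *\<^sub>R x)) (at t within T)" for x t T
    unfolding P_def by (auto intro!: derivative_eq_intros)
  have BP: "((\<lambda>t. B (P x t)) has_vector_derivative B' (P x t) x) (at t within T)"
    if "norm x < r" "t \<in> {0..1}" for x t T
  proof -
    have "((\<lambda>t. B (P x t)) has_derivative (\<lambda>d. B' (P x t) (d *\<^sub>R x))) (at t within T)"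
      by (rule has_derivative_compose[where g = B and f = "P x", OF Pder der[OF Ball[OF that]]])
    then show ?thesis
      using has_derivative_linear[OF der[OF Ball[OF that]]] by (simp add: has_vector_derivative_def linear_cmul)
  qed
  have ex: "\<exists>F. F 0 = w \<and> (\<forall>t\<in>{0..1}. (F has_vector_derivative B (P x t) x (F t)) (at t within {0..1}))"
    if x: "norm x < r" for x w
  proof (rule linear_ode_exists[of "\<lambda>t. B (P x t) x"])
    have "continuous_on {0..1} (\<lambda>t. B (P x t))"
      unfolding continuous_on_eq_continuous_within
      using BP[OF x] has_vector_derivative_continuous by blast
    then show "continuous_on {0..1} (\<lambda>t. B (P x t) x)" by (intro continuous_intros)
  qed (use Cb[OF x] in auto)
  have "\<exists>s. s y0 = w \<and> (\<forall>y\<in>ball y0 r. (s has_derivative (\<lambda>v. B y v (s y))) (at y))" for w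
  proof -
    obtain F where F0: "\<And>x. norm x < r \<Longrightarrow> F x 0 = w"
      and F: "\<And>x t. norm x < r \<Longrightarrow> t \<in> {0..1} \<Longrightarrow>
        (F x has_vector_derivative B (P x t) x (F x t)) (at t within {0..1})"
      using ex[of _ w] by metis
    have Fb: "norm (F x t) \<le> 2 * norm w" if "norm x < r" "t \<in> {0..1}" for x t
    proof -
      have "(F x has_vector_derivative B (P x t) x (F x t) + 0) (at t within {0..1})" if "t \<in> {0..1}" for t
        using F[OF \<open>norm x < r\<close> that] by simp
      from linear_ode_bound[OF this Cb[OF \<open>norm x < r\<close>], of 0 t] show ?thesis
        using that F0[OF \<open>norm x < r\<close>] by simp
    qed
    define s where "s y = F (y - y0) 1" for y
    have main: "(s has_derivative (\<lambda>v. B y v (s y))) (at y)" if "y \<in> ball y0 r" for y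
    proof -
      define x where "x = y - y0"
      have x: "norm x < r" using that by (simp add: x_def dist_norm norm_minus_commute)
      have y: "P x 1 = y" by (simp add: P_def x_def)
      let ?b = "2 * norm w + 1"
      have b: "?b > 0" by (simp add: add_nonneg_pos)
      have est: "\<exists>d>0. \<forall>h. norm h < d \<longrightarrow> norm (s (y + h) - s y - B y h (s y)) \<le> e * norm h"
        if "e > 0" for e
      proof -
        \<comment> \<open>The defect will be at most \<open>(c |h| + e / 8) |h|\<close>, and \<open>c |h| \<le> e / 8\<close> by the choice of \<open>d\<close>.\<close>
        define e1 where "e1 = e / (8 * ?b * (1 + k))"
        have e1: "e1 > 0" using that k b by (simp add: e1_def)
        obtain d1 where d1: "d1 > 0" and lin: "\<And>y h. y \<in> ?K \<Longrightarrow> norm h < d1 \<Longrightarrow> y + h \<in> ?K \<Longrightarrow>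
            norm (B (y + h) - B y - B' y h) \<le> e1 * norm h"
        proof -
          have "\<exists>d>0. \<forall>y\<in>?K. \<forall>h. norm h < d \<longrightarrow> y + h \<in> ?K \<longrightarrow>
              norm (B (y + h) - B y - B' y h) \<le> e1 * norm h"
            by (rule uniform_linearization[OF compact_cball convex_cball _ continuous_on_subset[OF cont RS] e1])
              (use der RS in auto)
          then show ?thesis using that by metis
        qed
        define c where "c = (k * k + k' + k' * k) * ?b"
        have c: "c > 0" using k k' b by (auto simp: c_def intro!: mult_pos_pos add_pos_pos)
        define d where "d = Min {d1, r - norm x, 1, e / (8 * c)}"
        have d: "d > 0" "d \<le> d1" "d \<le> r - norm x" "d \<le> 1" "d \<le> e / (8 * c)"
          using d1 x that c by (auto simp: d_def)
        have "norm (s (y + h) - s y - B y h (s y)) \<le> e * norm h" if h: "norm h < d" for h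
        proof -
          have xh: "norm (x + h) < r" using h d(3) norm_triangle_ineq[of x h] by linarith
          \<comment> \<open>\<open>G\<close> solves the equation of the ray to \<open>y + h\<close> up to the defect \<open>\<rho>\<close>.\<close>
          define G where "G t = F x t + t *\<^sub>R B (P x t) h (F x t)" for t
          define \<rho> where "\<rho> t = - (B (P (x + h) t) (x + h) (G t) - (B (P x t) x (F x t) +
            (B (P x t) h (F x t) + t *\<^sub>R (B' (P x t) x h (F x t) + B (P x t) h (B (P x t) x (F x t))))))" for t
          have Gder: "(G has_vector_derivative (B (P x t) x (F x t) +
            (B (P x t) h (F x t) + t *\<^sub>R (B' (P x t) x h (F x t) + B (P x t) h (B (P x t) x (F x t))))))
            (at t within {0..1})" if t: "t \<in> {0..1}" for t
          proof -
            have "((\<lambda>t. B (P x t) h) has_vector_derivative B' (P x t) x h) (at t within {0..1})"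
              using bounded_linear.has_vector_derivative[OF
                  bounded_bilinear.bounded_linear_left[OF bounded_bilinear_blinfun_apply] BP[OF x t]] .
            from bounded_bilinear.has_vector_derivative[OF bounded_bilinear_blinfun_apply this F[OF x t]]
            have "((\<lambda>t. B (P x t) h (F x t)) has_vector_derivative
              B (P x t) h (B (P x t) x (F x t)) + B' (P x t) x h (F x t)) (at t within {0..1})" .
            from has_vector_derivative_scaleR[OF DERIV_ident this]
            have "((\<lambda>t. t *\<^sub>R B (P x t) h (F x t)) has_vector_derivative
              t *\<^sub>R (B (P x t) h (B (P x t) x (F x t)) + B' (P x t) x h (F x t)) + 1 *\<^sub>R B (P x t) h (F x t))
              (at t within {0..1})" .
            from has_vector_derivative_add[OF F[OF x t] this] show ?thesis
              unfolding G_def by (simp add: add_ac)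
          qed
          have \<rho>b: "norm (\<rho> t) \<le> (c * norm h + e1 * ?b * (1 + k)) * norm h" if t: "t \<in> {0..1}" for t
          proof -
            define \<beta> where "\<beta> = B (P x t)"
            define \<beta>h where "\<beta>h = B (P (x + h) t)"
            define \<beta>' where "\<beta>' = B' (P x t)"
            define Q where "Q = F x t"
            define Rm where "Rm = \<beta>h - \<beta> - \<beta>' (t *\<^sub>R h)"
            have PS: "P x t \<in> S" "P x t \<in> ?K" and Ph: "P (x + h) t = P x t + t *\<^sub>R h"
              using Ball[OF x t] P[OF x t] by (auto simp: P_def scaleR_add_right)
            interpret b': bounded_linear \<beta>'
              unfolding \<beta>'_def using der[OF PS(1)] by (rule has_derivative_bounded_linear)
            have th: "norm (t *\<^sub>R h) \<le> norm h" using t by (simp add: mult_left_le_one_le)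
            have Rm: "norm Rm \<le> e1 * norm h"
            proof -
              have "norm Rm \<le> e1 * norm (t *\<^sub>R h)"
                unfolding Rm_def \<beta>_def \<beta>h_def \<beta>'_def Ph
                using lin[OF PS(2), of "t *\<^sub>R h"] th h d(2) P[OF xh t] Ph by auto
              then show ?thesis using th e1 mult_left_mono[of "norm (t *\<^sub>R h)" "norm h" e1] by linarith
            qed
            have \<beta>h: "\<beta>h = \<beta> + t *\<^sub>R \<beta>' h + Rm" by (simp add: Rm_def b'.scaleR)
            have bk: "norm \<beta> \<le> k" and bk': "norm (\<beta>' h) \<le> k' * norm h"
              using Bk[OF PS(2)] Bk'[OF PS(2)] by (simp_all add: \<beta>_def \<beta>'_def)
            have Q: "norm Q \<le> ?b" using Fb[OF x t] by (simp add: Q_def)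
            have xh1: "norm (x + h) \<le> 1" using xh r(3) by linarith
            have h1: "norm h \<le> 1" using h d by linarith
            have G: "G t = Q + t *\<^sub>R \<beta> h Q" by (simp add: G_def Q_def \<beta>_def)
            have fl: "\<beta>' x h Q + \<beta> h (\<beta> x Q) = \<beta>' h x Q + \<beta> x (\<beta> h Q)"
              using flat[OF PS(1), of x h Q] by (simp add: \<beta>_def \<beta>'_def)
            have "- \<rho> t = \<beta>h (x + h) (G t) - (\<beta> x Q + (\<beta> h Q + t *\<^sub>R (\<beta>' h x Q + \<beta> x (\<beta> h Q))))"
              unfolding fl[symmetric] by (simp add: \<rho>_def \<beta>_def \<beta>h_def \<beta>'_def Q_def)
            also have "\<dots> = t *\<^sub>R \<beta> h (\<beta> h Q) + t *\<^sub>R \<beta>' h h Q + (t * t) *\<^sub>R \<beta>' h (x + h) (\<beta> h Q) + Rm (x + h) (G t)"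
              by (simp add: G \<beta>h blinfun.bilinear_simps algebra_simps)
            finally have \<rho>eq: "norm (\<rho> t) = norm (t *\<^sub>R \<beta> h (\<beta> h Q) + t *\<^sub>R \<beta>' h h Q +
              (t * t) *\<^sub>R \<beta>' h (x + h) (\<beta> h Q) + Rm (x + h) (G t))"
              by (metis norm_minus_cancel)
            have app: "norm (A v z) \<le> p * q * l" if "norm A \<le> p" "norm v \<le> q" "norm z \<le> l"
              for A :: "'a \<Rightarrow>\<^sub>L 'b \<Rightarrow>\<^sub>L 'b" and v z p q l
            proof -
              have "norm (A v z) \<le> norm (A v) * norm z" by (rule norm_blinfun)
              also have "\<dots> \<le> (norm A * norm v) * norm z" by (intro mult_right_mono norm_blinfun) simp
              also have "\<dots> \<le> p * q * l"
                using that order_trans[OF norm_ge_zero that(1)] order_trans[OF norm_ge_zero that(2)]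
                by (intro mult_mono) auto
              finally show ?thesis .
            qed
            have bQ: "norm (\<beta> h Q) \<le> k * norm h * ?b" by (rule app[OF bk order_refl Q])
            have sc: "norm (u *\<^sub>R z) \<le> p" if "norm z \<le> p" "u \<in> {0..1}" for u p and z :: 'b
            proof -
              have "\<bar>u\<bar> * norm z \<le> 1 * norm z" using that by (intro mult_right_mono) auto
              then show ?thesis using that by simp
            qed
            have 1: "norm (t *\<^sub>R \<beta> h (\<beta> h Q)) \<le> k * norm h * (k * norm h * ?b)"
              by (rule sc[OF app[OF bk order_refl bQ] t])
            have 2: "norm (t *\<^sub>R \<beta>' h h Q) \<le> k' * norm h * norm h * ?b"
              by (rule sc[OF app[OF bk' order_refl Q] t])
            have 3: "norm ((t * t) *\<^sub>R \<beta>' h (x + h) (\<beta> h Q)) \<le> k' * norm h * 1 * (k * norm h * ?b)"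
              by (rule sc[OF app[OF bk' xh1 bQ]]) (use t in \<open>auto simp: mult_le_one\<close>)
            have Gb: "norm (G t) \<le> ?b * (1 + k)"
            proof -
              have "k * norm h * ?b \<le> k * 1 * ?b" using h1 k b by (intro mult_mono) auto
              then have "norm (t *\<^sub>R \<beta> h Q) \<le> k * ?b" using sc[OF bQ t] by linarith
              then have "norm (G t) \<le> ?b + k * ?b"
                unfolding G using norm_triangle_ineq[of Q "t *\<^sub>R \<beta> h Q"] Q by linarith
              then show ?thesis by (simp add: algebra_simps)
            qed
            have 4: "norm (Rm (x + h) (G t)) \<le> (e1 * norm h) * 1 * (?b * (1 + k))"
              by (rule app[OF Rm xh1 Gb])
            have "norm (\<rho> t) \<le> norm (t *\<^sub>R \<beta> h (\<beta> h Q)) + norm (t *\<^sub>R \<beta>' h h Q) +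
                norm ((t * t) *\<^sub>R \<beta>' h (x + h) (\<beta> h Q)) + norm (Rm (x + h) (G t))"
              unfolding \<rho>eq by (intro norm_triangle_le add_mono order_refl)
            also have "\<dots> \<le> k * norm h * (k * norm h * ?b) + k' * norm h * norm h * ?b +
                k' * norm h * 1 * (k * norm h * ?b) + (e1 * norm h) * 1 * (?b * (1 + k))"
              by (intro add_mono 1 2 3 4)
            also have "\<dots> = (c * norm h + e1 * ?b * (1 + k)) * norm h"
              by (simp add: c_def algebra_simps)
            finally show ?thesis .
          qed
          have "((\<lambda>t. F (x + h) t - G t) has_vector_derivative
              B (P (x + h) t) (x + h) (F (x + h) t - G t) + - \<rho> t) (at t within {0..1})"
            if t: "t \<in> {0..1}" for t
            using has_vector_derivative_diff[OF F[OF xh t] Gder[OF t]]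
            by (simp add: \<rho>_def blinfun.diff_right algebra_simps)
          from linear_ode_bound[OF this Cb[OF xh], of "(c * norm h + e1 * ?b * (1 + k)) * norm h" 1]
          have "norm (F (x + h) 1 - G 1) \<le> 2 * ((c * norm h + e1 * ?b * (1 + k)) * norm h)"
            using \<rho>b F0[OF xh] F0[OF x] by (simp add: G_def)
          also have "\<dots> \<le> 2 * ((e / 8 + e / 8) * norm h)"
          proof -
            have "c * norm h \<le> c * (e / (8 * c))" using h d(5) c by (intro mult_left_mono) auto
            moreover have "e1 * ?b * (1 + k) = e / 8"
            proof -
              have "e / (8 * p * q) * p * q = e / 8" if "p > 0" "q > 0" for p q
                using that by (simp add: field_simps)
              from this[OF b, of "1 + k"] show ?thesis using k by (simp add: e1_def)
            qed
            ultimately have "c * norm h + e1 * ?b * (1 + k) \<le> e / 8 + e / 8" using c by simp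
            then show ?thesis by (intro mult_left_mono mult_right_mono) auto
          qed
          also have "\<dots> \<le> e * norm h" using \<open>e > 0\<close> by (simp add: field_simps)
          finally show ?thesis
            using y by (simp add: s_def x_def G_def algebra_simps)
        qed
        then show ?thesis using d(1) by blast
      qed
      show ?thesis
        unfolding has_derivative_at_alt
      proof (intro conjI allI impI)
        show "bounded_linear (\<lambda>v. B y v (s y))"
          by (intro bounded_linear_blinfun_apply bounded_linear_compose[OF
              bounded_bilinear.bounded_linear_left[OF bounded_bilinear_blinfun_apply]]
              blinfun.bounded_linear_right)
        fix e :: real assume "0 < e"
        then obtain d where "d > 0"
          "\<And>h. norm h < d \<Longrightarrow> norm (s (y + h) - s y - B y h (s y)) \<le> e * norm h" using est by blast
        then have "norm (s y' - s y - B y (y' - y) (s y)) \<le> e * norm (y' - y)" if "norm (y' - y) < d" for y'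
          using \<open>\<And>h. norm h < d \<Longrightarrow> norm (s (y + h) - s y - B y h (s y)) \<le> e * norm h\<close>[of "y' - y"] that by simp
        then show "\<exists>d>0. \<forall>y'. norm (y' - y) < d \<longrightarrow> norm (s y' - s y - B y (y' - y) (s y)) \<le> e * norm (y' - y)"
          using \<open>d > 0\<close> by blast
      qed
    qed
    moreover have "s y0 = w"
    proof -
      have "(F 0 has_derivative (\<lambda>h. 0)) (at t within {0..1})" if "t \<in> {0..1}" for t
        using F[of 0 t] r that by (simp add: has_vector_derivative_def)
      then have "F 0 1 = F 0 0"
        using has_derivative_zero_constant[of "{0..1::real}" "F 0"] by fastforce
      then show ?thesis using F0[of 0] r by (simp add: s_def)
    qed
    ultimately show ?thesis by blast
  qed
  moreover have "ball y0 r \<subseteq> S" using r(2) RS by (auto simp: subset_eq)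
  ultimately show ?thesis using r(1) by blast
qed

text \<open>The same for a form given by its components, which are assembled to an operator-valued map with the help of the
  rank one operators \<open>E i j b = (v \<mapsto> z \<mapsto> (v \<bullet> i) (z \<bullet> j) b)\<close>.\<close>

lemma frobenius:
  fixes B :: "'a::euclidean_space \<Rightarrow> 'a \<Rightarrow> 'b::euclidean_space \<Rightarrow> 'b"
  assumes "open S" "y0 \<in> S"
    and lin: "\<And>y z. y \<in> S \<Longrightarrow> linear (\<lambda>v. B y v z)" "\<And>y v. y \<in> S \<Longrightarrow> linear (B y v)"
    and smooth: "\<And>v z. smooth_on S (\<lambda>y. B y v z)"
    and flat: "\<And>y u v z. y \<in> S \<Longrightarrow>
      frechet_derivative (\<lambda>y. B y v z) (at y) u + B y v (B y u z) =
      frechet_derivative (\<lambda>y. B y u z) (at y) v + B y u (B y v z)"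
  shows "\<exists>r>0. ball y0 r \<subseteq> S \<and> (\<forall>w. \<exists>s. s y0 = w \<and>
    (\<forall>y\<in>ball y0 r. (s has_derivative (\<lambda>v. B y v (s y))) (at y)))"
proof -
  define E where "E i j b = blinfun_scaleR_left (blinfun_scaleR_left b o\<^sub>L blinfun_inner_left j) o\<^sub>L
    blinfun_inner_left i" for i :: 'a and j b :: 'b
  have Eapp: "E i j b v z = (v \<bullet> i) *\<^sub>R (z \<bullet> j) *\<^sub>R b" for i j b v z
    by (simp add: E_def blinfun.scaleR_left)
  have Ebl: "bounded_linear (E i j)" for i j
    unfolding E_def
    by (intro bounded_linear_compose[OF bounded_bilinear.bounded_linear_left[OF bounded_bilinear_blinfun_compose]]
        bounded_linear_compose[OF bounded_linear_blinfun_scaleR_left]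
        bounded_linear_blinfun_scaleR_left bounded_bilinear.bounded_linear_left[OF bounded_bilinear_blinfun_compose])
  define Bl where "Bl y = (\<Sum>i\<in>Basis. \<Sum>j\<in>Basis. E i j (B y i j))" for y
  define Bl' where "Bl' y u = (\<Sum>i\<in>Basis. \<Sum>j\<in>Basis. E i j (frechet_derivative (\<lambda>y. B y i j) (at y) u))" for y u
  have expand: "b v z = (\<Sum>i\<in>Basis. \<Sum>j\<in>Basis. (v \<bullet> i) *\<^sub>R (z \<bullet> j) *\<^sub>R b i j)"
    if "\<And>z. linear (\<lambda>v. b v z)" "\<And>v. linear (b v)" for b :: "'a \<Rightarrow> 'b \<Rightarrow> 'b" and v z
  proof -
    have "b v z = (\<Sum>i\<in>Basis. (v \<bullet> i) *\<^sub>R b i z)"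
      using arg_cong[OF euclidean_representation[of v, symmetric], of "\<lambda>v. b v z"] that(1)[of z]
      by (simp add: linear_sum[of "\<lambda>v. b v z"] linear_cmul[of "\<lambda>v. b v z"])
    also have "\<dots> = (\<Sum>i\<in>Basis. (v \<bullet> i) *\<^sub>R (\<Sum>j\<in>Basis. (z \<bullet> j) *\<^sub>R b i j))"
      using arg_cong[OF euclidean_representation[of z, symmetric], of "\<lambda>z. b i z" for i] that(2)
      by (simp add: linear_sum linear_cmul)
    finally show ?thesis by (simp add: scaleR_sum_right)
  qed
  have Bl: "Bl y v z = B y v z" if "y \<in> S" for y v z
    using expand[of "B y" v z] lin that by (simp add: Bl_def blinfun.sum_left Eapp)
  have Bder: "((\<lambda>y. B y v z) has_derivative frechet_derivative (\<lambda>y. B y v z) (at y)) (at y)" if "y \<in> S" for y v z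
    by (rule smooth_on_has_derivative[OF \<open>open S\<close> smooth that])
  have Blder: "(Bl has_derivative Bl' y) (at y)" if "y \<in> S" for y
    unfolding Bl_def Bl'_def
    by (intro has_derivative_sum bounded_linear.has_derivative[OF Ebl] Bder[OF that])
  have Bl': "Bl' y u v z = frechet_derivative (\<lambda>y. B y v z) (at y) u" if "y \<in> S" for y u v z
  proof -
    have "((\<lambda>y. Bl y v z) has_derivative (\<lambda>u. Bl' y u v z)) (at y)"
      by (intro bounded_linear.has_derivative[OF bounded_bilinear.bounded_linear_left[OF bounded_bilinear_blinfun_apply]]
          Blder[OF that])
    then have "((\<lambda>y. B y v z) has_derivative (\<lambda>u. Bl' y u v z)) (at y)"
      by (rule has_derivative_transform_within_open[OF _ \<open>open S\<close> that]) (rule Bl)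
    then show ?thesis using frechet_derivative_at by metis
  qed
  have cont: "continuous_on S (\<lambda>y. Bl' y u)" for u
    unfolding Bl'_def
    by (intro continuous_on_sum bounded_linear.continuous_on[OF Ebl] smooth_on_continuous
        smooth_on_derivative smooth)
  have "\<exists>r>0. ball y0 r \<subseteq> S \<and> (\<forall>w. \<exists>s. s y0 = w \<and>
    (\<forall>y\<in>ball y0 r. (s has_derivative (\<lambda>v. Bl y v (s y))) (at y)))"
    by (rule frobenius_ball[OF assms(1,2) Blder cont]) (simp_all add: Bl Bl' flat)
  then obtain r where r: "r > 0" "ball y0 r \<subseteq> S"
    and s: "\<And>w. \<exists>s. s y0 = w \<and> (\<forall>y\<in>ball y0 r. (s has_derivative (\<lambda>v. Bl y v (s y))) (at y))"
    by blast
  have "(\<lambda>v. Bl y v (s y)) = (\<lambda>v. B y v (s y))" if "y \<in> ball y0 r" for y s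
    using Bl that r(2) by auto
  then have "\<exists>s. s y0 = w \<and> (\<forall>y\<in>ball y0 r. (s has_derivative (\<lambda>v. B y v (s y))) (at y))" for w
    using s[of w] by metis
  then show ?thesis using r by blast
qed

section \<open>The scalar product of $\mathbb{R}^{4,2}$\<close>

lemma bounded_bilinear_lip: "bounded_bilinear lip"
proof -
  have "bilinear lip"
    by (auto simp: bilinear_def lip_def linear_iff algebra_simps inner_simps)
  then show ?thesis by (simp add: bilinear_conv_bounded_bilinear)
qed

interpretation lip: bounded_bilinear lip
  by (rule bounded_bilinear_lip)

lemmas lip_linear = lip.add_left lip.add_right lip.diff_left lip.diff_right lip.minus_left lip.minus_right
  lip.scaleR_left lip.scaleR_right lip.zero_left lip.zero_right

lemma lip_commute: "lip v w = lip w v"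
  by (simp add: lip_def inner_commute)

lemma lip_nondegenerate:
  assumes "\<And>w. lip v w = 0"
  shows "v = 0"
  using assms[of "(fst v, - snd v)"] by (simp add: lip_def prod_eq_iff add_nonneg_eq_0_iff)

lemma subspace_perp: "subspace (perp W)"
  by (auto simp: subspace_def perp_def lip_linear)

lemma perp_span: "perp (span W) = perp W"
proof -
  have "lip v w = 0" if v: "\<And>w. w \<in> W \<Longrightarrow> lip v w = 0" and "w \<in> span W" for v w
    using that(2) by (induction rule: span_induct_alt) (simp_all add: lip_linear v)
  then show ?thesis by (auto simp: perp_def intro: span_base)
qed

lemma span_pair: "span {a, b} = {r *\<^sub>R a + s *\<^sub>R b | r s. True}" for a b :: "'a::real_vector"
proof -
  have "x \<in> span {a, b} \<longleftrightarrow> (\<exists>k s. x - k *\<^sub>R a = s *\<^sub>R b)" for x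
    by (simp add: span_insert[of a "{b}"] span_singleton image_iff)
  then show ?thesis by (auto simp: algebra_simps)
qed

text \<open>An isotropic plane \<open>\<langle>a, b\<rangle>\<close> projects onto the negative definite factor, so that every \<open>z \<bottom> a, b\<close>
  has the same length as some vector of the positive definite factor.\<close>

lemma perp_isotropic_plane:
  assumes ind: "independent {a, b}" "a \<noteq> b" and iso: "lip a a = 0" "lip a b = 0" "lip b b = 0"
    and z: "lip z a = 0" "lip z b = 0"
  shows "lip z z \<ge> 0" "lip z z = 0 \<Longrightarrow> z \<in> span {a, b}"
proof -
  have null: "lip v v = 0 \<and> lip z v = 0 \<and> lip v z = 0" if "v \<in> span {a, b}" for v
    using that iso z by (auto simp: span_pair lip_linear lip_commute[of _ z] lip_commute[of b a])
  have lin: "linear (snd :: R42 \<Rightarrow> real^2)" by (rule bounded_linear.linear[OF bounded_linear_snd])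
  have "v = 0" if "v \<in> span {a, b}" "snd v = 0" for v
    using null[OF that(1)] that(2) by (simp add: lip_def prod_eq_iff)
  then have "inj_on snd (span {a, b})"
    using linear_injective_on_subspace_0[OF lin subspace_span] by blast
  then have "dim (snd ` {a, b}) = 2"
    using dim_image_eq[OF lin, of "{a, b}"] dim_eq_card_independent[OF ind(1)] ind(2) by simp
  then have "span (snd ` {a, b}) = UNIV"
    using dim_eq_full[of "snd ` {a, b}"] by simp
  then obtain g where g: "g \<in> span {a, b}" "snd g = snd z"
    by (metis UNIV_I imageE linear_span_image[OF lin])
  have eq: "lip z z = norm (fst (z - g)) ^ 2"
  proof -
    have "lip z z = lip (z - g) (z - g)" using null[OF g(1)] by (simp add: lip_linear)
    then show ?thesis using g(2) by (simp add: lip_def power2_norm_eq_inner)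
  qed
  then show "lip z z \<ge> 0" by simp
  assume "lip z z = 0"
  then have "z = g" using eq g(2) by (simp add: prod_eq_iff)
  then show "z \<in> span {a, b}" using g(1) by simp
qed

lemma wedge_self: "wedge a a z = 0"
  by (simp add: wedge_def)

lemma wedge_commute: "wedge a b z = - wedge b a z"
  by (simp add: wedge_def)

lemma lip_wedge_skew: "lip (wedge a b v) w = - lip v (wedge a b w)"
  by (simp add: wedge_def lip_linear lip_commute[of v] mult.commute)

section \<open>Differentiation on a surface\<close>

text \<open>The condition on \<open>x\<close>, which holds in every chart of an atlas, lets the product rule mention \<open>\<sigma> x\<close>
  without reference to the atlas.\<close>

definition hasD :: "'p chart \<Rightarrow> ('p \<Rightarrow> 'b::real_normed_vector) \<Rightarrow> 'p \<Rightarrow> (real^2 \<Rightarrow> 'b) \<Rightarrow> bool" where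
  "hasD \<phi> \<sigma> x d \<longleftrightarrow> point \<phi> (coord \<phi> x) = x \<and> ((\<sigma> \<circ> point \<phi>) has_derivative d) (at (coord \<phi> x))"

lemma hasD_D: "hasD \<phi> \<sigma> x d \<Longrightarrow> D \<phi> \<sigma> x v = d v"
  unfolding hasD_def D_def using frechet_derivative_at by metis

lemma hasD_linear: "hasD \<phi> \<sigma> x d \<Longrightarrow> linear d"
  unfolding hasD_def using has_derivative_linear by blast

lemma hasD_bilinear:
  assumes "bounded_bilinear pr" "hasD \<phi> \<sigma> x d" "hasD \<phi> \<tau> x e"
  shows "hasD \<phi> (\<lambda>y. pr (\<sigma> y) (\<tau> y)) x (\<lambda>v. pr (\<sigma> x) (e v) + pr (d v) (\<tau> x))"
  using bounded_bilinear.FDERIV[OF assms(1), of "\<sigma> \<circ> point \<phi>" d "coord \<phi> x" UNIV "\<tau> \<circ> point \<phi>" e] assms(2,3)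
  by (simp add: hasD_def comp_def)

lemma hasD_add: "hasD \<phi> \<sigma> x d \<Longrightarrow> hasD \<phi> \<tau> x e \<Longrightarrow> hasD \<phi> (\<lambda>y. \<sigma> y + \<tau> y) x (\<lambda>v. d v + e v)"
  unfolding hasD_def comp_def by (auto intro: has_derivative_add)

lemma hasD_bounded_linear: "bounded_linear g \<Longrightarrow> hasD \<phi> \<sigma> x d \<Longrightarrow> hasD \<phi> (\<lambda>y. g (\<sigma> y)) x (\<lambda>v. g (d v))"
  unfolding hasD_def comp_def by (auto intro: bounded_linear.has_derivative)

lemmas hasD_lip = hasD_bilinear[OF bounded_bilinear_lip]
lemmas hasD_scaleR = hasD_bilinear[OF bounded_bilinear_scaleR]
lemmas hasD_lip_left = hasD_bounded_linear[OF lip.bounded_linear_left]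
lemmas hasD_scaleR_right = hasD_bounded_linear[OF bounded_linear_scaleR_right]
lemmas hasD_minus = hasD_bounded_linear[OF bounded_linear_minus[OF bounded_linear_ident]]

lemma hasD_diff: "hasD \<phi> \<sigma> x d \<Longrightarrow> hasD \<phi> \<tau> x e \<Longrightarrow> hasD \<phi> (\<lambda>y. \<sigma> y - \<tau> y) x (\<lambda>v. d v - e v)"
  unfolding hasD_def comp_def by (auto intro: has_derivative_diff)

lemma hasD_unique: "hasD \<phi> \<sigma> x d \<Longrightarrow> hasD \<phi> \<sigma> x e \<Longrightarrow> d v = e v"
  by (metis hasD_D)

locale surface =
  fixes A :: "('p::{t2_space,second_countable_topology}) chart set"
  assumes surface: "smooth_surface A"
begin

lemma chart_at: "\<exists>\<phi>\<in>A. x \<in> dom_chart \<phi>"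
  using surface unfolding smooth_surface_def by blast

lemma point_coord: "\<phi> \<in> A \<Longrightarrow> x \<in> dom_chart \<phi> \<Longrightarrow> point \<phi> (coord \<phi> x) = x"
  using surface unfolding smooth_surface_def homeomorphism_def by blast

lemma coord_point: "\<phi> \<in> A \<Longrightarrow> u \<in> coord \<phi> ` (dom_chart \<phi> \<inter> S) \<Longrightarrow>
    point \<phi> u \<in> dom_chart \<phi> \<inter> S \<and> coord \<phi> (point \<phi> u) = u"
  using point_coord by fastforce

lemma open_dom_chart: "\<phi> \<in> A \<Longrightarrow> open (dom_chart \<phi>)"
  using surface unfolding smooth_surface_def by blast

lemma open_chart_image:
  assumes "\<phi> \<in> A" "open S"
  shows "open (coord \<phi> ` (dom_chart \<phi> \<inter> S))"
proof -
  have h: "homeomorphism (dom_chart \<phi>) (coord \<phi> ` dom_chart \<phi>) (coord \<phi>) (point \<phi>)"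
    and o: "open (coord \<phi> ` dom_chart \<phi>)"
    using surface assms(1) unfolding smooth_surface_def by blast+
  have "openin (top_of_set (coord \<phi> ` dom_chart \<phi>)) (coord \<phi> ` (dom_chart \<phi> \<inter> S))"
    by (rule homeomorphism_imp_open_map[OF h]) (use assms(2) in \<open>auto simp: openin_open\<close>)
  then show ?thesis using o openin_open_trans by blast
qed

lemma open_point_image:
  assumes "\<phi> \<in> A" "open V" "V \<subseteq> coord \<phi> ` dom_chart \<phi>"
  shows "open (point \<phi> ` V)"
proof -
  have h: "homeomorphism (coord \<phi> ` dom_chart \<phi>) (dom_chart \<phi>) (point \<phi>) (coord \<phi>)"
    using surface assms(1) unfolding smooth_surface_def by (blast intro: homeomorphism_symD)
  have "openin (top_of_set (dom_chart \<phi>)) (point \<phi> ` V)"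
    by (rule homeomorphism_imp_open_map[OF h]) (use assms(2,3) in \<open>auto simp: openin_open\<close>)
  then show ?thesis using open_dom_chart[OF assms(1)] openin_open_trans by blast
qed

lemma continuous_on_coord: "\<phi> \<in> A \<Longrightarrow> continuous_on (dom_chart \<phi>) (coord \<phi>)"
  using surface unfolding smooth_surface_def homeomorphism_def by blast

lemma smooth_map_hasD:
  assumes "smooth_map A N \<sigma>" "open N" "x \<in> N" "\<phi> \<in> A" "x \<in> dom_chart \<phi>"
  shows "hasD \<phi> \<sigma> x (D \<phi> \<sigma> x)"
proof -
  have "smooth_on (coord \<phi> ` (dom_chart \<phi> \<inter> N)) (\<sigma> \<circ> point \<phi>)"
    using assms(1,4) unfolding smooth_map_def by (rule bspec)
  then have "((\<sigma> \<circ> point \<phi>) has_derivative frechet_derivative (\<sigma> \<circ> point \<phi>) (at (coord \<phi> x))) (at (coord \<phi> x))"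
    by (rule smooth_on_has_derivative[OF open_chart_image[OF assms(4,2)]]) (use assms(3,5) in blast)
  then show ?thesis using point_coord assms by (simp add: hasD_def D_def[abs_def])
qed

lemma hasD_cong:
  assumes "hasD \<phi> \<sigma> x d" "open N" "x \<in> N" "\<phi> \<in> A" "x \<in> dom_chart \<phi>"
    and "\<And>y. y \<in> N \<Longrightarrow> y \<in> dom_chart \<phi> \<Longrightarrow> \<sigma> y = \<tau> y"
  shows "hasD \<phi> \<tau> x d"
proof -
  have "((\<tau> \<circ> point \<phi>) has_derivative d) (at (coord \<phi> x))"
  proof (rule has_derivative_transform_within_open[OF _ open_chart_image[OF assms(4,2)]])
    show "((\<sigma> \<circ> point \<phi>) has_derivative d) (at (coord \<phi> x))" using assms(1) by (simp add: hasD_def)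
    show "coord \<phi> x \<in> coord \<phi> ` (dom_chart \<phi> \<inter> N)" using assms(3,5) by blast
    show "(\<sigma> \<circ> point \<phi>) u = (\<tau> \<circ> point \<phi>) u" if "u \<in> coord \<phi> ` (dom_chart \<phi> \<inter> N)" for u
      using coord_point[OF assms(4) that] assms(6) by simp
  qed
  then show ?thesis using assms(1) by (simp add: hasD_def)
qed

lemma hasD_const: "\<phi> \<in> A \<Longrightarrow> x \<in> dom_chart \<phi> \<Longrightarrow> hasD \<phi> (\<lambda>y. z) x (\<lambda>v. 0)"
  using point_coord by (simp add: hasD_def comp_def)

lemma smooth_on_D:
  assumes "smooth_map A N \<sigma>" "open N" "\<phi> \<in> A"
  shows "smooth_on (coord \<phi> ` (dom_chart \<phi> \<inter> N)) ((\<lambda>y. D \<phi> \<sigma> y w) \<circ> point \<phi>)"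
proof (rule smooth_on_cong[OF open_chart_image[OF assms(3,2)]])
  show "smooth_on (coord \<phi> ` (dom_chart \<phi> \<inter> N)) (\<lambda>u. frechet_derivative (\<sigma> \<circ> point \<phi>) (at u) w)"
    using assms(1,3) unfolding smooth_map_def by (intro smooth_on_derivative) (rule bspec)
qed (use coord_point[OF assms(3)] in \<open>simp add: D_def\<close>)

lemma hasD_second:
  assumes "smooth_map A N \<sigma>" "open N" "x \<in> N" "\<phi> \<in> A" "x \<in> dom_chart \<phi>"
  shows "hasD \<phi> (\<lambda>y. D \<phi> \<sigma> y w) x (D \<phi> (\<lambda>y. D \<phi> \<sigma> y w) x)"
proof -
  have "((\<lambda>y. D \<phi> \<sigma> y w) \<circ> point \<phi> has_derivative
      frechet_derivative ((\<lambda>y. D \<phi> \<sigma> y w) \<circ> point \<phi>) (at (coord \<phi> x))) (at (coord \<phi> x))"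
    by (rule smooth_on_has_derivative[OF open_chart_image[OF assms(4,2)] smooth_on_D[OF assms(1,2,4)]])
      (use assms(3,5) in blast)
  then show ?thesis using point_coord assms by (simp add: hasD_def D_def[of \<phi> "\<lambda>y. D \<phi> \<sigma> y w", abs_def])
qed

text \<open>The components \<open>v, w\<close> in a chart stand for commuting vector fields.\<close>

lemma D_second_symmetric:
  assumes "smooth_map A N \<sigma>" "open N" "x \<in> N" "\<phi> \<in> A" "x \<in> dom_chart \<phi>"
  shows "D \<phi> (\<lambda>y. D \<phi> \<sigma> y w) x v = D \<phi> (\<lambda>y. D \<phi> \<sigma> y v) x w"
proof -
  let ?O = "coord \<phi> ` (dom_chart \<phi> \<inter> N)"
  have O: "open ?O" "coord \<phi> x \<in> ?O" using open_chart_image assms by auto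
  have 1: "((\<sigma> \<circ> point \<phi>) has_derivative D \<phi> \<sigma> (point \<phi> u)) (at u)" if "u \<in> ?O" for u
  proof -
    have u: "point \<phi> u \<in> dom_chart \<phi>" "point \<phi> u \<in> N" "coord \<phi> (point \<phi> u) = u"
      using coord_point[OF assms(4) that] by auto
    show ?thesis using smooth_map_hasD[OF assms(1,2) u(2) assms(4) u(1)] u(3) by (simp add: hasD_def)
  qed
  have 2: "((\<lambda>u. D \<phi> \<sigma> (point \<phi> u) w) has_derivative D \<phi> (\<lambda>y. D \<phi> \<sigma> y w) x) (at (coord \<phi> x))" for w
    using hasD_second[OF assms] by (simp add: hasD_def comp_def)
  show ?thesis
    by (rule symmetric_second_derivative[OF O 1 2 2])
qed

lemma D_linear: "smooth_map A N \<sigma> \<Longrightarrow> open N \<Longrightarrow> x \<in> N \<Longrightarrow> \<phi> \<in> A \<Longrightarrow> x \<in> dom_chart \<phi> \<Longrightarrow> linear (D \<phi> \<sigma> x)"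
  by (rule hasD_linear, rule smooth_map_hasD)

lemma smooth_mapD: "smooth_map A S \<sigma> \<Longrightarrow> \<phi> \<in> A \<Longrightarrow> smooth_on (coord \<phi> ` (dom_chart \<phi> \<inter> S)) (\<sigma> \<circ> point \<phi>)"
  unfolding smooth_map_def by (rule bspec)

lemma smooth_map_subset:
  assumes "smooth_map A S \<sigma>" "T \<subseteq> S"
  shows "smooth_map A T \<sigma>"
  unfolding smooth_map_def
proof
  fix \<phi> assume "\<phi> \<in> A"
  show "smooth_on (coord \<phi> ` (dom_chart \<phi> \<inter> T)) (\<sigma> \<circ> point \<phi>)"
    by (rule smooth_on_subset[OF smooth_mapD[OF assms(1) \<open>\<phi> \<in> A\<close>]]) (use assms(2) in blast)
qed

lemma smooth_map_const: "smooth_map A S (\<lambda>x. z)"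
  by (simp add: smooth_map_def comp_def smooth_on_const)

lemma smooth_map_add: "open S \<Longrightarrow> smooth_map A S \<sigma> \<Longrightarrow> smooth_map A S \<tau> \<Longrightarrow> smooth_map A S (\<lambda>x. \<sigma> x + \<tau> x)"
  by (simp add: smooth_map_def comp_def smooth_on_add open_chart_image)

lemma smooth_map_bilinear:
  assumes "bounded_bilinear pr" "open S" "smooth_map A S \<sigma>" "smooth_map A S \<tau>"
  shows "smooth_map A S (\<lambda>x. pr (\<sigma> x) (\<tau> x))"
  unfolding smooth_map_def
proof
  fix \<phi> assume "\<phi> \<in> A"
  show "smooth_on (coord \<phi> ` (dom_chart \<phi> \<inter> S)) ((\<lambda>x. pr (\<sigma> x) (\<tau> x)) \<circ> point \<phi>)"
    using smooth_on_bilinear[OF assms(1) open_chart_image[OF \<open>\<phi> \<in> A\<close> assms(2)]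
        smooth_mapD[OF assms(3) \<open>\<phi> \<in> A\<close>] smooth_mapD[OF assms(4) \<open>\<phi> \<in> A\<close>]]
    by (simp add: comp_def)
qed

lemmas smooth_map_lip = smooth_map_bilinear[OF bounded_bilinear_lip]
lemmas smooth_map_scaleR = smooth_map_bilinear[OF bounded_bilinear_scaleR]
lemmas smooth_map_mult = smooth_map_bilinear[OF bounded_bilinear_mult]

lemma smooth_map_minus: "open S \<Longrightarrow> smooth_map A S \<sigma> \<Longrightarrow> smooth_map A S (\<lambda>x. - \<sigma> x)"
  using smooth_map_scaleR[OF _ smooth_map_const[of S "-1 :: real"], of \<sigma>] by simp

lemma smooth_map_diff: "open S \<Longrightarrow> smooth_map A S \<sigma> \<Longrightarrow> smooth_map A S \<tau> \<Longrightarrow> smooth_map A S (\<lambda>x. \<sigma> x - \<tau> x)"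
  using smooth_map_add[OF _ _ smooth_map_minus, of S \<sigma> \<tau>] by simp

lemma smooth_map_divide:
  fixes \<sigma> \<tau> :: "'p \<Rightarrow> real"
  assumes "open S" "smooth_map A S \<sigma>" "smooth_map A S \<tau>" "\<And>x. x \<in> S \<Longrightarrow> \<tau> x \<noteq> 0"
  shows "smooth_map A S (\<lambda>x. \<sigma> x / \<tau> x)"
proof -
  have "smooth_map A S (\<lambda>x. inverse (\<tau> x))"
    unfolding smooth_map_def comp_def
  proof
    fix \<phi> assume "\<phi> \<in> A"
    show "smooth_on (coord \<phi> ` (dom_chart \<phi> \<inter> S)) (\<lambda>u. inverse (\<tau> (point \<phi> u)))"
      using assms(3,4) coord_point[OF \<open>\<phi> \<in> A\<close>, of _ S] \<open>\<phi> \<in> A\<close>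
      by (intro smooth_on_inverse[OF open_chart_image[OF \<open>\<phi> \<in> A\<close> assms(1)]]) (auto simp: smooth_map_def comp_def)
  qed
  then show ?thesis using smooth_map_mult[OF assms(1,2)] by (simp add: divide_inverse)
qed

lemma smooth_map_sum: "open S \<Longrightarrow> (\<And>i. i \<in> I \<Longrightarrow> smooth_map A S (\<sigma> i)) \<Longrightarrow> smooth_map A S (\<lambda>x. \<Sum>i\<in>I. \<sigma> i x)"
  by (induction I rule: infinite_finite_induct) (auto intro: smooth_map_const smooth_map_add)

lemma smooth_map_continuous_on:
  assumes "smooth_map A S \<sigma>" "open S"
  shows "continuous_on S \<sigma>"
proof -
  have "continuous (at x) \<sigma>" if x: "x \<in> S" for x
  proof -
    obtain \<phi> where \<phi>: "\<phi> \<in> A" "x \<in> dom_chart \<phi>" using chart_at by blast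
    let ?N = "dom_chart \<phi> \<inter> S"
    have "smooth_on (coord \<phi> ` ?N) (\<sigma> \<circ> point \<phi>)"
      using assms(1) \<phi>(1) unfolding smooth_map_def by (rule bspec)
    then have "continuous_on ?N (\<lambda>y. (\<sigma> \<circ> point \<phi>) (coord \<phi> y))"
      by (rule continuous_on_compose2[OF smooth_on_continuous
            continuous_on_subset[OF continuous_on_coord[OF \<phi>(1)]]]) auto
    then have "continuous_on ?N \<sigma>"
      by (rule continuous_on_eq) (use point_coord[OF \<phi>(1)] in auto)
    then show ?thesis
      using continuous_on_eq_continuous_at[of ?N \<sigma>] open_dom_chart[OF \<phi>(1)] assms(2) \<phi>(2) x by auto
  qed
  then show ?thesis by (simp add: continuous_at_imp_continuous_on)
qed

end

section \<open>Legendre maps in terms of projection and tangent plane congruence\<close>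

lemma proportional_pairs:
  fixes k m k' m' :: real
  assumes "k * m' = m * k'" "(k, m) \<noteq> (0, 0)" "(k', m') \<noteq> (0, 0)"
  shows "\<exists>c. c \<noteq> 0 \<and> k = c * k' \<and> m = c * m'"
proof (cases "k' = 0")
  case True
  then show ?thesis using assms by (intro exI[of _ "m / m'"]) auto
next
  case False
  have "m = k / k' * m'" using assms(1) False by (simp add: field_simps)
  moreover have "k \<noteq> 0" using assms False calculation by auto
  ultimately show ?thesis using False by (intro exI[of _ "k / k'"]) auto
qed

lemma independent_frame:
  assumes "lip u \<qq> = -1" "lip u \<pp> = 0" "lip w \<qq> = 0" "lip w \<pp> = -1"
  shows "independent {u, w}" "u \<noteq> w"
proof -
  show ne: "u \<noteq> w" using assms by auto
  have "w \<noteq> r *\<^sub>R u" for r using assms by (auto simp: lip_linear)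
  then have "w \<notin> span {u}" by (auto simp: span_singleton)
  moreover have "u \<noteq> 0" using assms by (auto simp: lip_linear)
  ultimately show "independent {u, w}"
    by (simp add: insert_commute[of u] independent_insert ne)
qed

context surface
begin

lemma hasD_zero_on:
  assumes "hasD \<phi> \<sigma> x d" "open N" "x \<in> N" "\<phi> \<in> A" "x \<in> dom_chart \<phi>"
    and "\<And>y. y \<in> N \<Longrightarrow> \<sigma> y = c"
  shows "d v = 0"
  using hasD_unique[OF assms(1) hasD_cong[OF hasD_const[OF assms(4,5), of c] assms(2-5)], of v] assms(6)
  by simp

end

text \<open>A Legendre map up to regularity. The single relation \<open>(\<ff>, d\<tt>) = 0\<close> expresses \<open>f\<^sup>(\<^sup>1\<^sup>) \<le> f\<^sup>\<bottom>\<close>, since all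
  other products of \<open>\<ff>, \<tt>\<close> with \<open>d\<ff>, d\<tt>\<close> follow by differentiating constants.\<close>

locale contact_lift = surface A
  for A :: "('p::{t2_space,second_countable_topology}) chart set" +
  fixes S :: "'p set" and f :: "'p vbundle" and \<pp> \<qq> :: R42 and \<ff> \<tt> :: "'p \<Rightarrow> R42"
  assumes open_S: "open S"
    and smooth_f: "smooth_map A S \<ff>" and smooth_t: "smooth_map A S \<tt>"
    and lip_ff: "x \<in> S \<Longrightarrow> lip (\<ff> x) (\<ff> x) = 0" and lip_ft: "x \<in> S \<Longrightarrow> lip (\<ff> x) (\<tt> x) = 0"
    and lip_tt: "x \<in> S \<Longrightarrow> lip (\<tt> x) (\<tt> x) = 0"
    and lip_fq: "x \<in> S \<Longrightarrow> lip (\<ff> x) \<qq> = -1" and lip_fp: "x \<in> S \<Longrightarrow> lip (\<ff> x) \<pp> = 0"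
    and lip_tq: "x \<in> S \<Longrightarrow> lip (\<tt> x) \<qq> = 0" and lip_tp: "x \<in> S \<Longrightarrow> lip (\<tt> x) \<pp> = -1"
    and fibre: "x \<in> S \<Longrightarrow> f x = span {\<ff> x, \<tt> x}"
    and contact: "x \<in> S \<Longrightarrow> \<phi> \<in> A \<Longrightarrow> x \<in> dom_chart \<phi> \<Longrightarrow> lip (\<ff> x) (D \<phi> \<tt> x v) = 0"
begin

lemmas lip_frame = lip_ff lip_ft lip_tt lip_fq lip_fp lip_tq lip_tp
  lip_ft[THEN trans[OF lip_commute]] lip_fq[THEN trans[OF lip_commute]] lip_fp[THEN trans[OF lip_commute]]
  lip_tq[THEN trans[OF lip_commute]] lip_tp[THEN trans[OF lip_commute]]

abbreviation "csphere x \<kappa> \<mu> \<equiv> \<kappa> *\<^sub>R \<ff> x + \<mu> *\<^sub>R \<tt> x"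

lemma f_mem: "x \<in> S \<Longrightarrow> r *\<^sub>R \<ff> x + s *\<^sub>R \<tt> x \<in> f x"
  by (auto simp: fibre span_pair)

lemma f_decomp: "x \<in> S \<Longrightarrow> u \<in> f x \<Longrightarrow> u = - lip u \<qq> *\<^sub>R \<ff> x - lip u \<pp> *\<^sub>R \<tt> x"
  by (auto simp: fibre span_pair lip_linear lip_frame)

lemma frame_independent:
  assumes "x \<in> S" shows "independent {\<ff> x, \<tt> x}" "\<ff> x \<noteq> \<tt> x"
  using independent_frame[OF lip_fq[OF assms] lip_fp[OF assms] lip_tq[OF assms] lip_tp[OF assms]] .

lemma dim_f: "x \<in> S \<Longrightarrow> dim (f x) = 2"
  using frame_independent[of x] by (simp add: fibre dim_span dim_eq_card_independent)

lemma f_isotropic: "x \<in> S \<Longrightarrow> u \<in> f x \<Longrightarrow> w \<in> f x \<Longrightarrow> lip u w = 0"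
  by (auto simp: fibre span_pair lip_linear lip_frame)

lemma hasD_f: "x \<in> S \<Longrightarrow> \<phi> \<in> A \<Longrightarrow> x \<in> dom_chart \<phi> \<Longrightarrow> hasD \<phi> \<ff> x (D \<phi> \<ff> x)"
  using smooth_map_hasD[OF smooth_f open_S] by blast

lemma hasD_t: "x \<in> S \<Longrightarrow> \<phi> \<in> A \<Longrightarrow> x \<in> dom_chart \<phi> \<Longrightarrow> hasD \<phi> \<tt> x (D \<phi> \<tt> x)"
  using smooth_map_hasD[OF smooth_t open_S] by blast

lemma D_frame_perp:
  assumes x: "x \<in> S" "\<phi> \<in> A" "x \<in> dom_chart \<phi>"
  shows "lip (D \<phi> \<ff> x v) (\<ff> x) = 0" "lip (D \<phi> \<ff> x v) (\<tt> x) = 0"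
    "lip (D \<phi> \<tt> x v) (\<ff> x) = 0" "lip (D \<phi> \<tt> x v) (\<tt> x) = 0"
    "lip (D \<phi> \<ff> x v) \<pp> = 0" "lip (D \<phi> \<ff> x v) \<qq> = 0" "lip (D \<phi> \<tt> x v) \<pp> = 0" "lip (D \<phi> \<tt> x v) \<qq> = 0"
proof -
  note zero = hasD_zero_on[OF _ open_S x]
  note F = hasD_f[OF x] and G = hasD_t[OF x]
  show "lip (D \<phi> \<ff> x v) (\<ff> x) = 0"
    using zero[OF hasD_lip[OF F F], of 0 v] lip_ff by (simp add: lip_commute[of "\<ff> x"])
  show "lip (D \<phi> \<tt> x v) (\<tt> x) = 0"
    using zero[OF hasD_lip[OF G G], of 0 v] lip_tt by (simp add: lip_commute[of "\<tt> x"])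
  show fG: "lip (D \<phi> \<tt> x v) (\<ff> x) = 0"
    using contact[OF x] by (simp add: lip_commute[of "\<ff> x"])
  show "lip (D \<phi> \<ff> x v) (\<tt> x) = 0"
    using zero[OF hasD_lip[OF F G], of 0 v] lip_ft contact[OF x] by simp
  show "lip (D \<phi> \<ff> x v) \<pp> = 0" using zero[OF hasD_lip_left[OF F], of \<pp> 0 v] lip_fp by simp
  show "lip (D \<phi> \<ff> x v) \<qq> = 0" using zero[OF hasD_lip_left[OF F], of \<qq> "-1" v] lip_fq by simp
  show "lip (D \<phi> \<tt> x v) \<pp> = 0" using zero[OF hasD_lip_left[OF G], of \<pp> "-1" v] lip_tp by simp
  show "lip (D \<phi> \<tt> x v) \<qq> = 0" using zero[OF hasD_lip_left[OF G], of \<qq> 0 v] lip_tq by simp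
qed

lemma D_frame_linear:
  assumes "x \<in> S" "\<phi> \<in> A" "x \<in> dom_chart \<phi>"
  shows "linear (D \<phi> \<ff> x)" "linear (D \<phi> \<tt> x)"
  using D_linear[OF smooth_f open_S assms] D_linear[OF smooth_t open_S assms] .

text \<open>In signature \<open>(4,2)\<close> an isotropic plane is maximal, so that \<open>f\<^sup>\<bottom>/f\<close> is positive definite; \<open>\<langle>\<pp>, \<qq>\<rangle>\<^sup>\<bottom>\<close> cuts a
  complement of \<open>f\<close> out of \<open>f\<^sup>\<bottom>\<close>.\<close>

lemma perp_f_positive:
  assumes "x \<in> S" "lip z (\<ff> x) = 0" "lip z (\<tt> x) = 0"
  shows "lip z z \<ge> 0" "lip z z = 0 \<Longrightarrow> lip z \<pp> = 0 \<Longrightarrow> lip z \<qq> = 0 \<Longrightarrow> z = 0"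
proof -
  note * = perp_isotropic_plane[OF frame_independent[OF assms(1)] lip_ff[OF assms(1)] lip_ft[OF assms(1)]
      lip_tt[OF assms(1)] assms(2,3)]
  show "lip z z \<ge> 0" by (rule *)
  assume "lip z z = 0" "lip z \<pp> = 0" "lip z \<qq> = 0"
  then show "z = 0" using *(2) f_decomp[OF assms(1), of z] by (simp add: fibre[OF assms(1)])
qed

text \<open>The two-form \<open>(d\<ff>, d\<tt>)\<close> is the exterior derivative of \<open>(\<ff>, d\<tt>) = 0\<close>.\<close>

lemma second_form_symmetric:
  assumes x: "x \<in> S" "\<phi> \<in> A" "x \<in> dom_chart \<phi>"
  shows "lip (D \<phi> \<ff> x v) (D \<phi> \<tt> x w) = lip (D \<phi> \<ff> x w) (D \<phi> \<tt> x v)"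
proof -
  have "lip (\<ff> x) (D \<phi> (\<lambda>y. D \<phi> \<tt> y w) x v) + lip (D \<phi> \<ff> x v) (D \<phi> \<tt> x w) = 0" for v w
  proof -
    have h: "hasD \<phi> (\<lambda>y. lip (\<ff> y) (D \<phi> \<tt> y w)) x
        (\<lambda>v. lip (\<ff> x) (D \<phi> (\<lambda>y. D \<phi> \<tt> y w) x v) + lip (D \<phi> \<ff> x v) (D \<phi> \<tt> x w))"
      by (rule hasD_lip[OF hasD_f[OF x] hasD_second[OF smooth_t open_S x]])
    show ?thesis
      by (rule hasD_zero_on[OF h open_Int[OF open_S open_dom_chart[OF x(2)]], of 0])
        (use x contact[OF _ x(2)] in auto)
  qed
  from this[of v w] this[of w v] show ?thesis
    using D_second_symmetric[OF smooth_t open_S x, of w v] by simp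
qed

text \<open>The value on \<open>u\<close>, \<open>v\<close> of the map \<open>\<sigma> \<mapsto> - d\<^sub>X \<sigma> mod f\<close>, represented in \<open>f\<^sup>\<bottom> \<inter> \<langle>\<pp>, \<qq>\<rangle>\<^sup>\<bottom>\<close>.\<close>

definition shape :: "'p chart \<Rightarrow> 'p \<Rightarrow> R42 \<Rightarrow> real^2 \<Rightarrow> R42" where
  "shape \<phi> x u v = lip u \<qq> *\<^sub>R D \<phi> \<ff> x v + lip u \<pp> *\<^sub>R D \<phi> \<tt> x v"

text \<open>Apart from derivatives of its coefficients, the derivative of a section of \<open>f\<close> is determined by its value.\<close>

lemma local_section_hasD:
  assumes "local_section A S f x \<sigma>" "\<phi> \<in> A" "x \<in> dom_chart \<phi>"
  shows "hasD \<phi> \<sigma> x (D \<phi> \<sigma> x)" "x \<in> S" "\<sigma> x \<in> f x"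
    "D \<phi> \<sigma> x v = - lip (D \<phi> \<sigma> x v) \<qq> *\<^sub>R \<ff> x - lip (D \<phi> \<sigma> x v) \<pp> *\<^sub>R \<tt> x - shape \<phi> x (\<sigma> x) v"
proof -
  obtain N where N: "open N" "x \<in> N" "N \<subseteq> S" "smooth_map A N \<sigma>" "\<And>y. y \<in> N \<Longrightarrow> \<sigma> y \<in> f y"
    using assms unfolding local_section_def section_of_def by blast
  show h: "hasD \<phi> \<sigma> x (D \<phi> \<sigma> x)" by (rule smooth_map_hasD[OF N(4,1,2) assms(2,3)])
  show x: "x \<in> S" "\<sigma> x \<in> f x" using N by auto
  have "hasD \<phi> (\<lambda>y. - lip (\<sigma> y) \<qq> *\<^sub>R \<ff> y - lip (\<sigma> y) \<pp> *\<^sub>R \<tt> y) x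
    (\<lambda>v. (- lip (\<sigma> x) \<qq> *\<^sub>R D \<phi> \<ff> x v + - lip (D \<phi> \<sigma> x v) \<qq> *\<^sub>R \<ff> x) -
      (lip (\<sigma> x) \<pp> *\<^sub>R D \<phi> \<tt> x v + lip (D \<phi> \<sigma> x v) \<pp> *\<^sub>R \<tt> x))"
    by (intro hasD_diff hasD_scaleR hasD_minus hasD_lip_left h hasD_f hasD_t x assms(2,3))
  from hasD_unique[OF h hasD_cong[OF this N(1,2) assms(2,3)], of v]
  have "D \<phi> \<sigma> x v = (- lip (\<sigma> x) \<qq> *\<^sub>R D \<phi> \<ff> x v + - lip (D \<phi> \<sigma> x v) \<qq> *\<^sub>R \<ff> x) -
      (lip (\<sigma> x) \<pp> *\<^sub>R D \<phi> \<tt> x v + lip (D \<phi> \<sigma> x v) \<pp> *\<^sub>R \<tt> x)"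
    using N(3,5) f_decomp[THEN sym] by (simp add: subset_eq)
  then show "D \<phi> \<sigma> x v = - lip (D \<phi> \<sigma> x v) \<qq> *\<^sub>R \<ff> x - lip (D \<phi> \<sigma> x v) \<pp> *\<^sub>R \<tt> x - shape \<phi> x (\<sigma> x) v"
    by (rule trans) (simp add: shape_def algebra_simps)
qed

lemma local_section_combination:
  assumes "x \<in> S"
  shows "local_section A S f x (\<lambda>y. r *\<^sub>R \<ff> y + s *\<^sub>R \<tt> y)"
  unfolding local_section_def section_of_def
  by (intro exI[of _ S] conjI open_S assms subset_refl smooth_map_add smooth_map_scaleR smooth_map_const
      smooth_f smooth_t ballI f_mem)

lemma local_section_f: "x \<in> S \<Longrightarrow> local_section A S f x \<ff>"
  and local_section_t: "x \<in> S \<Longrightarrow> local_section A S f x \<tt>"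
  using local_section_combination[of x 1 0] local_section_combination[of x 0 1] by simp_all

lemma shape_perp:
  assumes "x \<in> S" "\<phi> \<in> A" "x \<in> dom_chart \<phi>"
  shows "lip (shape \<phi> x u v) (\<ff> x) = 0" "lip (shape \<phi> x u v) (\<tt> x) = 0"
    "lip (shape \<phi> x u v) \<pp> = 0" "lip (shape \<phi> x u v) \<qq> = 0"
  by (simp_all add: shape_def lip_linear D_frame_perp[OF assms])

lemma D_local_section_mem_iff:
  assumes "local_section A S f x \<sigma>" "\<phi> \<in> A" "x \<in> dom_chart \<phi>"
  shows "D \<phi> \<sigma> x v \<in> f x \<longleftrightarrow> shape \<phi> x (\<sigma> x) v = 0"
proof
  note h = local_section_hasD[OF assms]
  show "D \<phi> \<sigma> x v \<in> f x \<Longrightarrow> shape \<phi> x (\<sigma> x) v = 0"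
    using f_decomp[OF h(2), of "D \<phi> \<sigma> x v"] h(4)[of v] by simp
  show "shape \<phi> x (\<sigma> x) v = 0 \<Longrightarrow> D \<phi> \<sigma> x v \<in> f x"
    using f_mem[OF h(2), of "- lip (D \<phi> \<sigma> x v) \<qq>" "- lip (D \<phi> \<sigma> x v) \<pp>"] h(4)[of v] by simp
qed

lemma curvature_space_eq:
  assumes x: "x \<in> S" "\<phi> \<in> A" "x \<in> dom_chart \<phi>" and "L \<subseteq> f x"
  shows "curvature_space A S f \<phi> x L = {v. \<forall>u\<in>L. shape \<phi> x u v = 0}"
proof -
  have "\<exists>\<sigma>. local_section A S f x \<sigma> \<and> \<sigma> x = u" if "u \<in> L" for u
  proof (intro exI[of _ "\<lambda>y. - lip u \<qq> *\<^sub>R \<ff> y + - lip u \<pp> *\<^sub>R \<tt> y"] conjI local_section_combination[OF x(1)])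
    show "- lip u \<qq> *\<^sub>R \<ff> x + - lip u \<pp> *\<^sub>R \<tt> x = u"
      using f_decomp[OF x(1), of u] that assms(4) by auto
  qed
  then show ?thesis
    unfolding curvature_space_def using D_local_section_mem_iff[OF _ x(2,3)] by blast
qed

lemma shape_scaleR: "shape \<phi> x (c *\<^sub>R u) v = c *\<^sub>R shape \<phi> x u v"
  by (simp add: shape_def lip_linear scaleR_add_right)

lemma curvature_space_span:
  assumes "x \<in> S" "\<phi> \<in> A" "x \<in> dom_chart \<phi>" "u \<in> f x"
  shows "curvature_space A S f \<phi> x (span {u}) = {v. shape \<phi> x u v = 0}"
proof -
  have "span {u} \<subseteq> f x" using assms(4) fibre[OF assms(1)] by (simp add: span_minimal)
  then show ?thesis
    using curvature_space_eq[OF assms(1-3)] by (auto simp: span_singleton shape_scaleR intro: exI[of _ 1])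
qed

lemma shape_linear: "x \<in> S \<Longrightarrow> \<phi> \<in> A \<Longrightarrow> x \<in> dom_chart \<phi> \<Longrightarrow> linear (shape \<phi> x u)"
  unfolding shape_def[abs_def] by (intro linear_compose_add linear_compose_scale_right D_frame_linear)

lemma curvature_sphere_iff:
  assumes "x \<in> S"
  shows "curvature_sphere A S f x L \<longleftrightarrow> (\<exists>u\<in>f x. u \<noteq> 0 \<and> L = span {u} \<and>
    (\<forall>\<phi>\<in>A. x \<in> dom_chart \<phi> \<longrightarrow> (\<exists>v. v \<noteq> 0 \<and> shape \<phi> x u v = 0)))" (is "?l \<longleftrightarrow> ?r")
proof
  have nz: "{v. shape \<phi> x u v = 0} \<noteq> {0} \<longleftrightarrow> (\<exists>v. v \<noteq> 0 \<and> shape \<phi> x u v = 0)"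
    if "\<phi> \<in> A" "x \<in> dom_chart \<phi>" for \<phi> u
    using linear_0[OF shape_linear[OF assms that, of u]] by auto
  show ?r if l: ?l
  proof -
    have L: "subspace L" "dim L = 1" "L \<subseteq> f x" using l by (auto simp: curvature_sphere_def)
    obtain B where B: "B \<subseteq> L" "independent B" "L \<subseteq> span B" "card B = 1"
      using basis_exists[of L] L(2) by metis
    then obtain u where u: "B = {u}" by (auto simp: card_1_singleton_iff)
    have "u \<noteq> 0" using B(2) u by auto
    moreover have uL: "L = span {u}" using B u L(1) by (meson span_minimal subset_antisym)
    moreover have "u \<in> f x" using B(1) u L(3) by auto
    ultimately show ?r
      using l curvature_space_span[OF assms _ _ \<open>u \<in> f x\<close>] nz unfolding curvature_sphere_def by metis
  qed
  show ?l if r: ?r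
  proof -
    obtain u where u: "u \<in> f x" "u \<noteq> 0" "L = span {u}"
      and v: "\<And>\<phi>. \<phi> \<in> A \<Longrightarrow> x \<in> dom_chart \<phi> \<Longrightarrow> \<exists>v. v \<noteq> 0 \<and> shape \<phi> x u v = 0" using r by blast
    have "dim L = 1" using u by (simp add: dim_span dim_eq_card_independent)
    moreover have "L \<subseteq> f x" using u fibre[OF assms] by (simp add: span_minimal)
    ultimately show ?l
      using v nz curvature_space_span[OF assms _ _ u(1)] u(3) by (simp add: curvature_sphere_def)
  qed
qed

end

locale legendre_lift = contact_lift +
  assumes regular: "x \<in> S \<Longrightarrow> \<phi> \<in> A \<Longrightarrow> x \<in> dom_chart \<phi> \<Longrightarrow> D \<phi> \<ff> x v = 0 \<Longrightarrow> D \<phi> \<tt> x v = 0 \<Longrightarrow> v = 0"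
begin

text \<open>Two distinct curvature spheres \<open>u\<^sub>1, u\<^sub>2\<close> diagonalise \<open>d\<ff>\<close> and \<open>d\<tt>\<close> simultaneously: that \<open>\<kappa>\<^sub>i d\<ff> + \<mu>\<^sub>i d\<tt>\<close>
  kills \<open>v\<^sub>i\<close> makes \<open>d\<ff> v\<^sub>i\<close>, \<open>d\<tt> v\<^sub>i\<close> multiples of one vector \<open>\<xi>\<^sub>i\<close>, and the symmetry of \<open>(d\<ff>, d\<tt>)\<close> makes
  \<open>\<xi>\<^sub>1, \<xi>\<^sub>2\<close> orthogonal.\<close>

lemma principal_frame:
  assumes x: "x \<in> S" "\<phi> \<in> A" "x \<in> dom_chart \<phi>"
    and u1: "u1 = csphere x \<kappa>1 \<mu>1" and u2: "u2 = csphere x \<kappa>2 \<mu>2"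
    and ind: "\<kappa>1 * \<mu>2 \<noteq> \<mu>1 * \<kappa>2"
    and v: "v1 \<noteq> 0" "shape \<phi> x u1 v1 = 0" "v2 \<noteq> 0" "shape \<phi> x u2 v2 = 0"
  obtains \<xi>1 \<xi>2 where "D \<phi> \<ff> x v1 = \<mu>1 *\<^sub>R \<xi>1" "D \<phi> \<tt> x v1 = - \<kappa>1 *\<^sub>R \<xi>1"
    "D \<phi> \<ff> x v2 = \<mu>2 *\<^sub>R \<xi>2" "D \<phi> \<tt> x v2 = - \<kappa>2 *\<^sub>R \<xi>2"
    "lip \<xi>1 \<xi>2 = 0" "lip \<xi>1 \<xi>1 > 0" "lip \<xi>2 \<xi>2 > 0"
    "\<And>z. z \<in> {\<ff> x, \<tt> x, \<pp>, \<qq>} \<Longrightarrow> lip \<xi>1 z = 0 \<and> lip \<xi>2 z = 0"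
    "\<And>v. \<exists>r s. v = r *\<^sub>R v1 + s *\<^sub>R v2"
proof -
  have ex: "\<exists>\<xi>. D \<phi> \<ff> x v = \<mu> *\<^sub>R \<xi> \<and> D \<phi> \<tt> x v = - \<kappa> *\<^sub>R \<xi> \<and> lip \<xi> \<xi> > 0 \<and>
      lip \<xi> (\<ff> x) = 0 \<and> lip \<xi> (\<tt> x) = 0 \<and> lip \<xi> \<pp> = 0 \<and> lip \<xi> \<qq> = 0"
    if "shape \<phi> x (csphere x \<kappa> \<mu>) v = 0" "v \<noteq> 0" "(\<kappa>, \<mu>) \<noteq> (0, 0)" for v \<kappa> \<mu>
  proof -
    define n where "n = \<kappa>\<^sup>2 + \<mu>\<^sup>2"
    have n: "n \<noteq> 0" using that(3) by (auto simp: n_def sum_power2_eq_zero_iff)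
    define \<xi> where "\<xi> = (1 / n) *\<^sub>R (\<mu> *\<^sub>R D \<phi> \<ff> x v - \<kappa> *\<^sub>R D \<phi> \<tt> x v)"
    have s: "\<kappa> *\<^sub>R D \<phi> \<ff> x v + \<mu> *\<^sub>R D \<phi> \<tt> x v = 0"
      using that(1) lip_frame[OF x(1)] by (simp add: shape_def lip_linear add_eq_0_iff)
    have n\<xi>: "n *\<^sub>R \<xi> = \<mu> *\<^sub>R D \<phi> \<ff> x v - \<kappa> *\<^sub>R D \<phi> \<tt> x v" using n by (simp add: \<xi>_def)
    have "n *\<^sub>R (\<mu> *\<^sub>R \<xi>) = \<mu> *\<^sub>R (n *\<^sub>R \<xi>)" by simp
    also have "\<dots> = n *\<^sub>R D \<phi> \<ff> x v - \<kappa> *\<^sub>R (\<kappa> *\<^sub>R D \<phi> \<ff> x v + \<mu> *\<^sub>R D \<phi> \<tt> x v)"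
      unfolding n\<xi> by (simp add: n_def power2_eq_square algebra_simps)
    finally have F: "D \<phi> \<ff> x v = \<mu> *\<^sub>R \<xi>" using s n by (simp only: scaleR_zero_right diff_zero scaleR_cancel_left simp_thms)
    have "n *\<^sub>R (- \<kappa> *\<^sub>R \<xi>) = - \<kappa> *\<^sub>R (n *\<^sub>R \<xi>)" by simp
    also have "\<dots> = n *\<^sub>R D \<phi> \<tt> x v - \<mu> *\<^sub>R (\<kappa> *\<^sub>R D \<phi> \<ff> x v + \<mu> *\<^sub>R D \<phi> \<tt> x v)"
      unfolding n\<xi> by (simp add: n_def power2_eq_square algebra_simps)
    finally have G: "D \<phi> \<tt> x v = - \<kappa> *\<^sub>R \<xi>" using s n by (simp only: scaleR_zero_right diff_zero scaleR_cancel_left simp_thms)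
    have p: "lip \<xi> (\<ff> x) = 0" "lip \<xi> (\<tt> x) = 0" "lip \<xi> \<pp> = 0" "lip \<xi> \<qq> = 0"
      by (simp_all add: \<xi>_def lip_linear D_frame_perp[OF x])
    have "\<xi> \<noteq> 0" using regular[OF x, of v] F G that(2) by auto
    then have "lip \<xi> \<xi> > 0" using perp_f_positive[OF x(1) p(1,2)] p(3,4) by force
    then show ?thesis using F G p by blast
  qed
  have nz: "(\<kappa>1, \<mu>1) \<noteq> (0, 0)" "(\<kappa>2, \<mu>2) \<noteq> (0, 0)" using ind by auto
  obtain \<xi>1 where 1: "D \<phi> \<ff> x v1 = \<mu>1 *\<^sub>R \<xi>1" "D \<phi> \<tt> x v1 = - \<kappa>1 *\<^sub>R \<xi>1" "lip \<xi>1 \<xi>1 > 0"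
    "lip \<xi>1 (\<ff> x) = 0" "lip \<xi>1 (\<tt> x) = 0" "lip \<xi>1 \<pp> = 0" "lip \<xi>1 \<qq> = 0"
    using ex[of \<kappa>1 \<mu>1 v1] v nz u1 by blast
  obtain \<xi>2 where 2: "D \<phi> \<ff> x v2 = \<mu>2 *\<^sub>R \<xi>2" "D \<phi> \<tt> x v2 = - \<kappa>2 *\<^sub>R \<xi>2" "lip \<xi>2 \<xi>2 > 0"
    "lip \<xi>2 (\<ff> x) = 0" "lip \<xi>2 (\<tt> x) = 0" "lip \<xi>2 \<pp> = 0" "lip \<xi>2 \<qq> = 0"
    using ex[of \<kappa>2 \<mu>2 v2] v nz u2 by blast
  have orth: "lip \<xi>1 \<xi>2 = 0"
  proof -
    have "lip (\<mu>1 *\<^sub>R \<xi>1) (- \<kappa>2 *\<^sub>R \<xi>2) = lip (\<mu>2 *\<^sub>R \<xi>2) (- \<kappa>1 *\<^sub>R \<xi>1)"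
      using second_form_symmetric[OF x, of v1 v2] by (simp only: 1(1,2) 2(1,2))
    then have "lip \<xi>1 \<xi>2 = 0 \<or> \<mu>1 * \<kappa>2 = \<mu>2 * \<kappa>1"
      by (simp add: lip_linear lip_commute[of \<xi>2 \<xi>1]) (metis mult.commute)
    then show ?thesis using ind by (metis mult.commute)
  qed
  have nsp: "v2 \<noteq> k *\<^sub>R v1" for k
  proof
    assume "v2 = k *\<^sub>R v1"
    then have "D \<phi> \<ff> x v2 = k *\<^sub>R D \<phi> \<ff> x v1" "D \<phi> \<tt> x v2 = k *\<^sub>R D \<phi> \<tt> x v1"
      using D_frame_linear[OF x] by (simp_all add: linear_cmul)
    then have "lip (\<mu>2 *\<^sub>R \<xi>2) \<xi>2 = lip (k *\<^sub>R \<mu>1 *\<^sub>R \<xi>1) \<xi>2" "lip (- \<kappa>2 *\<^sub>R \<xi>2) \<xi>2 = lip (k *\<^sub>R - \<kappa>1 *\<^sub>R \<xi>1) \<xi>2"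
      using 1(1,2) 2(1,2) by simp_all
    then show False using orth 2(3) nz by (simp add: lip_linear)
  qed
  have "v2 \<notin> span {v1}" using nsp by (auto simp: span_singleton)
  then have ind': "independent {v1, v2}" "v1 \<noteq> v2"
    using v(1) nsp[of 1] by (auto simp: insert_commute[of v1] independent_insert)
  have "dim {v1, v2} = 2" using ind' by (simp add: dim_eq_card_independent)
  then have "span {v1, v2} = UNIV" by (simp add: dim_eq_full[symmetric])
  then have "\<exists>r s. v = r *\<^sub>R v1 + s *\<^sub>R v2" for v using span_pair[of v1 v2] by blast
  then show ?thesis by (intro that[OF 1(1,2) 2(1,2) orth 1(3) 2(3)]) (use 1 2 in auto)
qed

text \<open>On \<open>r v\<^sub>1 + s v\<^sub>2\<close> the value of \<open>shape\<close> at \<open>u\<close> has the components \<open>r [u, u\<^sub>1]\<close> and \<open>s [u, u\<^sub>2]\<close> along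
  \<open>\<xi>\<^sub>1, \<xi>\<^sub>2\<close>, where \<open>[ , ]\<close> is an area form on \<open>f\<close>; so only multiples of \<open>u\<^sub>1\<close> and \<open>u\<^sub>2\<close> are curvature
  spheres.\<close>

lemma two_curvature_spheres:
  assumes x: "x \<in> S"
    and u1: "u1 = csphere x \<kappa>1 \<mu>1" and u2: "u2 = csphere x \<kappa>2 \<mu>2"
    and ind: "\<kappa>1 * \<mu>2 \<noteq> \<mu>1 * \<kappa>2"
    and v: "\<And>\<phi>. \<phi> \<in> A \<Longrightarrow> x \<in> dom_chart \<phi> \<Longrightarrow> \<exists>v. v \<noteq> 0 \<and> shape \<phi> x u1 v = 0"
      "\<And>\<phi>. \<phi> \<in> A \<Longrightarrow> x \<in> dom_chart \<phi> \<Longrightarrow> \<exists>v. v \<noteq> 0 \<and> shape \<phi> x u2 v = 0"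
  shows "{L. curvature_sphere A S f x L} = {span {u1}, span {u2}}" "span {u1} \<noteq> span {u2}"
proof -
  have mem: "u1 \<in> f x" "u2 \<in> f x" using f_mem[OF x] u1 u2 by auto
  have coords: "lip u1 \<qq> = - \<kappa>1" "lip u1 \<pp> = - \<mu>1" "lip u2 \<qq> = - \<kappa>2" "lip u2 \<pp> = - \<mu>2"
    using lip_frame[OF x] by (simp_all add: u1 u2 lip_linear)
  have nz: "u1 \<noteq> 0" "u2 \<noteq> 0" using coords ind by (auto simp: lip_linear)
  have par: "span {u} = span {u'}" if "u \<in> f x" "u' \<in> f x" "u \<noteq> 0" "u' \<noteq> 0" "lip u \<qq> * lip u' \<pp> = lip u \<pp> * lip u' \<qq>" for u u'
  proof -
    have "(lip w \<qq>, lip w \<pp>) \<noteq> (0, 0)" if "w \<in> f x" "w \<noteq> 0" for w using f_decomp[OF x that(1)] that(2) by auto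
    from proportional_pairs[OF that(5) this[OF that(1,3)] this[OF that(2,4)]]
    obtain c where c: "c \<noteq> 0" "lip u \<qq> = c * lip u' \<qq>" "lip u \<pp> = c * lip u' \<pp>" by blast
    have "u = c *\<^sub>R (- lip u' \<qq> *\<^sub>R \<ff> x - lip u' \<pp> *\<^sub>R \<tt> x)"
      by (subst f_decomp[OF x that(1)]) (simp add: c(2,3) scaleR_diff_right)
    then have "u = c *\<^sub>R u'" using f_decomp[OF x that(2)] by simp
    then show ?thesis using c(1) span_image_scale[of "{u'}" "\<lambda>_. c"] by simp
  qed
  show "{L. curvature_sphere A S f x L} = {span {u1}, span {u2}}"
  proof (intro equalityI subsetI)
    fix L assume "L \<in> {span {u1}, span {u2}}"
    then show "L \<in> {L. curvature_sphere A S f x L}"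
      unfolding mem_Collect_eq curvature_sphere_iff[OF x] using mem nz v by blast
  next
    fix L assume "L \<in> {L. curvature_sphere A S f x L}"
    then obtain u where u: "u \<in> f x" "u \<noteq> 0" "L = span {u}"
      and vv: "\<And>\<phi>. \<phi> \<in> A \<Longrightarrow> x \<in> dom_chart \<phi> \<Longrightarrow> \<exists>v. v \<noteq> 0 \<and> shape \<phi> x u v = 0"
      unfolding mem_Collect_eq curvature_sphere_iff[OF x] by blast
    obtain \<phi> where \<phi>: "\<phi> \<in> A" "x \<in> dom_chart \<phi>" using chart_at by blast
    obtain v1 v2 w where vw: "v1 \<noteq> 0" "shape \<phi> x u1 v1 = 0" "v2 \<noteq> 0" "shape \<phi> x u2 v2 = 0" "w \<noteq> 0" "shape \<phi> x u w = 0"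
      using v[OF \<phi>] vv[OF \<phi>] by blast
    obtain \<xi>1 \<xi>2 where fr: "D \<phi> \<ff> x v1 = \<mu>1 *\<^sub>R \<xi>1" "D \<phi> \<tt> x v1 = - \<kappa>1 *\<^sub>R \<xi>1"
      "D \<phi> \<ff> x v2 = \<mu>2 *\<^sub>R \<xi>2" "D \<phi> \<tt> x v2 = - \<kappa>2 *\<^sub>R \<xi>2"
      "lip \<xi>1 \<xi>2 = 0" "lip \<xi>1 \<xi>1 > 0" "lip \<xi>2 \<xi>2 > 0"
      "\<And>v. \<exists>r s. v = r *\<^sub>R v1 + s *\<^sub>R v2"
      using principal_frame[OF x \<phi> u1 u2 ind vw(1-4)] by metis
    obtain r s where w: "w = r *\<^sub>R v1 + s *\<^sub>R v2" using fr(8) by blast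
    have "shape \<phi> x u w = (r * (lip u \<qq> * \<mu>1 - lip u \<pp> * \<kappa>1)) *\<^sub>R \<xi>1 + (s * (lip u \<qq> * \<mu>2 - lip u \<pp> * \<kappa>2)) *\<^sub>R \<xi>2"
      using D_frame_linear[OF x \<phi>] by (simp add: shape_def w linear_add linear_cmul fr algebra_simps)
    then have z: "(r * (lip u \<qq> * \<mu>1 - lip u \<pp> * \<kappa>1)) *\<^sub>R \<xi>1 + (s * (lip u \<qq> * \<mu>2 - lip u \<pp> * \<kappa>2)) *\<^sub>R \<xi>2 = 0"
      using vw(6) by simp
    have "r * (lip u \<qq> * \<mu>1 - lip u \<pp> * \<kappa>1) = 0"
      using arg_cong[OF z, of "lip \<xi>1"] fr(5,6) by (simp add: lip_linear)
    moreover have "s * (lip u \<qq> * \<mu>2 - lip u \<pp> * \<kappa>2) = 0"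
      using arg_cong[OF z, of "lip \<xi>2"] fr(5,7) by (simp add: lip_linear lip_commute[of \<xi>2 \<xi>1])
    moreover have "r \<noteq> 0 \<or> s \<noteq> 0" using w vw(5) by auto
    ultimately have "lip u \<qq> * lip u1 \<pp> = lip u \<pp> * lip u1 \<qq> \<or> lip u \<qq> * lip u2 \<pp> = lip u \<pp> * lip u2 \<qq>"
      using coords by auto
    then show "L \<in> {span {u1}, span {u2}}" using par u mem nz by blast
  qed
  show "span {u1} \<noteq> span {u2}"
  proof
    assume "span {u1} = span {u2}"
    then obtain k where "u1 = k *\<^sub>R u2" using span_base[of u1 "{u1}"] by (auto simp: span_singleton)
    then have "- \<kappa>1 = k * - \<kappa>2" "- \<mu>1 = k * - \<mu>2" using coords by (auto simp: lip_linear)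
    then show False using ind by (simp add: algebra_simps)
  qed
qed

text \<open>With its converse \<open>legendre_liftI\<close>, this makes the locale equivalent to a Legendre map with a given projection.\<close>

lemma legendre_map_lift: "legendre_map A S f"
  unfolding legendre_map_def
proof (intro conjI ballI impI allI)
  show "subbundle A S 2 f"
    unfolding subbundle_def
  proof (intro ballI conjI)
    fix x assume x: "x \<in> S"
    show "subspace (f x)" "dim (f x) = 2" using fibre[OF x] dim_f[OF x] by auto
    have im: "(\<lambda>i::nat. (if i = 0 then \<ff> else \<tt>) y) ` {..<2::nat} = {\<ff> y, \<tt> y}" for y
      by (auto simp: numeral_2_eq_2 lessThan_Suc)
    have "section_of A S f \<ff>" "section_of A S f \<tt>"
      unfolding section_of_def using smooth_f smooth_t f_mem[of _ 1 0] f_mem[of _ 0 1] by auto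
    then show "\<exists>N \<sigma>. open N \<and> x \<in> N \<and> N \<subseteq> S \<and> (\<forall>i<2::nat. section_of A N f (\<sigma> i)) \<and>
        (\<forall>y\<in>N. f y = span ((\<lambda>i. \<sigma> i y) ` {..<2::nat}))"
      by (intro exI[of _ S] exI[of _ "\<lambda>i::nat. if i = 0 then \<ff> else \<tt>"])
        (simp only: im, simp add: open_S x fibre)
  qed
  fix x assume x: "x \<in> S"
  show "isotropic (f x)" unfolding isotropic_def using f_isotropic[OF x] by blast
  have "lip (D \<phi> \<sigma> x v) w = 0" if "local_section A S f x \<sigma>" "\<phi> \<in> A" "x \<in> dom_chart \<phi>" "w \<in> f x" for \<phi> \<sigma> v w
  proof -
    note h = local_section_hasD[OF that(1-3)] and s = shape_perp[OF x that(2,3)]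
    show ?thesis
      using that(4) by (subst h(4)) (auto simp: fibre[OF x] span_pair lip_linear lip_frame[OF x] s)
  qed
  moreover have perp_sec: "lip (\<sigma> x) w = 0" if "local_section A S f x \<sigma>" "w \<in> f x" for \<sigma> w
    using f_isotropic[OF x _ that(2)] that(1) unfolding local_section_def section_of_def by blast
  ultimately show "derived A S f x \<subseteq> perp (f x)"
    unfolding derived_def
  proof (intro span_minimal[OF _ subspace_perp])
    show "{\<sigma> x |\<sigma>. local_section A S f x \<sigma>} \<union>
      {D \<phi> \<sigma> x v |\<phi> \<sigma> v. \<phi> \<in> A \<and> x \<in> dom_chart \<phi> \<and> local_section A S f x \<sigma>} \<subseteq> perp (f x)"
      using \<open>\<And>\<phi> \<sigma> v w. local_section A S f x \<sigma> \<Longrightarrow> \<phi> \<in> A \<Longrightarrow> x \<in> dom_chart \<phi> \<Longrightarrow> w \<in> f x \<Longrightarrow> lip (D \<phi> \<sigma> x v) w = 0\<close>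
        perp_sec unfolding perp_def by blast
  qed
  fix \<phi> v assume \<phi>: "\<phi> \<in> A" "x \<in> dom_chart \<phi>" and all: "\<forall>\<sigma>. local_section A S f x \<sigma> \<longrightarrow> D \<phi> \<sigma> x v \<in> f x"
  have "shape \<phi> x (\<ff> x) v = 0" "shape \<phi> x (\<tt> x) v = 0"
    using all D_local_section_mem_iff[OF _ \<phi>] local_section_f[OF x] local_section_t[OF x] by blast+
  then show "v = 0" using regular[OF x \<phi>, of v] lip_frame[OF x] by (simp add: shape_def)
qed

lemma projects_to_lift: "projects_to A S f \<pp> \<qq> \<ff> \<tt>"
proof -
  have "\<ff> x \<noteq> 0" if "x \<in> S" for x using lip_fq[OF that] by (auto simp: lip_linear)
  then show ?thesis
    unfolding projects_to_def section_of_def space_form_def lightcone_def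
    using smooth_f smooth_t f_mem[of _ 1 0] f_mem[of _ 0 1] lip_frame by auto
qed

end

lemma legendre_liftI:
  assumes "smooth_surface A" "open S" and leg: "legendre_map A S f" and pr: "projects_to A S f \<pp> \<qq> \<ff> \<tt>"
  shows "legendre_lift A S f \<pp> \<qq> \<ff> \<tt>"
proof -
  interpret surface A by (rule surface.intro) (rule assms(1))
  have mem: "\<ff> x \<in> f x" "\<tt> x \<in> f x" and iso: "isotropic (f x)" and sub: "subspace (f x)" and dim: "dim (f x) = 2"
    and fp: "lip (\<ff> x) \<qq> = -1" "lip (\<ff> x) \<pp> = 0" "lip (\<tt> x) \<qq> = 0" "lip (\<tt> x) \<pp> = -1"
    if "x \<in> S" for x
    using that leg pr unfolding legendre_map_def projects_to_def section_of_def subbundle_def space_form_def by auto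
  have sm: "smooth_map A S \<ff>" "smooth_map A S \<tt>" using pr by (auto simp: projects_to_def section_of_def)
  have ls: "local_section A S f x \<ff>" "local_section A S f x \<tt>" if "x \<in> S" for x
    using pr that assms(2) unfolding local_section_def projects_to_def by auto
  have fib: "f x = span {\<ff> x, \<tt> x}" if "x \<in> S" for x
  proof -
    note ind = independent_frame[OF fp[OF that]]
    show ?thesis
    proof
      show "f x \<subseteq> span {\<ff> x, \<tt> x}"
        by (rule card_ge_dim_independent[OF _ ind(1)]) (use mem[OF that] dim[OF that] ind(2) in auto)
      show "span {\<ff> x, \<tt> x} \<subseteq> f x" by (rule span_minimal) (use mem[OF that] sub[OF that] in auto)
    qed
  qed
  interpret contact_lift A S f \<pp> \<qq> \<ff> \<tt>
  proof (unfold_locales)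
    fix x \<phi> v assume x: "x \<in> S" "\<phi> \<in> A" "x \<in> dom_chart \<phi>"
    have "D \<phi> \<tt> x v \<in> derived A S f x"
      unfolding derived_def using ls(2)[OF x(1)] x(2,3) by (intro span_base) blast
    then have "D \<phi> \<tt> x v \<in> perp (f x)" using leg x(1) unfolding legendre_map_def by blast
    then show "lip (\<ff> x) (D \<phi> \<tt> x v) = 0" using mem[OF x(1)] by (simp add: perp_def lip_commute[of "\<ff> x"])
  qed (use assms(2) sm fp fib mem iso in \<open>auto simp: isotropic_def\<close>)
  show ?thesis
  proof unfold_locales
    fix x \<phi> v assume x: "x \<in> S" "\<phi> \<in> A" "x \<in> dom_chart \<phi>" and z: "D \<phi> \<ff> x v = 0" "D \<phi> \<tt> x v = 0"
    have "\<forall>\<sigma>. local_section A S f x \<sigma> \<longrightarrow> D \<phi> \<sigma> x v \<in> f x"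
      using D_local_section_mem_iff[OF _ x(2,3)] z by (simp add: shape_def)
    then show "v = 0" using leg x unfolding legendre_map_def by blast
  qed
qed

section \<open>The linear Weingarten condition along curvature spheres\<close>

text \<open>The form on \<open>f\<close> that \<open>W = a \<qq>\<odot>\<qq> + 2 b \<qq>\<odot>\<pp> + c \<pp>\<odot>\<pp>\<close> induces, on \<open>\<kappa> \<ff> + \<mu> \<tt>\<close> and \<open>\<kappa>' \<ff> + \<mu>' \<tt>\<close>.\<close>

abbreviation W_form :: "real \<Rightarrow> real \<Rightarrow> real \<Rightarrow> real \<Rightarrow> real \<Rightarrow> real \<Rightarrow> real \<Rightarrow> real" where
  "W_form a b c \<kappa> \<mu> \<kappa>' \<mu>' \<equiv> a * \<kappa> * \<kappa>' + b * (\<kappa> * \<mu>' + \<mu> * \<kappa>') + c * \<mu> * \<mu>'"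

context legendre_lift
begin

text \<open>On \<open>N\<close>, the curvature spheres are spanned by the smooth sections \<open>\<kappa>\<^sub>i \<ff> + \<mu>\<^sub>i \<tt>\<close>, so that the
  principal curvatures are \<open>\<kappa>\<^sub>i / \<mu>\<^sub>i\<close>; in contrast to these, the pairs exist where \<open>\<ff>\<close> does not immerse.\<close>

definition principal_sections ::
  "'a set \<Rightarrow> ('a \<Rightarrow> real) \<Rightarrow> ('a \<Rightarrow> real) \<Rightarrow> ('a \<Rightarrow> real) \<Rightarrow> ('a \<Rightarrow> real) \<Rightarrow> bool" where
  "principal_sections N \<kappa>1 \<mu>1 \<kappa>2 \<mu>2 \<longleftrightarrow> open N \<and> N \<subseteq> S \<and>
     smooth_map A N \<kappa>1 \<and> smooth_map A N \<mu>1 \<and> smooth_map A N \<kappa>2 \<and> smooth_map A N \<mu>2 \<and>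
     (\<forall>y\<in>N. \<kappa>1 y * \<mu>2 y \<noteq> \<mu>1 y * \<kappa>2 y \<and>
        (\<forall>\<phi>\<in>A. y \<in> dom_chart \<phi> \<longrightarrow>
           (\<exists>v. v \<noteq> 0 \<and> shape \<phi> y (csphere y (\<kappa>1 y) (\<mu>1 y)) v = 0) \<and>
           (\<exists>v. v \<noteq> 0 \<and> shape \<phi> y (csphere y (\<kappa>2 y) (\<mu>2 y)) v = 0)))"

lemma principal_sections_spheres:
  assumes "principal_sections N \<kappa>1 \<mu>1 \<kappa>2 \<mu>2" "y \<in> N"
  shows "{L. curvature_sphere A S f y L} =
      {span {csphere y (\<kappa>1 y) (\<mu>1 y)}, span {csphere y (\<kappa>2 y) (\<mu>2 y)}}" (is ?A)
    "span {csphere y (\<kappa>1 y) (\<mu>1 y)} \<noteq> span {csphere y (\<kappa>2 y) (\<mu>2 y)}" (is ?B)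
proof -
  have "y \<in> S" "\<kappa>1 y * \<mu>2 y \<noteq> \<mu>1 y * \<kappa>2 y"
    and "\<And>\<phi>. \<phi> \<in> A \<Longrightarrow> y \<in> dom_chart \<phi> \<Longrightarrow> \<exists>v. v \<noteq> 0 \<and> shape \<phi> y (csphere y (\<kappa>1 y) (\<mu>1 y)) v = 0"
    and "\<And>\<phi>. \<phi> \<in> A \<Longrightarrow> y \<in> dom_chart \<phi> \<Longrightarrow> \<exists>v. v \<noteq> 0 \<and> shape \<phi> y (csphere y (\<kappa>2 y) (\<mu>2 y)) v = 0"
    using assms unfolding principal_sections_def by blast+
  note two_curvature_spheres[OF this(1) refl refl this(2,3,4)]
  then show ?A ?B by blast+
qed

lemma umbilic_freeI:
  assumes "principal_sections S \<kappa>1 \<mu>1 \<kappa>2 \<mu>2"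
  shows "umbilic_free A S f"
proof -
  have sub: "subbundle A S 1 (\<lambda>y. span {csphere y (\<kappa> y) (\<mu> y)})"
    if "smooth_map A S \<kappa>" "smooth_map A S \<mu>" "\<And>y. y \<in> S \<Longrightarrow> csphere y (\<kappa> y) (\<mu> y) \<noteq> 0" for \<kappa> \<mu>
    unfolding subbundle_def
  proof (intro ballI conjI)
    fix x assume x: "x \<in> S"
    show "subspace (span {csphere x (\<kappa> x) (\<mu> x)})" by (rule subspace_span)
    show "dim (span {csphere x (\<kappa> x) (\<mu> x)}) = 1"
      using that(3)[OF x] by (simp add: dim_span dim_eq_card_independent)
    have "section_of A S (\<lambda>y. span {csphere y (\<kappa> y) (\<mu> y)}) (\<lambda>y. csphere y (\<kappa> y) (\<mu> y))"
      unfolding section_of_def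
      by (intro conjI ballI smooth_map_add smooth_map_scaleR open_S that smooth_f smooth_t span_base) simp
    then show "\<exists>N \<sigma>. open N \<and> x \<in> N \<and> N \<subseteq> S \<and>
        (\<forall>i<1. section_of A N (\<lambda>y. span {csphere y (\<kappa> y) (\<mu> y)}) (\<sigma> i)) \<and>
        (\<forall>y\<in>N. span {csphere y (\<kappa> y) (\<mu> y)} = span ((\<lambda>i. \<sigma> i y) ` {..<1::nat}))"
      using open_S x
      by (intro exI[of _ S] exI[of _ "\<lambda>i y. csphere y (\<kappa> y) (\<mu> y)"]) (auto simp: lessThan_Suc)
  qed
  have nz: "csphere y \<kappa> \<mu> \<noteq> 0" if "y \<in> S" "(\<kappa>, \<mu>) \<noteq> (0, 0)" for y \<kappa> \<mu>
  proof
    assume "csphere y \<kappa> \<mu> = 0"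
    then have "lip (csphere y \<kappa> \<mu>) \<qq> = 0" "lip (csphere y \<kappa> \<mu>) \<pp> = 0" by (simp_all add: lip_linear)
    then show False using that(2) lip_frame[OF that(1)] by (simp add: lip_linear)
  qed
  have ne: "csphere y (\<kappa>1 y) (\<mu>1 y) \<noteq> 0" "csphere y (\<kappa>2 y) (\<mu>2 y) \<noteq> 0" if "y \<in> S" for y
  proof -
    have "\<kappa>1 y * \<mu>2 y \<noteq> \<mu>1 y * \<kappa>2 y" using assms that unfolding principal_sections_def by blast
    then show "csphere y (\<kappa>1 y) (\<mu>1 y) \<noteq> 0" "csphere y (\<kappa>2 y) (\<mu>2 y) \<noteq> 0"
      by (intro nz[OF that]; force)+
  qed
  have sm: "smooth_map A S \<kappa>1" "smooth_map A S \<mu>1" "smooth_map A S \<kappa>2" "smooth_map A S \<mu>2"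
    using assms unfolding principal_sections_def by blast+
  show ?thesis
    unfolding umbilic_free_def
    by (intro exI conjI ballI, rule sub[OF sm(1,2) ne(1)], assumption, rule sub[OF sm(3,4) ne(2)], assumption)
      (use principal_sections_spheres[OF assms] in blast)+
qed

lemma curvature_sphere_section:
  assumes sub: "subbundle A S 1 s" and cs: "\<And>x. x \<in> S \<Longrightarrow> curvature_sphere A S f x (s x)" and x: "x \<in> S"
  obtains N \<kappa> \<mu> where "open N" "x \<in> N" "N \<subseteq> S" "smooth_map A N \<kappa>" "smooth_map A N \<mu>"
    "\<And>y. y \<in> N \<Longrightarrow> s y = span {csphere y (\<kappa> y) (\<mu> y)}"
    "\<And>y \<phi>. y \<in> N \<Longrightarrow> \<phi> \<in> A \<Longrightarrow> y \<in> dom_chart \<phi> \<Longrightarrow>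
      \<exists>v. v \<noteq> 0 \<and> shape \<phi> y (csphere y (\<kappa> y) (\<mu> y)) v = 0"
proof -
  have "\<exists>N \<sigma>. open N \<and> x \<in> N \<and> N \<subseteq> S \<and> (\<forall>i<1::nat. section_of A N s (\<sigma> i)) \<and>
      (\<forall>y\<in>N. s y = span ((\<lambda>i. \<sigma> i y) ` {..<1}))"
    using sub x unfolding subbundle_def by blast
  then obtain N and \<sigma> :: "nat \<Rightarrow> 'a \<Rightarrow> R42" where N: "open N" "x \<in> N" "N \<subseteq> S"
    and sec: "section_of A N s (\<sigma> 0)" and sp: "\<And>y. y \<in> N \<Longrightarrow> s y = span {\<sigma> 0 y}"
    by (auto simp: lessThan_Suc)
  define \<kappa> where "\<kappa> y = - lip (\<sigma> 0 y) \<qq>" for y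
  define \<mu> where "\<mu> y = - lip (\<sigma> 0 y) \<pp>" for y
  have sm: "smooth_map A N (\<sigma> 0)" using sec by (simp add: section_of_def)
  have smk: "smooth_map A N \<kappa>" "smooth_map A N \<mu>"
    unfolding \<kappa>_def \<mu>_def by (intro smooth_map_minus smooth_map_lip smooth_map_const sm N(1))+
  have mem: "\<sigma> 0 y \<in> f y" if "y \<in> N" for y
  proof -
    have "s y \<subseteq> f y" using cs that N(3) unfolding curvature_sphere_def by blast
    then show ?thesis using sp[OF that] span_base[of "\<sigma> 0 y" "{\<sigma> 0 y}"] by blast
  qed
  have eq: "csphere y (\<kappa> y) (\<mu> y) = \<sigma> 0 y" if "y \<in> N" for y
    using f_decomp[OF _ mem[OF that]] that N(3) by (auto simp: \<kappa>_def \<mu>_def)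
  have sh: "\<exists>v. v \<noteq> 0 \<and> shape \<phi> y (\<sigma> 0 y) v = 0" if prem: "y \<in> N" "\<phi> \<in> A" "y \<in> dom_chart \<phi>" for y \<phi>
  proof -
    have y: "y \<in> S" using prem(1) N(3) by blast
    obtain u where u: "span {\<sigma> 0 y} = span {u}" "\<exists>v. v \<noteq> 0 \<and> shape \<phi> y u v = 0"
      using cs[OF y] prem(2,3) unfolding sp[OF prem(1)] curvature_sphere_iff[OF y] by blast
    have "\<sigma> 0 y \<in> span {u}" using u(1) span_base[of "\<sigma> 0 y" "{\<sigma> 0 y}"] by blast
    then obtain k where "\<sigma> 0 y = k *\<^sub>R u" by (auto simp: span_singleton)
    then show ?thesis using u(2) by (auto simp: shape_scaleR)
  qed
  show ?thesis
    by (rule that[OF N smk]) (simp_all add: eq sp sh)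
qed

lemma umbilic_freeE:
  assumes "umbilic_free A S f" "x \<in> S"
  obtains N \<kappa>1 \<mu>1 \<kappa>2 \<mu>2 where "x \<in> N" "principal_sections N \<kappa>1 \<mu>1 \<kappa>2 \<mu>2"
proof -
  obtain s1 s2 where s12: "subbundle A S 1 s1" "subbundle A S 1 s2"
    "\<forall>x\<in>S. s1 x \<noteq> s2 x \<and> {L. curvature_sphere A S f x L} = {s1 x, s2 x}"
    using assms(1) unfolding umbilic_free_def by (elim exE conjE) (rule that)
  have s: "subbundle A S 1 s1" "subbundle A S 1 s2"
    "s1 x \<noteq> s2 x" "{L. curvature_sphere A S f x L} = {s1 x, s2 x}" if "x \<in> S" for x
    using s12 bspec[OF s12(3) that] by simp_all
  have cs: "curvature_sphere A S f x (s1 x)" "curvature_sphere A S f x (s2 x)" if "x \<in> S" for x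
    using s(4)[OF that] by auto
  obtain N1 \<kappa>1 \<mu>1 where 1: "open N1" "x \<in> N1" "N1 \<subseteq> S" "smooth_map A N1 \<kappa>1" "smooth_map A N1 \<mu>1"
    "\<And>y. y \<in> N1 \<Longrightarrow> s1 y = span {csphere y (\<kappa>1 y) (\<mu>1 y)}"
    "\<And>y \<phi>. y \<in> N1 \<Longrightarrow> \<phi> \<in> A \<Longrightarrow> y \<in> dom_chart \<phi> \<Longrightarrow>
      \<exists>v. v \<noteq> 0 \<and> shape \<phi> y (csphere y (\<kappa>1 y) (\<mu>1 y)) v = 0"
    by (rule curvature_sphere_section[OF s12(1) cs(1) assms(2)]) (assumption+, rule that)
  obtain N2 \<kappa>2 \<mu>2 where 2: "open N2" "x \<in> N2" "N2 \<subseteq> S" "smooth_map A N2 \<kappa>2" "smooth_map A N2 \<mu>2"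
    "\<And>y. y \<in> N2 \<Longrightarrow> s2 y = span {csphere y (\<kappa>2 y) (\<mu>2 y)}"
    "\<And>y \<phi>. y \<in> N2 \<Longrightarrow> \<phi> \<in> A \<Longrightarrow> y \<in> dom_chart \<phi> \<Longrightarrow>
      \<exists>v. v \<noteq> 0 \<and> shape \<phi> y (csphere y (\<kappa>2 y) (\<mu>2 y)) v = 0"
    by (rule curvature_sphere_section[OF s12(2) cs(2) assms(2)]) (assumption+, rule that)
  have "\<kappa>1 y * \<mu>2 y \<noteq> \<mu>1 y * \<kappa>2 y" if y: "y \<in> N1 \<inter> N2" for y
  proof
    assume eq: "\<kappa>1 y * \<mu>2 y = \<mu>1 y * \<kappa>2 y"
    have yS: "y \<in> S" using y 1 by blast
    have nz: "(\<kappa>1 y, \<mu>1 y) \<noteq> (0, 0)" "(\<kappa>2 y, \<mu>2 y) \<noteq> (0, 0)"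
      using cs[OF yS] 1(6)[of y] 2(6)[of y] y by (auto simp: curvature_sphere_def)
    obtain k where "k \<noteq> 0" "\<kappa>1 y = k * \<kappa>2 y" "\<mu>1 y = k * \<mu>2 y"
      using proportional_pairs[OF eq nz] by blast
    then have "csphere y (\<kappa>1 y) (\<mu>1 y) = k *\<^sub>R (csphere y (\<kappa>2 y) (\<mu>2 y))"
      by (simp add: scaleR_add_right)
    then have "s1 y = s2 y"
      using 1(6)[of y] 2(6)[of y] y \<open>k \<noteq> 0\<close>
        span_image_scale[of "{csphere y (\<kappa>2 y) (\<mu>2 y)}" "\<lambda>_. k"] by simp
    then show False using s(3)[OF yS] by blast
  qed
  moreover have "smooth_map A (N1 \<inter> N2) \<kappa>1" "smooth_map A (N1 \<inter> N2) \<mu>1"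
    "smooth_map A (N1 \<inter> N2) \<kappa>2" "smooth_map A (N1 \<inter> N2) \<mu>2"
    using smooth_map_subset[OF 1(4)] smooth_map_subset[OF 1(5)] smooth_map_subset[OF 2(4)]
      smooth_map_subset[OF 2(5)] by auto
  ultimately have "principal_sections (N1 \<inter> N2) \<kappa>1 \<mu>1 \<kappa>2 \<mu>2"
    unfolding principal_sections_def using 1(1,3,7) 2(1,7) by blast
  then show ?thesis using that 1(2) 2(2) by blast
qed

text \<open>Where \<open>\<ff>\<close> immerses, a vector \<open>u\<close> of a curvature sphere with principal curvature \<open>k\<close> is
  proportional to \<open>k \<ff> + \<tt>\<close>.\<close>

lemma immersed_principal_curvature:
  assumes x: "x \<in> S" and imm: "immerses_at A \<ff> x" and L: "curvature_sphere A S f x L"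
    and k: "\<And>\<phi> v. \<phi> \<in> A \<Longrightarrow> x \<in> dom_chart \<phi> \<Longrightarrow> v \<in> curvature_space A S f \<phi> x L \<Longrightarrow>
      D \<phi> \<tt> x v + k *\<^sub>R D \<phi> \<ff> x v = 0"
    and u: "L = span {csphere x \<kappa> \<mu>}"
  shows "\<kappa> = k * \<mu>"
proof -
  let ?u = "csphere x \<kappa> \<mu>"
  obtain \<phi> where \<phi>: "\<phi> \<in> A" "x \<in> dom_chart \<phi>" using chart_at by blast
  have cs: "curvature_space A S f \<phi> x L = {v. shape \<phi> x ?u v = 0}"
    unfolding u by (rule curvature_space_span[OF x \<phi> f_mem[OF x]])
  have "curvature_space A S f \<phi> x L \<noteq> {0}" using L \<phi> by (auto simp: curvature_sphere_def)
  moreover have "0 \<in> curvature_space A S f \<phi> x L"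
    unfolding cs using linear_0[OF shape_linear[OF x \<phi>]] by simp
  ultimately obtain v where v: "v \<noteq> 0" "v \<in> curvature_space A S f \<phi> x L" by blast
  have F: "D \<phi> \<ff> x v \<noteq> 0" using imm \<phi> v(1) unfolding immerses_at_def by blast
  have G: "D \<phi> \<tt> x v = - k *\<^sub>R D \<phi> \<ff> x v" using k[OF \<phi> v(2)] by (simp add: add_eq_0_iff2)
  have "- \<kappa> *\<^sub>R D \<phi> \<ff> x v + - \<mu> *\<^sub>R D \<phi> \<tt> x v = 0"
    using v(2) lip_frame[OF x] unfolding cs by (simp add: shape_def lip_linear)
  then have "(k * \<mu> - \<kappa>) *\<^sub>R D \<phi> \<ff> x v = 0" unfolding G by (simp add: algebra_simps)
  then show ?thesis using F by simp
qed

lemma weingarten_immersed: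
  assumes ps: "principal_sections N \<kappa>1 \<mu>1 \<kappa>2 \<mu>2" and y: "y \<in> N" and imm: "immerses_at A \<ff> y"
    and pc: "principal_curvatures A S f \<ff> \<tt> y k1 k2" and lw: "a * (k1 * k2) + 2 * b * ((k1 + k2) / 2) + c = 0"
  shows "W_form a b c (\<kappa>1 y) (\<mu>1 y) (\<kappa>2 y) (\<mu>2 y) = 0"
proof -
  have yS: "y \<in> S" using ps y unfolding principal_sections_def by blast
  let ?u1 = "csphere y (\<kappa>1 y) (\<mu>1 y)" and ?u2 = "csphere y (\<kappa>2 y) (\<mu>2 y)"
  obtain L1 L2 where L: "L1 \<noteq> L2" "{L. curvature_sphere A S f y L} = {L1, L2}"
    and k: "\<forall>\<phi>\<in>A. y \<in> dom_chart \<phi> \<longrightarrow>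
      (\<forall>v\<in>curvature_space A S f \<phi> y L1. D \<phi> \<tt> y v + k1 *\<^sub>R D \<phi> \<ff> y v = 0) \<and>
      (\<forall>v\<in>curvature_space A S f \<phi> y L2. D \<phi> \<tt> y v + k2 *\<^sub>R D \<phi> \<ff> y v = 0)"
    using pc unfolding principal_curvatures_def by (elim exE conjE) (rule that)
  have k1: "\<And>\<phi> v. \<phi> \<in> A \<Longrightarrow> y \<in> dom_chart \<phi> \<Longrightarrow> v \<in> curvature_space A S f \<phi> y L1 \<Longrightarrow>
      D \<phi> \<tt> y v + k1 *\<^sub>R D \<phi> \<ff> y v = 0"
    and k2: "\<And>\<phi> v. \<phi> \<in> A \<Longrightarrow> y \<in> dom_chart \<phi> \<Longrightarrow> v \<in> curvature_space A S f \<phi> y L2 \<Longrightarrow>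
      D \<phi> \<tt> y v + k2 *\<^sub>R D \<phi> \<ff> y v = 0"
    using k by blast+
  have cs: "curvature_sphere A S f y L1" "curvature_sphere A S f y L2" using L(2) by auto
  have "(L1 = span {?u1} \<and> L2 = span {?u2}) \<or> (L1 = span {?u2} \<and> L2 = span {?u1})"
    using principal_sections_spheres[OF ps y] L by (metis doubleton_eq_iff)
  then have "(\<kappa>1 y = k1 * \<mu>1 y \<and> \<kappa>2 y = k2 * \<mu>2 y) \<or> (\<kappa>2 y = k1 * \<mu>2 y \<and> \<kappa>1 y = k2 * \<mu>1 y)"
    using immersed_principal_curvature[OF yS imm cs(1) k1] immersed_principal_curvature[OF yS imm cs(2) k2]
    by blast
  then have "W_form a b c (\<kappa>1 y) (\<mu>1 y) (\<kappa>2 y) (\<mu>2 y) =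
      (a * (k1 * k2) + 2 * b * ((k1 + k2) / 2) + c) * (\<mu>1 y * \<mu>2 y)"
    by (auto simp: algebra_simps)
  then show ?thesis using lw by simp
qed

text \<open>The homogeneous equation holds everywhere, as it is continuous and \<open>\<ff>\<close> immerses on a dense set.\<close>

lemma weingarten_everywhere:
  assumes ps: "principal_sections N \<kappa>1 \<mu>1 \<kappa>2 \<mu>2" and lw: "linear_weingarten A S f \<ff> \<tt> a b c" and y: "y \<in> N"
  shows "W_form a b c (\<kappa>1 y) (\<mu>1 y) (\<kappa>2 y) (\<mu>2 y) = 0"
proof (rule ccontr)
  define w where "w y = W_form a b c (\<kappa>1 y) (\<mu>1 y) (\<kappa>2 y) (\<mu>2 y)" for y
  have N: "open N" "N \<subseteq> S" and sm: "smooth_map A N \<kappa>1" "smooth_map A N \<mu>1" "smooth_map A N \<kappa>2" "smooth_map A N \<mu>2"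
    using ps unfolding principal_sections_def by blast+
  have "continuous_on N w"
    unfolding w_def using sm[THEN smooth_map_continuous_on] N(1) by (intro continuous_intros) auto
  then have "open (N \<inter> w -` (- {0}))" using N(1) by (intro continuous_open_preimage) auto
  moreover assume "\<not> W_form a b c (\<kappa>1 y) (\<mu>1 y) (\<kappa>2 y) (\<mu>2 y) = 0"
  then have "y \<in> N \<inter> w -` (- {0})" using y by (simp add: w_def)
  moreover have "y \<in> closure {x \<in> S. immerses_at A \<ff> x}"
    using lw y N(2) unfolding linear_weingarten_def by blast
  ultimately obtain z where z: "z \<in> N" "w z \<noteq> 0" "z \<in> S" "immerses_at A \<ff> z"
    using open_Int_closure_eq_empty[of "N \<inter> w -` (- {0})" "{x \<in> S. immerses_at A \<ff> x}"] by blast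
  obtain k1 k2 where "principal_curvatures A S f \<ff> \<tt> z k1 k2" "a * (k1 * k2) + 2 * b * ((k1 + k2) / 2) + c = 0"
    using lw z(3,4) unfolding linear_weingarten_def Let_def by blast
  from weingarten_immersed[OF ps z(1,4) this] show False using z(2) by (simp add: w_def)
qed

text \<open>If no \<open>\<mu>\<^sub>i\<close> vanishes then \<open>d\<ff> = \<mu>\<^sub>i \<xi>\<^sub>i\<close> is injective, so that \<open>\<ff>\<close> immerses everywhere.\<close>

lemma linear_weingartenI:
  assumes ps: "principal_sections S \<kappa>1 \<mu>1 \<kappa>2 \<mu>2" and abc: "(a, b, c) \<noteq> (0, 0, 0)"
    and \<mu>: "\<And>x. x \<in> S \<Longrightarrow> \<mu>1 x \<noteq> 0 \<and> \<mu>2 x \<noteq> 0"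
    and lw: "\<And>x. x \<in> S \<Longrightarrow> W_form a b c (\<kappa>1 x) (\<mu>1 x) (\<kappa>2 x) (\<mu>2 x) = 0"
  shows "linear_weingarten A S f \<ff> \<tt> a b c"
proof -
  have shape: "\<And>y \<phi>. y \<in> S \<Longrightarrow> \<phi> \<in> A \<Longrightarrow> y \<in> dom_chart \<phi> \<Longrightarrow>
      \<exists>v. v \<noteq> 0 \<and> shape \<phi> y (csphere y (\<kappa>1 y) (\<mu>1 y)) v = 0"
      "\<And>y \<phi>. y \<in> S \<Longrightarrow> \<phi> \<in> A \<Longrightarrow> y \<in> dom_chart \<phi> \<Longrightarrow>
      \<exists>v. v \<noteq> 0 \<and> shape \<phi> y (csphere y (\<kappa>2 y) (\<mu>2 y)) v = 0"
      "\<And>y. y \<in> S \<Longrightarrow> \<kappa>1 y * \<mu>2 y \<noteq> \<mu>1 y * \<kappa>2 y"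
    using ps unfolding principal_sections_def by blast+
  have imm: "immerses_at A \<ff> x" if x: "x \<in> S" for x
    unfolding immerses_at_def
  proof (intro ballI allI impI)
    fix \<phi> v assume \<phi>: "\<phi> \<in> A" "x \<in> dom_chart \<phi>" and v: "D \<phi> \<ff> x v = 0"
    obtain v1 v2 where vv: "v1 \<noteq> 0" "shape \<phi> x (csphere x (\<kappa>1 x) (\<mu>1 x)) v1 = 0"
      "v2 \<noteq> 0" "shape \<phi> x (csphere x (\<kappa>2 x) (\<mu>2 x)) v2 = 0" using shape(1,2)[OF x \<phi>] by blast
    obtain \<xi>1 \<xi>2 where fr: "D \<phi> \<ff> x v1 = \<mu>1 x *\<^sub>R \<xi>1" "D \<phi> \<ff> x v2 = \<mu>2 x *\<^sub>R \<xi>2"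
      "lip \<xi>1 \<xi>2 = 0" "lip \<xi>1 \<xi>1 > 0" "lip \<xi>2 \<xi>2 > 0" "\<And>v. \<exists>r s. v = r *\<^sub>R v1 + s *\<^sub>R v2"
      using principal_frame[OF x \<phi> refl refl shape(3)[OF x] vv] by metis
    obtain r s where rs: "v = r *\<^sub>R v1 + s *\<^sub>R v2" using fr(6) by blast
    have z: "(r * \<mu>1 x) *\<^sub>R \<xi>1 + (s * \<mu>2 x) *\<^sub>R \<xi>2 = 0"
      using v D_frame_linear(1)[OF x \<phi>] by (simp add: rs linear_add linear_cmul fr(1,2))
    have "r * \<mu>1 x = 0" using arg_cong[OF z, of "lip \<xi>1"] fr(3,4) by (simp add: lip_linear)
    moreover have "s * \<mu>2 x = 0"
      using arg_cong[OF z, of "lip \<xi>2"] fr(3,5) by (simp add: lip_linear lip_commute[of \<xi>2 \<xi>1])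
    ultimately show "v = 0" using \<mu>[OF x] rs by simp
  qed
  have "principal_curvatures A S f \<ff> \<tt> x (\<kappa>1 x / \<mu>1 x) (\<kappa>2 x / \<mu>2 x)" if x: "x \<in> S" for x
  proof -
    have "D \<phi> \<tt> x v + (\<kappa> / \<mu>) *\<^sub>R D \<phi> \<ff> x v = 0"
      if "\<phi> \<in> A" "x \<in> dom_chart \<phi>" "v \<in> curvature_space A S f \<phi> x (span {csphere x \<kappa> \<mu>})" "\<mu> \<noteq> 0"
      for \<phi> v \<kappa> \<mu>
    proof -
      have "shape \<phi> x (csphere x \<kappa> \<mu>) v = 0"
        using that(3) curvature_space_span[OF x that(1,2) f_mem[OF x]] by blast
      then have "\<kappa> *\<^sub>R D \<phi> \<ff> x v + \<mu> *\<^sub>R D \<phi> \<tt> x v = 0"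
        using lip_frame[OF x] by (simp add: shape_def lip_linear add_eq_0_iff)
      then have "(1 / \<mu>) *\<^sub>R (\<kappa> *\<^sub>R D \<phi> \<ff> x v + \<mu> *\<^sub>R D \<phi> \<tt> x v) = 0" by simp
      then show ?thesis using that(4) by (simp add: scaleR_add_right add.commute)
    qed
    then show ?thesis
      unfolding principal_curvatures_def using principal_sections_spheres[OF ps x] \<mu>[OF x] by blast
  qed
  moreover have "a * (\<kappa>1 x / \<mu>1 x * (\<kappa>2 x / \<mu>2 x)) + 2 * b * ((\<kappa>1 x / \<mu>1 x + \<kappa>2 x / \<mu>2 x) / 2) + c = 0"
    if x: "x \<in> S" for x
  proof -
    define k1 where "k1 = \<kappa>1 x / \<mu>1 x"
    define k2 where "k2 = \<kappa>2 x / \<mu>2 x"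
    have k: "\<kappa>1 x = k1 * \<mu>1 x" "\<kappa>2 x = k2 * \<mu>2 x" using \<mu>[OF x] by (simp_all add: k1_def k2_def)
    have "(a * (k1 * k2) + b * (k1 + k2) + c) * (\<mu>1 x * \<mu>2 x) = 0"
      using lw[OF x] unfolding k by (simp add: algebra_simps)
    then have "a * (k1 * k2) + 2 * b * ((k1 + k2) / 2) + c = 0" using \<mu>[OF x] by simp
    then show ?thesis unfolding k1_def k2_def .
  qed
  moreover have "S \<subseteq> closure {x \<in> S. immerses_at A \<ff> x}"
    using imm closure_subset by fastforce
  ultimately show ?thesis
    unfolding linear_weingarten_def Let_def using abc by blast
qed

end

section \<open>The \<open>\<Omega>\<close>-structure of a linear Weingarten surface\<close>

lemma bounded_bilinear_wedge: "bounded_bilinear (\<lambda>u w. wedge u w z)"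
proof -
  have "bilinear (\<lambda>u w. wedge u w z)"
    by (auto simp: bilinear_def wedge_def linear_iff lip_linear algebra_simps)
  then show ?thesis by (simp add: bilinear_conv_bounded_bilinear)
qed

interpretation wedge: bounded_bilinear "\<lambda>u w. wedge u w z" for z
  by (rule bounded_bilinear_wedge)

text \<open>The basis chosen in the definition of the trace drops out.\<close>

lemma trace_on_rank_two:
  fixes W :: "'a::euclidean_space set"
  assumes "subspace W" "e1 \<in> W" "e2 \<in> W" "linear h1" "linear h2"
    and g: "\<And>u. u \<in> W \<Longrightarrow> g u = h1 u *\<^sub>R e1 + h2 u *\<^sub>R e2"
  shows "trace_on W g = h1 e1 + h2 e2"
proof -
  define B where "B = (SOME B. independent B \<and> span B = W)"
  have "\<exists>B. independent B \<and> span B = W"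
    using basis_exists[of W] assms(1) by (metis span_minimal subset_antisym)
  then have B: "independent B" "span B = W"
    unfolding B_def by (metis (mono_tags, lifting) someI_ex)+
  have BW: "b \<in> W" if "b \<in> B" for b using that B(2) span_base by blast
  have fin: "finite B" using B(1) independent_imp_finite by blast
  have rep: "(\<Sum>b\<in>B. representation B e b * h b) = h e" if "linear h" "e \<in> W" for h :: "'a \<Rightarrow> real" and e
  proof -
    have "h e = h (\<Sum>b\<in>B. representation B e b *\<^sub>R b)"
      using sum_representation_eq[OF B(1) _ fin subset_refl, of e] that(2) B(2) by simp
    then show ?thesis using that(1) by (simp add: linear_sum linear_cmul)
  qed
  have "trace_on W g = (\<Sum>b\<in>B. representation B (g b) b)"
    unfolding trace_on_def B_def[symmetric] by simp
  also have "\<dots> = (\<Sum>b\<in>B. representation B e1 b * h1 b + representation B e2 b * h2 b)"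
  proof (rule sum.cong[OF refl])
    fix b assume b: "b \<in> B"
    show "representation B (g b) b = representation B e1 b * h1 b + representation B e2 b * h2 b"
    proof -
      have "e1 \<in> span B" "e2 \<in> span B" using assms(2,3) B(2) by auto
      then show ?thesis
        unfolding g[OF BW[OF b]] using B(1) by (simp add: representation_add representation_scale span_scale)
    qed
  qed
  also have "\<dots> = h1 e1 + h2 e2" using assms by (simp add: sum.distrib rep)
  finally show ?thesis .
qed

context surface
begin

lemma hasD_chart_change:
  assumes "hasD \<psi> \<sigma> x d" "\<phi> \<in> A" "\<psi> \<in> A" "x \<in> dom_chart \<phi>" "x \<in> dom_chart \<psi>"
  shows "hasD \<phi> \<sigma> x (\<lambda>v. d (D \<phi> (coord \<psi>) x v))"
proof -
  let ?O = "coord \<phi> ` (dom_chart \<phi> \<inter> dom_chart \<psi>)"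
  have O: "open ?O" "coord \<phi> x \<in> ?O"
    using open_chart_image[OF assms(2) open_dom_chart[OF assms(3)]] assms(4,5) by auto
  have "smooth_on ?O (coord \<psi> \<circ> point \<phi>)"
    using surface assms(2,3) unfolding smooth_surface_def by blast
  from smooth_on_has_derivative[OF O(1) this O(2)]
  have c: "((coord \<psi> \<circ> point \<phi>) has_derivative D \<phi> (coord \<psi>) x) (at (coord \<phi> x))"
    by (simp add: D_def[abs_def])
  have "(\<sigma> \<circ> point \<psi> has_derivative d) (at ((coord \<psi> \<circ> point \<phi>) (coord \<phi> x)))"
    using assms(1) point_coord[OF assms(2,4)] by (simp add: hasD_def)
  from diff_chain_at[OF c this]
  have "((\<sigma> \<circ> point \<psi>) \<circ> (coord \<psi> \<circ> point \<phi>) has_derivative d \<circ> D \<phi> (coord \<psi>) x) (at (coord \<phi> x))" .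
  then have "((\<sigma> \<circ> point \<phi>) has_derivative d \<circ> D \<phi> (coord \<psi>) x) (at (coord \<phi> x))"
    by (rule has_derivative_transform_within_open[OF _ O])
      (use coord_point[OF assms(2), of _ "dom_chart \<psi>"] point_coord[OF assms(3)] in auto)
  then show ?thesis using point_coord[OF assms(2,4)] by (simp add: hasD_def comp_def)
qed

end

locale weingarten_lift = legendre_lift +
  fixes a b c :: real
  assumes non_tub: "b\<^sup>2 - a * c \<noteq> 0"
    and weingarten: "x \<in> S \<Longrightarrow> \<exists>N \<kappa>1 \<mu>1 \<kappa>2 \<mu>2. x \<in> N \<and> principal_sections N \<kappa>1 \<mu>1 \<kappa>2 \<mu>2 \<and>
      (\<forall>y\<in>N. W_form a b c (\<kappa>1 y) (\<mu>1 y) (\<kappa>2 y) (\<mu>2 y) = 0)"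
begin

text \<open>The form \<open>\<eta>\<close> is \<open>\<ff> \<and> \<alpha> + \<tt> \<and> \<beta>\<close> with \<open>\<alpha>, \<beta> \<bottom> f, \<pp>, \<qq>\<close>.\<close>

definition \<alpha> where "\<alpha> \<phi> x v = c *\<^sub>R D \<phi> \<ff> x v - b *\<^sub>R D \<phi> \<tt> x v"
definition \<beta> where "\<beta> \<phi> x v = a *\<^sub>R D \<phi> \<tt> x v - b *\<^sub>R D \<phi> \<ff> x v"

abbreviation \<eta> where "\<eta> \<equiv> eta_mid \<ff> \<tt> a b c"

lemma eta_wedge: "\<eta> \<phi> x v z = wedge (\<ff> x) (\<alpha> \<phi> x v) z + wedge (\<tt> x) (\<beta> \<phi> x v) z"
  by (simp add: eta_mid_def \<alpha>_def \<beta>_def wedge.diff_right wedge.scaleR_right algebra_simps)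

lemma eta_eq: "\<eta> \<phi> x v z = lip (\<ff> x) z *\<^sub>R \<alpha> \<phi> x v - lip (\<alpha> \<phi> x v) z *\<^sub>R \<ff> x +
    (lip (\<tt> x) z *\<^sub>R \<beta> \<phi> x v - lip (\<beta> \<phi> x v) z *\<^sub>R \<tt> x)"
  by (simp add: eta_wedge wedge_def)

lemma alpha_beta_perp:
  assumes "x \<in> S" "\<phi> \<in> A" "x \<in> dom_chart \<phi>"
  shows "lip (\<alpha> \<phi> x v) (\<ff> x) = 0" "lip (\<alpha> \<phi> x v) (\<tt> x) = 0" "lip (\<alpha> \<phi> x v) \<pp> = 0" "lip (\<alpha> \<phi> x v) \<qq> = 0"
    "lip (\<beta> \<phi> x v) (\<ff> x) = 0" "lip (\<beta> \<phi> x v) (\<tt> x) = 0" "lip (\<beta> \<phi> x v) \<pp> = 0" "lip (\<beta> \<phi> x v) \<qq> = 0"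
  by (simp_all add: \<alpha>_def \<beta>_def lip_linear D_frame_perp[OF assms])

lemmas alpha_beta_perp' = alpha_beta_perp[THEN trans[OF lip_commute]]

lemma eta_linear:
  assumes "x \<in> S" "\<phi> \<in> A" "x \<in> dom_chart \<phi>"
  shows "linear (\<lambda>v. \<eta> \<phi> x v z)" "linear (\<eta> \<phi> x v)"
proof -
  have "linear (\<alpha> \<phi> x)" "linear (\<beta> \<phi> x)"
    unfolding \<alpha>_def[abs_def] \<beta>_def[abs_def]
    by (intro linear_compose_sub linear_compose_scale_right D_frame_linear[OF assms])+
  then show "linear (\<lambda>v. \<eta> \<phi> x v z)"
    by (simp add: linear_iff eta_wedge wedge.add_right wedge.scaleR_right algebra_simps)
  show "linear (\<eta> \<phi> x v)"
    by (simp add: linear_iff eta_eq lip_linear algebra_simps)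
qed

lemma eta_skew: "lip (\<eta> \<phi> x v z) w = - lip z (\<eta> \<phi> x v w)"
  by (simp add: eta_wedge lip_linear lip_wedge_skew)

lemma eta_smooth:
  assumes "\<phi> \<in> A"
  shows "smooth_on (coord \<phi> ` (dom_chart \<phi> \<inter> S)) ((\<lambda>x. \<eta> \<phi> x v z) \<circ> point \<phi>)"
proof -
  let ?O = "coord \<phi> ` (dom_chart \<phi> \<inter> S)"
  have O: "open ?O" by (rule open_chart_image[OF assms open_S])
  have sm: "smooth_on ?O (\<lambda>u. \<ff> (point \<phi> u))" "smooth_on ?O (\<lambda>u. \<tt> (point \<phi> u))"
    using smooth_mapD[OF smooth_f assms] smooth_mapD[OF smooth_t assms] by (simp_all add: comp_def)
  have D: "smooth_on ?O (\<lambda>u. D \<phi> \<ff> (point \<phi> u) v)" "smooth_on ?O (\<lambda>u. D \<phi> \<tt> (point \<phi> u) v)"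
    using smooth_on_D[OF smooth_f open_S assms] smooth_on_D[OF smooth_t open_S assms] by (simp_all add: comp_def)
  note bil = smooth_on_bilinear[OF _ O]
  have "smooth_on ?O (\<lambda>u. (c *\<^sub>R wedge (\<ff> (point \<phi> u)) (D \<phi> \<ff> (point \<phi> u) v) z
     + (- b) *\<^sub>R (wedge (\<ff> (point \<phi> u)) (D \<phi> \<tt> (point \<phi> u) v) z + wedge (\<tt> (point \<phi> u)) (D \<phi> \<ff> (point \<phi> u) v) z))
     + a *\<^sub>R wedge (\<tt> (point \<phi> u)) (D \<phi> \<tt> (point \<phi> u) v) z)"
    by (intro smooth_on_add[OF O] bil[OF bounded_bilinear_scaleR] smooth_on_const bil[OF bounded_bilinear_wedge] sm D)
  then show ?thesis by (simp add: eta_mid_def comp_def)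
qed

lemma eta_chart_change:
  assumes "x \<in> S" "\<phi> \<in> A" "\<psi> \<in> A" "x \<in> dom_chart \<phi>" "x \<in> dom_chart \<psi>"
  shows "\<eta> \<phi> x v = \<eta> \<psi> x (D \<phi> (coord \<psi>) x v)"
  using hasD_D[OF hasD_chart_change[OF hasD_f assms(2-5)]] hasD_D[OF hasD_chart_change[OF hasD_t assms(2-5)]] assms
  by (simp add: eta_mid_def)

lemma one_form_eta: "one_form A S \<eta>"
  unfolding one_form_def using eta_linear(1) eta_smooth eta_chart_change by blast

lemma wedge_space_eta:
  assumes x: "x \<in> S" "\<phi> \<in> A" "x \<in> dom_chart \<phi>"
  shows "\<eta> \<phi> x v \<in> wedge_space (f x) (perp (f x))"
proof -
  let ?u = "\<lambda>i::nat. if i = 0 then \<ff> x else \<tt> x" and ?w = "\<lambda>i::nat. if i = 0 then \<alpha> \<phi> x v else \<beta> \<phi> x v"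
  have "\<ff> x \<in> f x" "\<tt> x \<in> f x" using f_mem[OF x(1), of 1 0] f_mem[OF x(1), of 0 1] by auto
  moreover have "\<alpha> \<phi> x v \<in> perp (f x)" "\<beta> \<phi> x v \<in> perp (f x)"
    unfolding fibre[OF x(1)] perp_span using alpha_beta_perp[OF x] by (simp_all add: perp_def)
  moreover have "\<eta> \<phi> x v = (\<lambda>z. \<Sum>i<2. wedge (?u i) (?w i) z)"
    by (rule ext) (simp add: eta_wedge numeral_2_eq_2 lessThan_Suc)
  ultimately show ?thesis
    unfolding wedge_space_def by (intro CollectI exI[of _ 2] exI[of _ ?u] exI[of _ ?w]) auto
qed

lemma weingarten_frame:
  assumes x: "x \<in> S" "\<phi> \<in> A" "x \<in> dom_chart \<phi>"
  obtains \<kappa>1 \<mu>1 \<kappa>2 \<mu>2 v1 v2 \<xi>1 \<xi>2 where "\<kappa>1 * \<mu>2 \<noteq> \<mu>1 * \<kappa>2"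
    "W_form a b c \<kappa>1 \<mu>1 \<kappa>2 \<mu>2 = 0"
    "D \<phi> \<ff> x v1 = \<mu>1 *\<^sub>R \<xi>1" "D \<phi> \<tt> x v1 = - \<kappa>1 *\<^sub>R \<xi>1"
    "D \<phi> \<ff> x v2 = \<mu>2 *\<^sub>R \<xi>2" "D \<phi> \<tt> x v2 = - \<kappa>2 *\<^sub>R \<xi>2"
    "lip \<xi>1 \<xi>2 = 0" "lip \<xi>1 \<xi>1 > 0" "lip \<xi>2 \<xi>2 > 0"
    "\<And>z. z \<in> {\<ff> x, \<tt> x, \<pp>, \<qq>} \<Longrightarrow> lip \<xi>1 z = 0 \<and> lip \<xi>2 z = 0"
    "\<And>v. \<exists>r s. v = r *\<^sub>R v1 + s *\<^sub>R v2"
proof -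
  obtain N \<kappa>1 \<mu>1 \<kappa>2 \<mu>2 where ps: "x \<in> N" "principal_sections N \<kappa>1 \<mu>1 \<kappa>2 \<mu>2"
    and w: "W_form a b c (\<kappa>1 x) (\<mu>1 x) (\<kappa>2 x) (\<mu>2 x) = 0"
    using weingarten[OF x(1)] by blast
  have ind: "\<kappa>1 x * \<mu>2 x \<noteq> \<mu>1 x * \<kappa>2 x" using ps unfolding principal_sections_def by blast
  obtain v1 v2 where "v1 \<noteq> 0" "shape \<phi> x (csphere x (\<kappa>1 x) (\<mu>1 x)) v1 = 0"
    "v2 \<noteq> 0" "shape \<phi> x (csphere x (\<kappa>2 x) (\<mu>2 x)) v2 = 0"
    using ps x unfolding principal_sections_def by blast
  from principal_frame[OF x refl refl ind this] that[OF ind w] show ?thesis by metis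
qed

text \<open>Modulo second derivatives, which cancel, \<open>d\<eta>\<close> is \<open>2 W(s\<^sub>1, s\<^sub>2) \<xi>\<^sub>1 \<and> \<xi>\<^sub>2\<close> on the two curvature
  directions.\<close>

lemma closed_eta: "closed_form A S \<eta>"
  unfolding closed_form_def
proof (intro ballI allI)
  fix \<phi> x v w z assume \<phi>: "\<phi> \<in> A" and "x \<in> S \<inter> dom_chart \<phi>"
  then have x: "x \<in> S" "\<phi> \<in> A" "x \<in> dom_chart \<phi>" by auto
  let ?F = "D \<phi> \<ff> x" and ?G = "D \<phi> \<tt> x"
  note h = hasD_f[OF x] hasD_t[OF x] hasD_second[OF smooth_f open_S x] hasD_second[OF smooth_t open_S x]
  note wd = hasD_bilinear[OF bounded_bilinear_wedge]
  define \<Omega> where "\<Omega> v w = c *\<^sub>R wedge (?F v) (?F w) z - b *\<^sub>R (wedge (?F v) (?G w) z + wedge (?G v) (?F w) z) +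
    a *\<^sub>R wedge (?G v) (?G w) z" for v w
  define \<Theta> where "\<Theta> v w = c *\<^sub>R wedge (\<ff> x) (D \<phi> (\<lambda>y. D \<phi> \<ff> y w) x v) z -
    b *\<^sub>R (wedge (\<ff> x) (D \<phi> (\<lambda>y. D \<phi> \<tt> y w) x v) z + wedge (\<tt> x) (D \<phi> (\<lambda>y. D \<phi> \<ff> y w) x v) z) +
    a *\<^sub>R wedge (\<tt> x) (D \<phi> (\<lambda>y. D \<phi> \<tt> y w) x v) z" for v w
  have D\<eta>: "D \<phi> (\<lambda>y. \<eta> \<phi> y w z) x v = \<Theta> v w + \<Omega> v w" for v w
    unfolding eta_mid_def
    by (subst hasD_D[OF hasD_add[OF hasD_diff[OF hasD_scaleR_right[OF wd[OF h(1,3)]]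
          hasD_scaleR_right[OF hasD_add[OF wd[OF h(1,4)] wd[OF h(2,3)]]]] hasD_scaleR_right[OF wd[OF h(2,4)]]]])
      (simp add: \<Theta>_def \<Omega>_def algebra_simps)
  have sym: "\<Theta> v w = \<Theta> w v"
    unfolding \<Theta>_def using D_second_symmetric[OF smooth_f open_S x, of v w] D_second_symmetric[OF smooth_t open_S x, of v w]
    by simp
  have \<Omega>0: "\<Omega> v w = 0" for v w
  proof -
    obtain \<kappa>1 \<mu>1 \<kappa>2 \<mu>2 v1 v2 \<xi>1 \<xi>2 where W: "W_form a b c \<kappa>1 \<mu>1 \<kappa>2 \<mu>2 = 0"
      and fr: "?F v1 = \<mu>1 *\<^sub>R \<xi>1" "?G v1 = - \<kappa>1 *\<^sub>R \<xi>1" "?F v2 = \<mu>2 *\<^sub>R \<xi>2" "?G v2 = - \<kappa>2 *\<^sub>R \<xi>2"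
      and sp: "\<And>v. \<exists>r s. v = r *\<^sub>R v1 + s *\<^sub>R v2"
      using weingarten_frame[OF x] by metis
    obtain r s r' s' where vw: "v = r *\<^sub>R v1 + s *\<^sub>R v2" "w = r' *\<^sub>R v1 + s' *\<^sub>R v2" using sp by metis
    have F: "?F v = (r * \<mu>1) *\<^sub>R \<xi>1 + (s * \<mu>2) *\<^sub>R \<xi>2" "?F w = (r' * \<mu>1) *\<^sub>R \<xi>1 + (s' * \<mu>2) *\<^sub>R \<xi>2"
      and G: "?G v = (- r * \<kappa>1) *\<^sub>R \<xi>1 + (- s * \<kappa>2) *\<^sub>R \<xi>2" "?G w = (- r' * \<kappa>1) *\<^sub>R \<xi>1 + (- s' * \<kappa>2) *\<^sub>R \<xi>2"
      using D_frame_linear[OF x] by (simp_all add: vw linear_add linear_cmul fr)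
    have wl: "wedge (p *\<^sub>R \<xi>1 + q *\<^sub>R \<xi>2) (p' *\<^sub>R \<xi>1 + q' *\<^sub>R \<xi>2) z = (p * q' - q * p') *\<^sub>R wedge \<xi>1 \<xi>2 z" for p q p' q'
      by (simp add: wedge.add_left wedge.add_right wedge.scaleR_left wedge.scaleR_right wedge_self
          wedge_commute[of \<xi>2 \<xi>1] algebra_simps)
    have "\<Omega> v w = ((r * s' - s * r') * (W_form a b c \<kappa>1 \<mu>1 \<kappa>2 \<mu>2)) *\<^sub>R wedge \<xi>1 \<xi>2 z"
      unfolding \<Omega>_def F G wl scaleR_scaleR scaleR_add_left[symmetric] scaleR_diff_left[symmetric]
      by (rule arg_cong[of _ _ "\<lambda>t. t *\<^sub>R wedge \<xi>1 \<xi>2 z"]) (simp add: algebra_simps)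
    then show ?thesis using W by simp
  qed
  show "D \<phi> (\<lambda>y. \<eta> \<phi> y w z) x v - D \<phi> (\<lambda>y. \<eta> \<phi> y v z) x w = 0"
    using sym by (simp add: D\<eta> \<Omega>0)
qed

lemma alpha_beta_symmetric:
  assumes x: "x \<in> S" "\<phi> \<in> A" "x \<in> dom_chart \<phi>"
  shows "lip (\<alpha> \<phi> x v) (\<beta> \<phi> x w) = lip (\<alpha> \<phi> x w) (\<beta> \<phi> x v)"
  using second_form_symmetric[OF x, of v w]
  by (simp add: \<alpha>_def \<beta>_def lip_linear lip_commute[of "D \<phi> \<tt> x v" "D \<phi> \<ff> x w"]
      lip_commute[of "D \<phi> \<tt> x w" "D \<phi> \<ff> x v"] lip_commute[of "D \<phi> \<tt> x w" "D \<phi> \<tt> x v"]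
      lip_commute[of "D \<phi> \<ff> x w" "D \<phi> \<ff> x v"] algebra_simps)

text \<open>As \<open>\<eta>\<close> takes values in \<open>f \<and> f\<^sup>\<bottom>\<close>, the commutator is a multiple of \<open>\<ff> \<and> \<tt>\<close>, with the factor
  \<open>(\<alpha> v, \<beta> w) - (\<alpha> w, \<beta> v)\<close>.\<close>

lemma eta_commute:
  assumes x: "x \<in> S" "\<phi> \<in> A" "x \<in> dom_chart \<phi>"
  shows "\<eta> \<phi> x v (\<eta> \<phi> x w z) = \<eta> \<phi> x w (\<eta> \<phi> x v z)"
proof -
  have ab: "lip (\<beta> \<phi> x w) (\<alpha> \<phi> x v) = lip (\<alpha> \<phi> x v) (\<beta> \<phi> x w)" for v w by (rule lip_commute)
  have "\<eta> \<phi> x v (\<eta> \<phi> x w z) =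
    - (lip (\<ff> x) z * lip (\<alpha> \<phi> x v) (\<alpha> \<phi> x w) + lip (\<tt> x) z * lip (\<alpha> \<phi> x v) (\<beta> \<phi> x w)) *\<^sub>R \<ff> x
    - (lip (\<ff> x) z * lip (\<alpha> \<phi> x w) (\<beta> \<phi> x v) + lip (\<tt> x) z * lip (\<beta> \<phi> x v) (\<beta> \<phi> x w)) *\<^sub>R \<tt> x" for v w
    unfolding eta_eq[of \<phi> x v] eta_eq[of \<phi> x w]
    by (simp add: lip_linear lip_frame[OF x(1)] alpha_beta_perp[OF x] alpha_beta_perp'[OF x] ab algebra_simps)
  then show ?thesis
    using alpha_beta_symmetric[OF x, of v w] lip_commute[of "\<alpha> \<phi> x v" "\<alpha> \<phi> x w"] lip_commute[of "\<beta> \<phi> x v" "\<beta> \<phi> x w"]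
    by simp
qed

text \<open>As \<open>\<eta>\<close> kills \<open>f\<close>, only the class of \<open>d\<sigma>\<close> modulo \<open>f\<close> matters, whatever extension \<open>\<sigma>\<close> is chosen.\<close>

lemma quadratic_differential_eta:
  assumes x: "x \<in> S" "\<phi> \<in> A" "x \<in> dom_chart \<phi>"
  shows "quadratic_differential A S f \<eta> \<phi> x v w = - lip (\<alpha> \<phi> x v) (D \<phi> \<ff> x w) - lip (\<beta> \<phi> x v) (D \<phi> \<tt> x w)"
proof -
  let ?g = "\<lambda>u. \<eta> \<phi> x v (D \<phi> (SOME \<sigma>. local_section A S f x \<sigma> \<and> \<sigma> x = u) x w)"
  have lin: "linear (\<lambda>u. lip z (shape \<phi> x u w))" for z
    by (simp add: shape_def lip_linear linear_iff algebra_simps)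
  have g: "?g u = lip (\<alpha> \<phi> x v) (shape \<phi> x u w) *\<^sub>R \<ff> x + lip (\<beta> \<phi> x v) (shape \<phi> x u w) *\<^sub>R \<tt> x" if u: "u \<in> f x" for u
  proof -
    define \<sigma> where "\<sigma> = (SOME \<sigma>. local_section A S f x \<sigma> \<and> \<sigma> x = u)"
    have "\<exists>\<sigma>. local_section A S f x \<sigma> \<and> \<sigma> x = u"
      using local_section_combination[OF x(1), of "- lip u \<qq>" "- lip u \<pp>"] f_decomp[OF x(1) u] by force
    then have \<sigma>: "local_section A S f x \<sigma>" "\<sigma> x = u" unfolding \<sigma>_def by (metis (mono_tags, lifting) someI_ex)+
    have "\<eta> \<phi> x v (D \<phi> \<sigma> x w) = \<eta> \<phi> x v (- lip (D \<phi> \<sigma> x w) \<qq> *\<^sub>R \<ff> x - lip (D \<phi> \<sigma> x w) \<pp> *\<^sub>R \<tt> x - shape \<phi> x u w)"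
      using local_section_hasD(4)[OF \<sigma>(1) x(2,3), of w] \<sigma>(2) by simp
    also have "\<dots> = lip (\<alpha> \<phi> x v) (shape \<phi> x u w) *\<^sub>R \<ff> x + lip (\<beta> \<phi> x v) (shape \<phi> x u w) *\<^sub>R \<tt> x"
      unfolding eta_eq by (simp add: lip_linear lip_frame[OF x(1)] alpha_beta_perp[OF x]
          shape_perp[OF x, THEN trans[OF lip_commute]])
    finally show ?thesis by (simp add: \<sigma>_def)
  qed
  have "trace_on (f x) ?g = lip (\<alpha> \<phi> x v) (shape \<phi> x (\<ff> x) w) + lip (\<beta> \<phi> x v) (shape \<phi> x (\<tt> x) w)"
    by (rule trace_on_rank_two[OF _ _ _ lin lin g])
      (use f_mem[OF x(1), of 1 0] f_mem[OF x(1), of 0 1] in \<open>auto simp: fibre[OF x(1)]\<close>)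
  then show ?thesis
    unfolding quadratic_differential_def by (simp add: shape_def lip_frame[OF x(1)] lip_linear)
qed

text \<open>On the curvature directions the quadratic differential is diagonal with entries
  \<open>- W(s\<^sub>i, s\<^sub>i) |\<xi>\<^sub>i|\<^sup>2\<close>, which do not vanish since \<open>W\<close> is a non-degenerate form with \<open>W(s\<^sub>1, s\<^sub>2) = 0\<close>.\<close>

lemma conjugate_nonzero:
  assumes ind: "\<kappa>1 * \<mu>2 \<noteq> \<mu>1 * \<kappa>2" and W: "W_form a b c \<kappa>1 \<mu>1 \<kappa>2 \<mu>2 = 0"
  shows "a * \<kappa>1 * \<kappa>1 + 2 * b * \<kappa>1 * \<mu>1 + c * \<mu>1 * \<mu>1 \<noteq> 0"
proof
  assume 0: "a * \<kappa>1 * \<kappa>1 + 2 * b * \<kappa>1 * \<mu>1 + c * \<mu>1 * \<mu>1 = 0"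
  have "(\<kappa>1 * \<mu>2 - \<mu>1 * \<kappa>2) * (a * \<kappa>1 + b * \<mu>1) = 0" "(\<kappa>1 * \<mu>2 - \<mu>1 * \<kappa>2) * (b * \<kappa>1 + c * \<mu>1) = 0"
    using 0 W by algebra+
  then have e: "a * \<kappa>1 + b * \<mu>1 = 0" "b * \<kappa>1 + c * \<mu>1 = 0" using ind by auto
  have "(b\<^sup>2 - a * c) * \<kappa>1 = 0" "(b\<^sup>2 - a * c) * \<mu>1 = 0" using e by algebra+
  then show False using non_tub ind by auto
qed

lemma quadratic_differential_nondegenerate:
  assumes x: "x \<in> S" "\<phi> \<in> A" "x \<in> dom_chart \<phi>" and "v \<noteq> 0"
  shows "\<exists>w. quadratic_differential A S f \<eta> \<phi> x v w \<noteq> 0"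
proof -
  obtain \<kappa>1 \<mu>1 \<kappa>2 \<mu>2 v1 v2 \<xi>1 \<xi>2 where ind: "\<kappa>1 * \<mu>2 \<noteq> \<mu>1 * \<kappa>2"
    and W: "W_form a b c \<kappa>1 \<mu>1 \<kappa>2 \<mu>2 = 0"
    and fr: "D \<phi> \<ff> x v1 = \<mu>1 *\<^sub>R \<xi>1" "D \<phi> \<tt> x v1 = - \<kappa>1 *\<^sub>R \<xi>1" "D \<phi> \<ff> x v2 = \<mu>2 *\<^sub>R \<xi>2" "D \<phi> \<tt> x v2 = - \<kappa>2 *\<^sub>R \<xi>2"
    and o: "lip \<xi>1 \<xi>2 = 0" "lip \<xi>1 \<xi>1 > 0" "lip \<xi>2 \<xi>2 > 0"
    and sp: "\<And>v. \<exists>r s. v = r *\<^sub>R v1 + s *\<^sub>R v2"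
    using weingarten_frame[OF x] by metis
  have o': "lip \<xi>2 \<xi>1 = 0" using o(1) lip_commute by metis
  obtain r s where v: "v = r *\<^sub>R v1 + s *\<^sub>R v2" using sp by blast
  have D: "D \<phi> \<ff> x v = (r * \<mu>1) *\<^sub>R \<xi>1 + (s * \<mu>2) *\<^sub>R \<xi>2" "D \<phi> \<tt> x v = - (r * \<kappa>1) *\<^sub>R \<xi>1 - (s * \<kappa>2) *\<^sub>R \<xi>2"
    using D_frame_linear[OF x] by (simp_all add: v linear_add linear_cmul fr)
  have "quadratic_differential A S f \<eta> \<phi> x v v1 =
      - r * (a * \<kappa>1 * \<kappa>1 + 2 * b * \<kappa>1 * \<mu>1 + c * \<mu>1 * \<mu>1) * lip \<xi>1 \<xi>1"
    unfolding quadratic_differential_eta[OF x] \<alpha>_def \<beta>_def D fr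
    by (simp add: lip_linear o o' algebra_simps)
  moreover have "quadratic_differential A S f \<eta> \<phi> x v v2 =
      - s * (a * \<kappa>2 * \<kappa>2 + 2 * b * \<kappa>2 * \<mu>2 + c * \<mu>2 * \<mu>2) * lip \<xi>2 \<xi>2"
    unfolding quadratic_differential_eta[OF x] \<alpha>_def \<beta>_def D fr
    by (simp add: lip_linear o o' algebra_simps)
  moreover have "a * \<kappa>1 * \<kappa>1 + 2 * b * \<kappa>1 * \<mu>1 + c * \<mu>1 * \<mu>1 \<noteq> 0" by (rule conjugate_nonzero[OF ind W])
  moreover have "a * \<kappa>2 * \<kappa>2 + 2 * b * \<kappa>2 * \<mu>2 + c * \<mu>2 * \<mu>2 \<noteq> 0"
    by (rule conjugate_nonzero[of \<kappa>2 \<mu>1 \<mu>2 \<kappa>1]) (use ind W in \<open>auto simp: algebra_simps\<close>)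
  moreover have "r \<noteq> 0 \<or> s \<noteq> 0" using v \<open>v \<noteq> 0\<close> by auto
  ultimately show ?thesis using o(2,3) by (metis less_irrefl mult_eq_0_iff neg_equal_0_iff_equal)
qed

lemma omega_surface_eta: "omega_surface A S f \<eta>"
  unfolding omega_surface_def
proof (intro conjI ballI allI exI[of _ S] impI)
  show "\<eta> \<phi> x v \<circ> \<eta> \<phi> x w = \<eta> \<phi> x w \<circ> \<eta> \<phi> x v" if "\<phi> \<in> A" "x \<in> S \<inter> dom_chart \<phi>" for \<phi> x v w
    using that by (intro ext) (simp add: eta_commute)
  show "S \<subseteq> closure S" by (rule closure_subset)
qed (use legendre_map_lift one_form_eta wedge_space_eta closed_eta open_S quadratic_differential_nondegenerate in blast)+

end

lemma weingarten_liftI: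
  assumes "smooth_surface A" "open S" "umbilic_free_lw_surface A S f \<pp> \<qq> \<ff> \<tt> a b c" "non_tubular a b c"
  shows "weingarten_lift A S f \<pp> \<qq> \<ff> \<tt> a b c"
proof -
  have lw: "legendre_map A S f" "projects_to A S f \<pp> \<qq> \<ff> \<tt>" "umbilic_free A S f" "linear_weingarten A S f \<ff> \<tt> a b c"
    using assms(3) by (auto simp: umbilic_free_lw_surface_def)
  interpret legendre_lift A S f \<pp> \<qq> \<ff> \<tt>
    by (rule legendre_liftI[OF assms(1,2) lw(1,2)])
  show ?thesis
  proof unfold_locales
    show "b\<^sup>2 - a * c \<noteq> 0" using assms(4) by (simp add: non_tubular_def)
    fix x assume "x \<in> S"
    from umbilic_freeE[OF lw(3) this]
    show "\<exists>N \<kappa>1 \<mu>1 \<kappa>2 \<mu>2. x \<in> N \<and> principal_sections N \<kappa>1 \<mu>1 \<kappa>2 \<mu>2 \<and>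
      (\<forall>y\<in>N. W_form a b c (\<kappa>1 y) (\<mu>1 y) (\<kappa>2 y) (\<mu>2 y) = 0)"
      using weingarten_everywhere[OF _ lw(4)] by metis
  qed
qed

section \<open>Darboux transforms\<close>

text \<open>The values of \<open>\<sigma>\<close> on the curvature spheres \<open>\<kappa> \<ff> + \<mu> \<tt>\<close> and on their conjugates with respect to
  \<open>W\<close>, the value of \<open>W\<close> on \<open>\<tau>\<close>, and the coefficients of the curvature spheres of the transform,
  as functions of \<open>(\<sigma>, \<ff>)\<close> and \<open>(\<sigma>, \<tt>)\<close>.\<close>

definition sphere_value :: "real \<Rightarrow> real \<Rightarrow> real \<Rightarrow> real \<Rightarrow> real" where
  "sphere_value \<kappa> \<mu> p q = \<kappa> * p + \<mu> * q"

definition conjugate_value :: "real \<Rightarrow> real \<Rightarrow> real \<Rightarrow> real \<Rightarrow> real \<Rightarrow> real \<Rightarrow> real \<Rightarrow> real" where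
  "conjugate_value a b c \<kappa> \<mu> p q = (c * \<mu> + b * \<kappa>) * p - (a * \<kappa> + b * \<mu>) * q"

definition weingarten_value :: "real \<Rightarrow> real \<Rightarrow> real \<Rightarrow> real \<Rightarrow> real \<Rightarrow> real" where
  "weingarten_value a b c p q = c * p * p - 2 * b * p * q + a * q * q"

definition new_\<kappa> :: "real \<Rightarrow> real \<Rightarrow> real \<Rightarrow> real \<Rightarrow> real \<Rightarrow> real \<Rightarrow> real \<Rightarrow> real" where
  "new_\<kappa> a b c \<kappa> \<mu> p q = conjugate_value a b c \<kappa> \<mu> p q * q - sphere_value \<kappa> \<mu> p q * (b * q - c * p)"

definition new_\<mu> :: "real \<Rightarrow> real \<Rightarrow> real \<Rightarrow> real \<Rightarrow> real \<Rightarrow> real \<Rightarrow> real \<Rightarrow> real" where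
  "new_\<mu> a b c \<kappa> \<mu> p q = - conjugate_value a b c \<kappa> \<mu> p q * p - sphere_value \<kappa> \<mu> p q * (b * p - a * q)"

lemmas value_defs = sphere_value_def conjugate_value_def weingarten_value_def new_\<kappa>_def new_\<mu>_def

lemma conjugate_value_product:
  "conjugate_value a b c \<kappa> \<mu> p q * conjugate_value a b c \<kappa>' \<mu>' p q =
   (b\<^sup>2 - a * c) * (sphere_value \<kappa> \<mu> p q * sphere_value \<kappa>' \<mu>' p q) +
   weingarten_value a b c p q * (W_form a b c \<kappa> \<mu> \<kappa>' \<mu>')"
  unfolding value_defs by (simp add: power2_eq_square algebra_simps)

text \<open>In the frame \<open>\<tau>, \<sigma> / m\<close> of the transform, the form \<open>W\<close> is \<open>W(\<tau>, \<tau>)\<close> times the diagonal form with entries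
  \<open>1, a c - b\<^sup>2\<close>; these are the equations \<open>mixed\<close> and \<open>square\<close> of the proof.\<close>

lemma new_weingarten:
  "a * new_\<kappa> a b c \<kappa> \<mu> p q * new_\<kappa> a b c \<kappa>' \<mu>' p q +
    b * (new_\<kappa> a b c \<kappa> \<mu> p q * new_\<mu> a b c \<kappa>' \<mu>' p q + new_\<mu> a b c \<kappa> \<mu> p q * new_\<kappa> a b c \<kappa>' \<mu>' p q) +
    c * new_\<mu> a b c \<kappa> \<mu> p q * new_\<mu> a b c \<kappa>' \<mu>' p q =
   (weingarten_value a b c p q)\<^sup>2 * (W_form a b c \<kappa> \<mu> \<kappa>' \<mu>')" (is "?l = ?n\<^sup>2 * ?w")
proof -
  have expand: "a * (\<Lambda> * q - T * y) * (\<Lambda>' * q - T' * y) +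
      b * ((\<Lambda> * q - T * y) * (- \<Lambda>' * p - T' * x) + (- \<Lambda> * p - T * x) * (\<Lambda>' * q - T' * y)) +
      c * (- \<Lambda> * p - T * x) * (- \<Lambda>' * p - T' * x) =
    \<Lambda> * \<Lambda>' * (c * p * p - 2 * b * p * q + a * q * q) - (\<Lambda> * T' + T * \<Lambda>') * (a * q * y + b * (q * x - p * y) - c * p * x) +
    T * T' * (a * y * y + 2 * b * x * y + c * x * x)" for \<Lambda> \<Lambda>' T T' x y :: real
    by (simp add: algebra_simps)
  have mixed: "a * q * (b * q - c * p) + b * (q * (b * p - a * q) - p * (b * q - c * p)) - c * p * (b * p - a * q) = 0"
    by (simp add: algebra_simps)
  have square: "a * (b * q - c * p) * (b * q - c * p) + 2 * b * (b * p - a * q) * (b * q - c * p) +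
      c * (b * p - a * q) * (b * p - a * q) = (a * c - b\<^sup>2) * ?n"
    by (simp add: weingarten_value_def power2_eq_square algebra_simps)
  have "?l = conjugate_value a b c \<kappa> \<mu> p q * conjugate_value a b c \<kappa>' \<mu>' p q * ?n +
      sphere_value \<kappa> \<mu> p q * sphere_value \<kappa>' \<mu>' p q * ((a * c - b\<^sup>2) * ?n)"
    unfolding new_\<kappa>_def new_\<mu>_def expand mixed square weingarten_value_def by simp
  also have "\<dots> = ?n\<^sup>2 * ?w"
    unfolding conjugate_value_product by (simp add: power2_eq_square algebra_simps)
  finally show ?thesis .
qed

lemma new_determinant:
  "new_\<kappa> a b c \<kappa> \<mu> p q * new_\<mu> a b c \<kappa>' \<mu>' p q - new_\<mu> a b c \<kappa> \<mu> p q * new_\<kappa> a b c \<kappa>' \<mu>' p q =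
   - (weingarten_value a b c p q)\<^sup>2 * (\<kappa> * \<mu>' - \<mu> * \<kappa>')"
proof -
  have expand: "(\<Lambda> * q - T * y) * (- \<Lambda>' * p - T' * x) - (- \<Lambda> * p - T * x) * (\<Lambda>' * q - T' * y) =
    - (\<Lambda> * T' - T * \<Lambda>') * (q * x + p * y)" for \<Lambda> \<Lambda>' T T' x y :: real
    by (simp add: algebra_simps)
  have 1: "q * (b * p - a * q) + p * (b * q - c * p) = - weingarten_value a b c p q"
    by (simp add: weingarten_value_def algebra_simps)
  have 2: "conjugate_value a b c \<kappa> \<mu> p q * sphere_value \<kappa>' \<mu>' p q - sphere_value \<kappa> \<mu> p q * conjugate_value a b c \<kappa>' \<mu>' p q =
      - weingarten_value a b c p q * (\<kappa> * \<mu>' - \<mu> * \<kappa>')"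
    by (simp add: value_defs algebra_simps)
  show ?thesis
    unfolding new_\<kappa>_def new_\<mu>_def expand 1 2 by (simp add: power2_eq_square algebra_simps)
qed

text \<open>The curvature spheres are spanned on all of \<open>S\<close> by given sections, as they are locally.\<close>

locale darboux_lift = weingarten_lift +
  fixes m :: real and \<sigma> :: "'a \<Rightarrow> R42" and \<kappa>1 \<mu>1 \<kappa>2 \<mu>2 :: "'a \<Rightarrow> real"
  assumes m: "m \<noteq> 0" and smooth_\<sigma>: "smooth_map A S \<sigma>"
    and null_\<sigma>: "x \<in> S \<Longrightarrow> lip (\<sigma> x) (\<sigma> x) = 0"
    and parallel_\<sigma>: "x \<in> S \<Longrightarrow> \<phi> \<in> A \<Longrightarrow> x \<in> dom_chart \<phi> \<Longrightarrow> D \<phi> \<sigma> x v = - m *\<^sub>R \<eta> \<phi> x v (\<sigma> x)"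
    and perp_p: "x \<in> S \<Longrightarrow> lip (\<sigma> x) (p_of \<pp> \<ff> \<tt> a b m x) = 0"
    and perp_q: "x \<in> S \<Longrightarrow> lip (\<sigma> x) (q_of \<qq> \<ff> \<tt> b c m x) = 0"
    and sections: "principal_sections S \<kappa>1 \<mu>1 \<kappa>2 \<mu>2"
    and W: "x \<in> S \<Longrightarrow> W_form a b c (\<kappa>1 x) (\<mu>1 x) (\<kappa>2 x) (\<mu>2 x) = 0"
begin

definition "A1 x = lip (\<sigma> x) (\<ff> x)"
definition "A2 x = lip (\<sigma> x) (\<tt> x)"
definition "\<tau> x = A2 x *\<^sub>R \<ff> x - A1 x *\<^sub>R \<tt> x"

abbreviation "\<kappa>1' x \<equiv> new_\<kappa> a b c (\<kappa>1 x) (\<mu>1 x) (A1 x) (A2 x)"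
abbreviation "\<mu>1' x \<equiv> new_\<mu> a b c (\<kappa>1 x) (\<mu>1 x) (A1 x) (A2 x)"
abbreviation "\<kappa>2' x \<equiv> new_\<kappa> a b c (\<kappa>2 x) (\<mu>2 x) (A1 x) (A2 x)"
abbreviation "\<mu>2' x \<equiv> new_\<mu> a b c (\<kappa>2 x) (\<mu>2 x) (A1 x) (A2 x)"

end

text \<open>In turn: the transform has a projection and is umbilic-free; \<open>\<sigma>\<close> is not orthogonal to the curvature spheres
  of \<open>f\<close>; the projection of the transform immerses.\<close>

locale generic_darboux_lift = darboux_lift +
  assumes generic: "x \<in> S \<Longrightarrow> weingarten_value a b c (A1 x) (A2 x) \<noteq> 0"
    "x \<in> S \<Longrightarrow> sphere_value (\<kappa>1 x) (\<mu>1 x) (A1 x) (A2 x) \<noteq> 0"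
    "x \<in> S \<Longrightarrow> sphere_value (\<kappa>2 x) (\<mu>2 x) (A1 x) (A2 x) \<noteq> 0"
    "x \<in> S \<Longrightarrow> \<mu>1' x \<noteq> 0"
    "x \<in> S \<Longrightarrow> \<mu>2' x \<noteq> 0"
begin

text \<open>The coefficients of \<open>\<ff>', \<tt>'\<close> solve the linear equations for their products with \<open>\<pp>, \<qq>\<close>, whose
  determinant is \<open>m n\<close>.\<close>

definition "n x = weingarten_value a b c (A1 x) (A2 x)"

definition "\<ff>' x = ((a * A2 x - b * A1 x) / n x) *\<^sub>R \<tau> x + (A1 x / (m * n x)) *\<^sub>R \<sigma> x"
definition "\<tt>' x = ((b * A2 x - c * A1 x) / n x) *\<^sub>R \<tau> x + (A2 x / (m * n x)) *\<^sub>R \<sigma> x"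
definition "f' x = {u + w | u w. u \<in> f x \<inter> perp (span {\<sigma> x}) \<and> w \<in> span {\<sigma> x}}"

lemma \<sigma>_frame: "x \<in> S \<Longrightarrow> lip (\<sigma> x) (\<ff> x) = A1 x" "x \<in> S \<Longrightarrow> lip (\<sigma> x) (\<tt> x) = A2 x"
  "x \<in> S \<Longrightarrow> lip (\<sigma> x) \<pp> = m * (b * A1 x - a * A2 x)" "x \<in> S \<Longrightarrow> lip (\<sigma> x) \<qq> = m * (b * A2 x - c * A1 x)"
  using perp_p[of x] perp_q[of x] by (simp_all add: A1_def A2_def p_of_def q_of_def lip_linear algebra_simps)

lemmas \<sigma>_frame' = \<sigma>_frame[THEN trans[OF lip_commute]]

lemma n: "x \<in> S \<Longrightarrow> n x \<noteq> 0"
  using generic(1) by (simp add: n_def)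

lemma n_eq: "n x = c * A1 x * A1 x - 2 * b * A1 x * A2 x + a * A2 x * A2 x"
  by (simp add: n_def weingarten_value_def)

lemma A_nz: "x \<in> S \<Longrightarrow> (A1 x, A2 x) \<noteq> (0, 0)"
  using n[of x] by (auto simp: n_eq)

lemma \<sigma>_nz: "x \<in> S \<Longrightarrow> \<sigma> x \<noteq> 0"
  using A_nz[of x] by (auto simp: A1_def A2_def lip_linear)

lemma \<tau>_frame:
  assumes "x \<in> S"
  shows "lip (\<tau> x) (\<ff> x) = 0" "lip (\<tau> x) (\<tt> x) = 0" "lip (\<tau> x) \<pp> = A1 x" "lip (\<tau> x) \<qq> = - A2 x"
    "lip (\<tau> x) (\<sigma> x) = 0" "lip (\<sigma> x) (\<tau> x) = 0" "lip (\<tau> x) (\<tau> x) = 0"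
  by (simp_all add: \<tau>_def lip_linear lip_frame[OF assms] \<sigma>_frame[OF assms] \<sigma>_frame'[OF assms])

lemma smooth_A: "smooth_map A S A1" "smooth_map A S A2"
  unfolding A1_def[abs_def] A2_def[abs_def]
  by (intro smooth_map_lip open_S smooth_\<sigma> smooth_f smooth_t)+

lemma smooth_\<tau>: "smooth_map A S \<tau>"
  unfolding \<tau>_def[abs_def]
  by (intro smooth_map_diff smooth_map_scaleR open_S smooth_A smooth_f smooth_t)

lemma smooth_n: "smooth_map A S n"
  unfolding n_eq[abs_def]
  by (intro smooth_map_add smooth_map_diff smooth_map_mult smooth_map_const open_S smooth_A)

lemma smooth_projection: "smooth_map A S \<ff>'" "smooth_map A S \<tt>'"
  unfolding \<ff>'_def[abs_def] \<tt>'_def[abs_def]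
  using m n
  by (intro smooth_map_add smooth_map_diff smooth_map_scaleR smooth_map_divide smooth_map_mult smooth_map_const
      open_S smooth_A smooth_n smooth_\<tau> smooth_\<sigma>; simp)+

lemma hasD_\<sigma>: "x \<in> S \<Longrightarrow> \<phi> \<in> A \<Longrightarrow> x \<in> dom_chart \<phi> \<Longrightarrow> hasD \<phi> \<sigma> x (D \<phi> \<sigma> x)"
  by (rule smooth_map_hasD[OF smooth_\<sigma> open_S])

lemma D_\<sigma>:
  assumes "x \<in> S" "\<phi> \<in> A" "x \<in> dom_chart \<phi>"
  shows "D \<phi> \<sigma> x v = - m *\<^sub>R (A1 x *\<^sub>R \<alpha> \<phi> x v + A2 x *\<^sub>R \<beta> \<phi> x v
    - lip (\<sigma> x) (\<alpha> \<phi> x v) *\<^sub>R \<ff> x - lip (\<sigma> x) (\<beta> \<phi> x v) *\<^sub>R \<tt> x)"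
  unfolding parallel_\<sigma>[OF assms] eta_eq
  by (simp add: \<sigma>_frame'[OF assms(1)] lip_commute[of _ "\<sigma> x"] \<sigma>_frame[OF assms(1)] algebra_simps)

lemma D_\<sigma>_perp:
  assumes x: "x \<in> S" "\<phi> \<in> A" "x \<in> dom_chart \<phi>"
  shows "lip (D \<phi> \<sigma> x v) (\<ff> x) = 0" "lip (D \<phi> \<sigma> x v) (\<tt> x) = 0" "lip (D \<phi> \<sigma> x v) (\<sigma> x) = 0"
    "lip (D \<phi> \<sigma> x v) (\<tau> x) = 0"
proof -
  show 1: "lip (D \<phi> \<sigma> x v) (\<ff> x) = 0" "lip (D \<phi> \<sigma> x v) (\<tt> x) = 0"
    unfolding D_\<sigma>[OF x] by (simp_all add: lip_linear alpha_beta_perp[OF x] lip_frame[OF x(1)])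
  have "lip (\<eta> \<phi> x v (\<sigma> x)) (\<sigma> x) = 0"
    using eta_skew[of \<phi> x v "\<sigma> x" "\<sigma> x"] lip_commute[of "\<sigma> x"] by simp
  then show "lip (D \<phi> \<sigma> x v) (\<sigma> x) = 0" by (simp add: parallel_\<sigma>[OF x] lip_linear)
  show "lip (D \<phi> \<sigma> x v) (\<tau> x) = 0" by (simp add: \<tau>_def lip_linear 1)
qed

lemma hasD_\<tau>:
  assumes x: "x \<in> S" "\<phi> \<in> A" "x \<in> dom_chart \<phi>"
  shows "hasD \<phi> \<tau> x (\<lambda>v. A2 x *\<^sub>R D \<phi> \<ff> x v - A1 x *\<^sub>R D \<phi> \<tt> x v
    + lip (\<sigma> x) (D \<phi> \<tt> x v) *\<^sub>R \<ff> x - lip (\<sigma> x) (D \<phi> \<ff> x v) *\<^sub>R \<tt> x)"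
proof -
  note h = hasD_f[OF x] hasD_t[OF x] hasD_\<sigma>[OF x]
  have "hasD \<phi> \<tau> x (\<lambda>v. (A2 x *\<^sub>R D \<phi> \<ff> x v + (lip (\<sigma> x) (D \<phi> \<tt> x v) + lip (D \<phi> \<sigma> x v) (\<tt> x)) *\<^sub>R \<ff> x) -
     (A1 x *\<^sub>R D \<phi> \<tt> x v + (lip (\<sigma> x) (D \<phi> \<ff> x v) + lip (D \<phi> \<sigma> x v) (\<ff> x)) *\<^sub>R \<tt> x))"
    unfolding \<tau>_def[abs_def] A1_def[abs_def] A2_def[abs_def]
    by (intro hasD_diff hasD_scaleR hasD_lip h)
  then show ?thesis by (simp add: D_\<sigma>_perp[OF x] algebra_simps)
qed

lemma D_\<tau>:
  assumes "x \<in> S" "\<phi> \<in> A" "x \<in> dom_chart \<phi>"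
  shows "D \<phi> \<tau> x v = A2 x *\<^sub>R D \<phi> \<ff> x v - A1 x *\<^sub>R D \<phi> \<tt> x v
    + lip (\<sigma> x) (D \<phi> \<tt> x v) *\<^sub>R \<ff> x - lip (\<sigma> x) (D \<phi> \<ff> x v) *\<^sub>R \<tt> x"
  by (rule hasD_D[OF hasD_\<tau>[OF assms]])

lemma D_\<tau>_perp:
  assumes x: "x \<in> S" "\<phi> \<in> A" "x \<in> dom_chart \<phi>"
  shows "lip (D \<phi> \<tau> x v) (\<sigma> x) = 0" "lip (D \<phi> \<tau> x v) (\<tau> x) = 0"
proof -
  have s: "lip (D \<phi> \<ff> x v) (\<sigma> x) = lip (\<sigma> x) (D \<phi> \<ff> x v)" "lip (D \<phi> \<tt> x v) (\<sigma> x) = lip (\<sigma> x) (D \<phi> \<tt> x v)"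
    by (simp_all add: lip_commute)
  show "lip (D \<phi> \<tau> x v) (\<sigma> x) = 0"
    unfolding D_\<tau>[OF x] by (simp add: lip_linear s \<sigma>_frame'[OF x(1)])
  show "lip (D \<phi> \<tau> x v) (\<tau> x) = 0"
    unfolding D_\<tau>[OF x] by (simp add: \<tau>_def lip_linear D_frame_perp[OF x] lip_frame[OF x(1)])
qed

lemma new_frame_combination:
  assumes "x \<in> S"
  shows "p *\<^sub>R \<ff>' x + q *\<^sub>R \<tt>' x =
    ((p * (a * A2 x - b * A1 x) + q * (b * A2 x - c * A1 x)) / n x) *\<^sub>R \<tau> x + ((p * A1 x + q * A2 x) / (m * n x)) *\<^sub>R \<sigma> x"
proof -
  have "p *\<^sub>R (r1 *\<^sub>R t + s1 *\<^sub>R z) + q *\<^sub>R (r2 *\<^sub>R t + s2 *\<^sub>R z) = (p * r1 + q * r2) *\<^sub>R t + (p * s1 + q * s2) *\<^sub>R z"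
    for r1 r2 s1 s2 and t z :: R42
    by (simp add: algebra_simps)
  then show ?thesis by (simp add: \<ff>'_def \<tt>'_def add_divide_distrib)
qed

lemma \<tau>_new_frame: "x \<in> S \<Longrightarrow> \<tau> x = A2 x *\<^sub>R \<ff>' x + (- A1 x) *\<^sub>R \<tt>' x"
  and \<sigma>_new_frame: "x \<in> S \<Longrightarrow> \<sigma> x = (- (m * (b * A2 x - c * A1 x))) *\<^sub>R \<ff>' x + (- (m * (b * A1 x - a * A2 x))) *\<^sub>R \<tt>' x"
proof -
  assume x: "x \<in> S"
  have 1: "A2 x * (a * A2 x - b * A1 x) + - A1 x * (b * A2 x - c * A1 x) = n x" "A2 x * A1 x + - A1 x * A2 x = 0"
    by (simp_all add: n_eq algebra_simps)
  show "\<tau> x = A2 x *\<^sub>R \<ff>' x + (- A1 x) *\<^sub>R \<tt>' x"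
    unfolding new_frame_combination[OF x] 1 using n[OF x] by simp
  have 2: "- (m * (b * A2 x - c * A1 x)) * (a * A2 x - b * A1 x) + - (m * (b * A1 x - a * A2 x)) * (b * A2 x - c * A1 x) = 0"
    "- (m * (b * A2 x - c * A1 x)) * A1 x + - (m * (b * A1 x - a * A2 x)) * A2 x = m * n x"
    by (simp_all add: n_eq algebra_simps)
  show "\<sigma> x = (- (m * (b * A2 x - c * A1 x))) *\<^sub>R \<ff>' x + (- (m * (b * A1 x - a * A2 x))) *\<^sub>R \<tt>' x"
    unfolding new_frame_combination[OF x] 2 using n[OF x] m by simp
qed

lemma span_new_frame:
  assumes x: "x \<in> S"
  shows "span {\<ff>' x, \<tt>' x} = span {\<tau> x, \<sigma> x}"
proof
  have "\<ff>' x \<in> span {\<tau> x, \<sigma> x}" "\<tt>' x \<in> span {\<tau> x, \<sigma> x}"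
    unfolding \<ff>'_def \<tt>'_def by (intro span_add span_scale span_base; simp)+
  then show "span {\<ff>' x, \<tt>' x} \<subseteq> span {\<tau> x, \<sigma> x}" by (intro span_minimal) auto
  have "A2 x *\<^sub>R \<ff>' x + (- A1 x) *\<^sub>R \<tt>' x \<in> span {\<ff>' x, \<tt>' x}"
    "(- (m * (b * A2 x - c * A1 x))) *\<^sub>R \<ff>' x + (- (m * (b * A1 x - a * A2 x))) *\<^sub>R \<tt>' x \<in> span {\<ff>' x, \<tt>' x}"
    by (intro span_add span_scale span_base; simp)+
  then have "\<tau> x \<in> span {\<ff>' x, \<tt>' x}" "\<sigma> x \<in> span {\<ff>' x, \<tt>' x}"
    using \<tau>_new_frame[OF x] \<sigma>_new_frame[OF x] by simp_all
  then show "span {\<tau> x, \<sigma> x} \<subseteq> span {\<ff>' x, \<tt>' x}" by (intro span_minimal) auto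
qed

lemma new_fibre:
  assumes x: "x \<in> S"
  shows "f' x = span {\<ff>' x, \<tt>' x}"
  unfolding span_new_frame[OF x]
proof
  show "f' x \<subseteq> span {\<tau> x, \<sigma> x}"
  proof
    fix z assume "z \<in> f' x"
    then obtain u w where z: "z = u + w" "u \<in> f x" "w \<in> span {\<sigma> x}" and up: "u \<in> perp (span {\<sigma> x})"
      unfolding f'_def mem_Collect_eq Int_iff by (elim exE conjE) (rule that)
    have pu: "lip u (\<sigma> x) = 0" using up unfolding perp_span by (simp add: perp_def)
    obtain k l where u: "u = k *\<^sub>R \<ff> x + l *\<^sub>R \<tt> x" using z(2) by (auto simp: fibre[OF x] span_pair)
    have e: "k * A1 x + l * A2 x = 0" using pu by (simp add: u lip_linear \<sigma>_frame'[OF x])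
    have "\<exists>t. k = t * A2 x \<and> l = - t * A1 x"
    proof (cases "A1 x = 0")
      case True
      then show ?thesis using e A_nz[OF x] by (intro exI[of _ "k / A2 x"]) auto
    next
      case False
      then show ?thesis using e by (intro exI[of _ "- l / A1 x"]) (simp add: field_simps)
    qed
    then obtain t where t: "k = t * A2 x" "l = - t * A1 x" by blast
    have "u = t *\<^sub>R \<tau> x" by (simp add: u t \<tau>_def algebra_simps)
    moreover obtain r where "w = r *\<^sub>R \<sigma> x" using z(3) by (auto simp: span_singleton)
    ultimately show "z \<in> span {\<tau> x, \<sigma> x}" unfolding span_pair z(1) by blast
  qed
  show "span {\<tau> x, \<sigma> x} \<subseteq> f' x"
  proof
    fix z assume "z \<in> span {\<tau> x, \<sigma> x}"
    then obtain k l where z: "z = k *\<^sub>R \<tau> x + l *\<^sub>R \<sigma> x" unfolding span_pair by blast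
    have k\<tau>: "k *\<^sub>R \<tau> x = (k * A2 x) *\<^sub>R \<ff> x + (- k * A1 x) *\<^sub>R \<tt> x" by (simp add: \<tau>_def algebra_simps)
    have "k *\<^sub>R \<tau> x \<in> f x" unfolding k\<tau> by (rule f_mem[OF x])
    moreover have "k *\<^sub>R \<tau> x \<in> perp (span {\<sigma> x})"
      unfolding perp_span by (simp add: perp_def lip_linear \<tau>_frame[OF x])
    moreover have "l *\<^sub>R \<sigma> x \<in> span {\<sigma> x}" by (intro span_scale span_base) simp
    ultimately show "z \<in> f' x" unfolding f'_def z by blast
  qed
qed

lemma new_lips:
  assumes x: "x \<in> S" and z: "z \<in> {\<ff>' x, \<tt>' x}"
  shows "lip (\<tau> x) z = 0" "lip (\<sigma> x) z = 0" "lip z (\<tau> x) = 0" "lip z (\<sigma> x) = 0"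
proof -
  show "lip (\<tau> x) z = 0" "lip (\<sigma> x) z = 0"
    using z by (auto simp: \<ff>'_def \<tt>'_def lip_linear \<tau>_frame[OF x] null_\<sigma>[OF x])
  then show "lip z (\<tau> x) = 0" "lip z (\<sigma> x) = 0" by (simp_all add: lip_commute[of z])
qed

sublocale new: contact_lift A S f' \<pp> \<qq> \<ff>' \<tt>'
proof unfold_locales
  fix x assume x: "x \<in> S"
  show "lip (\<ff>' x) (\<ff>' x) = 0" "lip (\<ff>' x) (\<tt>' x) = 0"
    by (simp_all add: \<ff>'_def[of x] lip_linear new_lips[OF x])
      (simp_all add: \<ff>'_def[of x] \<tt>'_def[of x] lip_linear new_lips[OF x] \<tau>_frame[OF x] null_\<sigma>[OF x])
  show "lip (\<tt>' x) (\<tt>' x) = 0"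
    by (simp add: \<tt>'_def[of x] lip_linear \<tau>_frame[OF x] null_\<sigma>[OF x])
  note nz = n[OF x] m
  have "lip (\<ff>' x) \<qq> = - (n x) / n x"
    using nz by (simp add: \<ff>'_def lip_linear \<tau>_frame[OF x] \<sigma>_frame[OF x] n_eq divide_simps) (simp add: algebra_simps)
  then show "lip (\<ff>' x) \<qq> = - 1" using nz by simp
  show "lip (\<ff>' x) \<pp> = 0"
    using nz by (simp add: \<ff>'_def lip_linear \<tau>_frame[OF x] \<sigma>_frame[OF x] divide_simps) (simp add: algebra_simps)
  show "lip (\<tt>' x) \<qq> = 0"
    using nz by (simp add: \<tt>'_def lip_linear \<tau>_frame[OF x] \<sigma>_frame[OF x] divide_simps)
  have "lip (\<tt>' x) \<pp> = - (n x) / n x"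
    using nz by (simp add: \<tt>'_def lip_linear \<tau>_frame[OF x] \<sigma>_frame[OF x] n_eq divide_simps) (simp add: algebra_simps)
  then show "lip (\<tt>' x) \<pp> = - 1" using nz by simp
  show "f' x = span {\<ff>' x, \<tt>' x}" by (rule new_fibre[OF x])
  fix \<phi> v assume \<phi>: "\<phi> \<in> A" "x \<in> dom_chart \<phi>"
  have "hasD \<phi> (\<lambda>y. (b * A2 y - c * A1 y) / n y) x (D \<phi> (\<lambda>y. (b * A2 y - c * A1 y) / n y) x)"
    by (rule smooth_map_hasD[OF _ open_S x \<phi>])
      (intro smooth_map_divide smooth_map_diff smooth_map_mult smooth_map_const open_S smooth_A smooth_n n)
  moreover have "hasD \<phi> (\<lambda>y. A2 y / (m * n y)) x (D \<phi> (\<lambda>y. A2 y / (m * n y)) x)"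
    by (rule smooth_map_hasD[OF _ open_S x \<phi>], intro smooth_map_divide smooth_map_mult smooth_map_const open_S smooth_A smooth_n)
      (use n m in simp)
  ultimately have "hasD \<phi> \<tt>' x (\<lambda>v. ((b * A2 x - c * A1 x) / n x) *\<^sub>R D \<phi> \<tau> x v + D \<phi> (\<lambda>y. (b * A2 y - c * A1 y) / n y) x v *\<^sub>R \<tau> x +
      ((A2 x / (m * n x)) *\<^sub>R D \<phi> \<sigma> x v + D \<phi> (\<lambda>y. A2 y / (m * n y)) x v *\<^sub>R \<sigma> x))"
    unfolding \<tt>'_def[abs_def]
    by (intro hasD_add hasD_scaleR smooth_map_hasD[OF smooth_\<tau> open_S x \<phi>] hasD_\<sigma>[OF x \<phi>])
  from hasD_D[OF this, of v]
  show "lip (\<ff>' x) (D \<phi> \<tt>' x v) = 0"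
    unfolding \<ff>'_def
    by (simp add: lip_linear \<tau>_frame[OF x] null_\<sigma>[OF x] D_\<tau>_perp[OF x \<phi>, THEN trans[OF lip_commute]]
        D_\<sigma>_perp[OF x \<phi>, THEN trans[OF lip_commute]])
qed (use open_S smooth_projection in auto)

text \<open>With coefficients held constant, \<open>d\<^sub>X\<close> of \<open>\<Lambda>\<^sub>i \<tau> + (S\<^sub>i / m) \<sigma>\<close> lies in \<open>\<langle>\<tau>\<rangle>\<close> for \<open>X\<close> in the curvature direction
  \<open>T\<^sub>i\<close> of \<open>f\<close>: the transform has the same curvature directions.\<close>

lemma new_sphere:
  assumes x: "x \<in> S" "\<phi> \<in> A" "x \<in> dom_chart \<phi>"
    and F: "D \<phi> \<ff> x v = \<mu> *\<^sub>R \<xi>" and G: "D \<phi> \<tt> x v = - \<kappa> *\<^sub>R \<xi>"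
  shows "new.shape \<phi> x (new_\<kappa> a b c \<kappa> \<mu> (A1 x) (A2 x) *\<^sub>R \<ff>' x + new_\<mu> a b c \<kappa> \<mu> (A1 x) (A2 x) *\<^sub>R \<tt>' x) v = 0"
proof -
  define \<Lambda> where "\<Lambda> = conjugate_value a b c \<kappa> \<mu> (A1 x) (A2 x)"
  define T where "T = sphere_value \<kappa> \<mu> (A1 x) (A2 x)"
  let ?u = "new_\<kappa> a b c \<kappa> \<mu> (A1 x) (A2 x) *\<^sub>R \<ff>' x + new_\<mu> a b c \<kappa> \<mu> (A1 x) (A2 x) *\<^sub>R \<tt>' x"
  have u: "?u = \<Lambda> *\<^sub>R \<tau> x + (T / m) *\<^sub>R \<sigma> x"
  proof -
    have "\<Lambda> *\<^sub>R \<tau> x + (T / m) *\<^sub>R \<sigma> x = (\<Lambda> * A2 x - T * (b * A2 x - c * A1 x)) *\<^sub>R \<ff>' x +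
        (- \<Lambda> * A1 x - T * (b * A1 x - a * A2 x)) *\<^sub>R \<tt>' x"
      by (subst \<tau>_new_frame[OF x(1)], subst \<sigma>_new_frame[OF x(1)]) (use m in \<open>simp add: algebra_simps\<close>)
    then show ?thesis by (simp add: new_\<kappa>_def new_\<mu>_def \<Lambda>_def T_def)
  qed
  define \<rho> where "\<rho> y = \<Lambda> *\<^sub>R \<tau> y + (T / m) *\<^sub>R \<sigma> y" for y
  have ls: "local_section A S f' x \<rho>"
    unfolding local_section_def section_of_def \<rho>_def
  proof (intro exI[of _ S] conjI ballI open_S x(1) subset_refl smooth_map_add smooth_map_scaleR smooth_map_const
      smooth_\<tau> smooth_\<sigma>)
    show "\<Lambda> *\<^sub>R \<tau> y + (T / m) *\<^sub>R \<sigma> y \<in> f' y" if "y \<in> S" for y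
      by (simp add: new_fibre[OF that] span_new_frame[OF that] span_add span_scale span_base)
  qed
  have \<alpha>: "\<alpha> \<phi> x v = (c * \<mu> + b * \<kappa>) *\<^sub>R \<xi>" and \<beta>: "\<beta> \<phi> x v = (- (a * \<kappa> + b * \<mu>)) *\<^sub>R \<xi>"
    by (simp_all add: \<alpha>_def \<beta>_def F G algebra_simps)
  have D\<sigma>: "D \<phi> \<sigma> x v = - m *\<^sub>R (\<Lambda> *\<^sub>R \<xi> - lip (\<sigma> x) \<xi> *\<^sub>R ((c * \<mu> + b * \<kappa>) *\<^sub>R \<ff> x - (a * \<kappa> + b * \<mu>) *\<^sub>R \<tt> x))"
    unfolding D_\<sigma>[OF x] \<alpha> \<beta> by (simp add: \<Lambda>_def conjugate_value_def lip_linear algebra_simps)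
  have D\<tau>: "D \<phi> \<tau> x v = T *\<^sub>R \<xi> - lip (\<sigma> x) \<xi> *\<^sub>R (csphere x \<kappa> \<mu>)"
    unfolding D_\<tau>[OF x] F G by (simp add: T_def sphere_value_def lip_linear algebra_simps)
  have "D \<phi> \<rho> x v = \<Lambda> *\<^sub>R D \<phi> \<tau> x v + (T / m) *\<^sub>R D \<phi> \<sigma> x v"
    unfolding \<rho>_def
    by (rule hasD_D[OF hasD_add[OF hasD_scaleR_right hasD_scaleR_right]])
      (intro smooth_map_hasD[OF smooth_\<tau> open_S x] hasD_\<sigma>[OF x])+
  also have "\<dots> = (lip (\<sigma> x) \<xi> * (T * (c * \<mu> + b * \<kappa>) - \<Lambda> * \<kappa>)) *\<^sub>R \<ff> x -
      (lip (\<sigma> x) \<xi> * (T * (a * \<kappa> + b * \<mu>) + \<Lambda> * \<mu>)) *\<^sub>R \<tt> x"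
    unfolding D\<sigma> D\<tau> using m by (simp add: algebra_simps)
  also have "\<dots> = (lip (\<sigma> x) \<xi> * (c * \<mu> * \<mu> + 2 * b * \<kappa> * \<mu> + a * \<kappa> * \<kappa>)) *\<^sub>R \<tau> x"
  proof -
    have 1: "T * (c * \<mu> + b * \<kappa>) - \<Lambda> * \<kappa> = (c * \<mu> * \<mu> + 2 * b * \<kappa> * \<mu> + a * \<kappa> * \<kappa>) * A2 x"
      and 2: "T * (a * \<kappa> + b * \<mu>) + \<Lambda> * \<mu> = (c * \<mu> * \<mu> + 2 * b * \<kappa> * \<mu> + a * \<kappa> * \<kappa>) * A1 x"
      unfolding T_def \<Lambda>_def sphere_value_def conjugate_value_def by algebra+
    show ?thesis unfolding 1 2 \<tau>_def by (simp add: scaleR_diff_right mult.assoc)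
  qed
  finally have "D \<phi> \<rho> x v \<in> f' x"
    unfolding new_fibre[OF x(1)] span_new_frame[OF x(1)] by (simp add: span_scale span_base)
  then show ?thesis
    using new.D_local_section_mem_iff[OF ls x(2,3), of v] u by (simp add: \<rho>_def)
qed

lemma sections_at:
  assumes "x \<in> S"
  shows "\<kappa>1 x * \<mu>2 x \<noteq> \<mu>1 x * \<kappa>2 x"
    and "\<phi> \<in> A \<Longrightarrow> x \<in> dom_chart \<phi> \<Longrightarrow> \<exists>v. v \<noteq> 0 \<and> shape \<phi> x (csphere x (\<kappa>1 x) (\<mu>1 x)) v = 0"
    and "\<phi> \<in> A \<Longrightarrow> x \<in> dom_chart \<phi> \<Longrightarrow> \<exists>v. v \<noteq> 0 \<and> shape \<phi> x (csphere x (\<kappa>2 x) (\<mu>2 x)) v = 0"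
  using sections assms unfolding principal_sections_def by blast+

text \<open>If \<open>d\<^sub>X \<ff>' = d\<^sub>X \<tt>' = 0\<close> then \<open>d\<^sub>X \<sigma>\<close> is null; but modulo \<open>f\<close> it is \<open>- m (r \<Lambda>\<^sub>1 \<xi>\<^sub>1 + s \<Lambda>\<^sub>2 \<xi>\<^sub>2)\<close>, where
  \<open>X\<close> has components \<open>r, s\<close> in the curvature directions, and the \<open>\<Lambda>\<^sub>i\<close> do not vanish.\<close>

sublocale new: legendre_lift A S f' \<pp> \<qq> \<ff>' \<tt>'
proof unfold_locales
  fix x \<phi> v assume x: "x \<in> S" "\<phi> \<in> A" "x \<in> dom_chart \<phi>" and z: "D \<phi> \<ff>' x v = 0" "D \<phi> \<tt>' x v = 0"
  obtain v1 v2 where vv: "v1 \<noteq> 0" "shape \<phi> x (csphere x (\<kappa>1 x) (\<mu>1 x)) v1 = 0"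
    "v2 \<noteq> 0" "shape \<phi> x (csphere x (\<kappa>2 x) (\<mu>2 x)) v2 = 0" using sections_at(2,3)[OF x] by blast
  obtain \<xi>1 \<xi>2 where fr: "D \<phi> \<ff> x v1 = \<mu>1 x *\<^sub>R \<xi>1" "D \<phi> \<tt> x v1 = - \<kappa>1 x *\<^sub>R \<xi>1"
    "D \<phi> \<ff> x v2 = \<mu>2 x *\<^sub>R \<xi>2" "D \<phi> \<tt> x v2 = - \<kappa>2 x *\<^sub>R \<xi>2"
    "lip \<xi>1 \<xi>2 = 0" "lip \<xi>1 \<xi>1 > 0" "lip \<xi>2 \<xi>2 > 0"
    "\<And>z. z \<in> {\<ff> x, \<tt> x, \<pp>, \<qq>} \<Longrightarrow> lip \<xi>1 z = 0 \<and> lip \<xi>2 z = 0" "\<And>v. \<exists>r s. v = r *\<^sub>R v1 + s *\<^sub>R v2"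
    using principal_frame[OF x refl refl sections_at(1)[OF x(1)] vv] by metis
  obtain r s where v: "v = r *\<^sub>R v1 + s *\<^sub>R v2" using fr(9) by blast
  define \<Lambda>1 where "\<Lambda>1 = conjugate_value a b c (\<kappa>1 x) (\<mu>1 x) (A1 x) (A2 x)"
  define \<Lambda>2 where "\<Lambda>2 = conjugate_value a b c (\<kappa>2 x) (\<mu>2 x) (A1 x) (A2 x)"
  have \<Lambda>: "\<Lambda>1 \<noteq> 0" "\<Lambda>2 \<noteq> 0"
    using conjugate_value_product[of a b c "\<kappa>1 x" "\<mu>1 x" "A1 x" "A2 x" "\<kappa>2 x" "\<mu>2 x"]
      generic(2,3)[OF x(1)] non_tub W[OF x(1)] by (auto simp: \<Lambda>1_def \<Lambda>2_def)
  have "local_section A S f' x \<sigma>"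
    unfolding local_section_def section_of_def
  proof (intro exI[of _ S] conjI ballI open_S x(1) subset_refl smooth_\<sigma>)
    show "\<sigma> y \<in> f' y" if "y \<in> S" for y
      unfolding new_fibre[OF that] span_new_frame[OF that] by (simp add: span_base)
  qed
  then have "D \<phi> \<sigma> x v \<in> f' x"
    using new.D_local_section_mem_iff[OF _ x(2,3)] z by (simp add: new.shape_def)
  then have null: "lip (D \<phi> \<sigma> x v) (D \<phi> \<sigma> x v) = 0" using new.f_isotropic[OF x(1)] by blast
  define \<zeta> where "\<zeta> = (r * \<Lambda>1) *\<^sub>R \<xi>1 + (s * \<Lambda>2) *\<^sub>R \<xi>2"
  have \<zeta>: "A1 x *\<^sub>R \<alpha> \<phi> x v + A2 x *\<^sub>R \<beta> \<phi> x v = \<zeta>"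
    using D_frame_linear[OF x]
    by (simp add: \<alpha>_def \<beta>_def v linear_add linear_cmul fr(1-4) \<zeta>_def \<Lambda>1_def \<Lambda>2_def conjugate_value_def algebra_simps)
  have D: "D \<phi> \<sigma> x v = - m *\<^sub>R (\<zeta> - lip (\<sigma> x) (\<alpha> \<phi> x v) *\<^sub>R \<ff> x - lip (\<sigma> x) (\<beta> \<phi> x v) *\<^sub>R \<tt> x)"
    unfolding D_\<sigma>[OF x] \<zeta> ..
  have \<zeta>p: "lip \<zeta> (\<ff> x) = 0" "lip \<zeta> (\<tt> x) = 0" "lip (\<ff> x) \<zeta> = 0" "lip (\<tt> x) \<zeta> = 0"
    using fr(8) by (simp_all add: \<zeta>_def lip_linear lip_commute[of "\<ff> x"] lip_commute[of "\<tt> x"])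
  have "lip \<zeta> \<zeta> = 0"
    using null m unfolding D by (simp add: lip_linear \<zeta>p lip_frame[OF x(1)])
  then have "(r * \<Lambda>1)\<^sup>2 * lip \<xi>1 \<xi>1 + (s * \<Lambda>2)\<^sup>2 * lip \<xi>2 \<xi>2 = 0"
    by (simp add: \<zeta>_def lip_linear fr(5) lip_commute[of \<xi>2 \<xi>1] power2_eq_square algebra_simps)
  then have "(r * \<Lambda>1)\<^sup>2 * lip \<xi>1 \<xi>1 = 0" "(s * \<Lambda>2)\<^sup>2 * lip \<xi>2 \<xi>2 = 0"
    using fr(6,7) by (simp_all add: add_nonneg_eq_0_iff)
  then show "v = 0" using v \<Lambda> fr(6,7) by auto
qed

lemma new_principal_sections:
  "new.principal_sections S \<kappa>1' \<mu>1'
    \<kappa>2' \<mu>2'"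
proof -
  have sm: "smooth_map A S (\<lambda>x. new_\<kappa> a b c (\<kappa> x) (\<mu> x) (A1 x) (A2 x))" "smooth_map A S (\<lambda>x. new_\<mu> a b c (\<kappa> x) (\<mu> x) (A1 x) (A2 x))"
    if "smooth_map A S \<kappa>" "smooth_map A S \<mu>" for \<kappa> \<mu>
    unfolding value_defs
    by (intro smooth_map_add smooth_map_diff smooth_map_mult smooth_map_minus smooth_map_const open_S smooth_A that)+
  have det: "\<kappa>1' x * \<mu>2' x \<noteq>
      \<mu>1' x * \<kappa>2' x" if "x \<in> S" for x
    using new_determinant[of a b c "\<kappa>1 x" "\<mu>1 x" "A1 x" "A2 x" "\<kappa>2 x" "\<mu>2 x"] generic(1)[OF that] sections_at(1)[OF that]
    by auto
  have sh: "\<exists>v. v \<noteq> 0 \<and> new.shape \<phi> x (new_\<kappa> a b c \<kappa> \<mu> (A1 x) (A2 x) *\<^sub>R \<ff>' x + new_\<mu> a b c \<kappa> \<mu> (A1 x) (A2 x) *\<^sub>R \<tt>' x) v = 0"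
    if x: "x \<in> S" "\<phi> \<in> A" "x \<in> dom_chart \<phi>" and \<kappa>: "(\<kappa>, \<mu>) \<in> {(\<kappa>1 x, \<mu>1 x), (\<kappa>2 x, \<mu>2 x)}" for x \<phi> \<kappa> \<mu>
  proof -
    obtain v1 v2 where vv: "v1 \<noteq> 0" "shape \<phi> x (csphere x (\<kappa>1 x) (\<mu>1 x)) v1 = 0"
      "v2 \<noteq> 0" "shape \<phi> x (csphere x (\<kappa>2 x) (\<mu>2 x)) v2 = 0" using sections_at(2,3)[OF x] by blast
    obtain \<xi>1 \<xi>2 where "D \<phi> \<ff> x v1 = \<mu>1 x *\<^sub>R \<xi>1" "D \<phi> \<tt> x v1 = - \<kappa>1 x *\<^sub>R \<xi>1"
      "D \<phi> \<ff> x v2 = \<mu>2 x *\<^sub>R \<xi>2" "D \<phi> \<tt> x v2 = - \<kappa>2 x *\<^sub>R \<xi>2"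
      by (rule principal_frame[OF x refl refl sections_at(1)[OF x(1)] vv])
    then show ?thesis using new_sphere[OF x] vv(1,3) \<kappa> by blast
  qed
  have smk: "smooth_map A S \<kappa>1" "smooth_map A S \<mu>1" "smooth_map A S \<kappa>2" "smooth_map A S \<mu>2"
    using sections unfolding principal_sections_def by blast+
  show ?thesis
    unfolding new.principal_sections_def
    by (intro conjI ballI impI open_S subset_refl sm smk det sh) simp_all
qed

lemma transform_lw: "umbilic_free_lw_surface A S f' \<pp> \<qq> \<ff>' \<tt>' a b c"
proof -
  have "(a, b, c) \<noteq> (0, 0, 0)" using non_tub by auto
  moreover have "W_form a b c (\<kappa>1' x) (\<mu>1' x) (\<kappa>2' x) (\<mu>2' x) = 0" if "x \<in> S" for x
    unfolding new_weingarten W[OF that] by simp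
  ultimately have "linear_weingarten A S f' \<ff>' \<tt>' a b c"
    by (intro new.linear_weingartenI[OF new_principal_sections] conjI generic(4,5))
  then show ?thesis
    unfolding umbilic_free_lw_surface_def
    using new.legendre_map_lift new.projects_to_lift new.umbilic_freeI[OF new_principal_sections] by blast
qed

text \<open>A section \<open>\<rho>\<close> of \<open>\<langle>\<sigma>\<rangle>\<close> satisfies \<open>(\<sigma>, k) \<rho> = (\<rho>, k) \<sigma>\<close> for every constant \<open>k\<close>; differentiating this avoids
  the quotient of \<open>\<rho>\<close> by \<open>\<sigma>\<close>.\<close>

lemma parallel_span: "parallel_subbundle A S \<eta> m (\<lambda>x. span {\<sigma> x})"
  unfolding parallel_subbundle_def
proof (intro ballI impI allI)
  fix x \<phi> \<rho> v assume x: "x \<in> S" "\<phi> \<in> A" "x \<in> dom_chart \<phi>" and ls: "local_section A S (\<lambda>x. span {\<sigma> x}) x \<rho>"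
  obtain N where N: "open N" "x \<in> N" "smooth_map A N \<rho>" "\<And>y. y \<in> N \<Longrightarrow> \<rho> y \<in> span {\<sigma> y}"
    using ls unfolding local_section_def section_of_def by blast
  obtain k where k: "lip (\<sigma> x) k \<noteq> 0" using lip_nondegenerate[of "\<sigma> x"] \<sigma>_nz[OF x(1)] by blast
  obtain h where h: "\<rho> x = h *\<^sub>R \<sigma> x" using N(2,4) by (auto simp: span_singleton)
  note hs = smooth_map_hasD[OF N(3,1,2) x(2,3)] hasD_\<sigma>[OF x]
  have "hasD \<phi> (\<lambda>y. lip (\<sigma> y) k *\<^sub>R \<rho> y - lip (\<rho> y) k *\<^sub>R \<sigma> y) x
    (\<lambda>v. lip (\<sigma> x) k *\<^sub>R D \<phi> \<rho> x v + lip (D \<phi> \<sigma> x v) k *\<^sub>R \<rho> x - (lip (\<rho> x) k *\<^sub>R D \<phi> \<sigma> x v + lip (D \<phi> \<rho> x v) k *\<^sub>R \<sigma> x))"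
    by (intro hasD_diff hasD_scaleR hasD_lip_left hs)
  moreover have "lip (\<sigma> y) k *\<^sub>R \<rho> y - lip (\<rho> y) k *\<^sub>R \<sigma> y = 0" if "y \<in> N" for y
    using N(4)[OF that] by (auto simp: span_singleton lip_linear)
  ultimately have "lip (\<sigma> x) k *\<^sub>R D \<phi> \<rho> x v + lip (D \<phi> \<sigma> x v) k *\<^sub>R \<rho> x -
      (lip (\<rho> x) k *\<^sub>R D \<phi> \<sigma> x v + lip (D \<phi> \<rho> x v) k *\<^sub>R \<sigma> x) = 0"
    by (rule hasD_zero_on[OF _ N(1,2) x(2,3)])
  then have "lip (\<sigma> x) k *\<^sub>R D \<phi> \<rho> x v =
      lip (\<sigma> x) k *\<^sub>R (h *\<^sub>R D \<phi> \<sigma> x v) + (lip (D \<phi> \<rho> x v) k - h * lip (D \<phi> \<sigma> x v) k) *\<^sub>R \<sigma> x"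
    by (simp add: h lip_linear algebra_simps)
  then have "lip (\<sigma> x) k *\<^sub>R (D \<phi> \<rho> x v + m *\<^sub>R \<eta> \<phi> x v (\<rho> x)) = (lip (D \<phi> \<rho> x v) k - h * lip (D \<phi> \<sigma> x v) k) *\<^sub>R \<sigma> x"
    by (simp add: parallel_\<sigma>[OF x] h linear_cmul[OF eta_linear(2)[OF x]] algebra_simps)
  then have "(1 / lip (\<sigma> x) k) *\<^sub>R (lip (\<sigma> x) k *\<^sub>R (D \<phi> \<rho> x v + m *\<^sub>R \<eta> \<phi> x v (\<rho> x))) \<in> span {\<sigma> x}"
    by (simp add: span_scale span_base)
  then show "D \<phi> \<rho> x v + m *\<^sub>R \<eta> \<phi> x v (\<rho> x) \<in> span {\<sigma> x}" using k by simp
qed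

lemma transform_darboux: "darboux_transform A S f \<eta> m (\<lambda>x. span {\<sigma> x}) f'"
  unfolding darboux_transform_def
proof (intro conjI m parallel_span ballI allI impI)
  show "subbundle A S 1 (\<lambda>x. span {\<sigma> x})"
    unfolding subbundle_def
  proof (intro ballI conjI subspace_span)
    fix x assume x: "x \<in> S"
    show "dim (span {\<sigma> x}) = 1" using \<sigma>_nz[OF x] by (simp add: dim_span dim_eq_card_independent)
    have "section_of A S (\<lambda>x. span {\<sigma> x}) \<sigma>"
      unfolding section_of_def using smooth_\<sigma> by (auto intro: span_base)
    then show "\<exists>N \<rho>. open N \<and> x \<in> N \<and> N \<subseteq> S \<and> (\<forall>i<1. section_of A N (\<lambda>x. span {\<sigma> x}) (\<rho> i)) \<and>
        (\<forall>y\<in>N. span {\<sigma> y} = span ((\<lambda>i. \<rho> i y) ` {..<1::nat}))"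
      using open_S x by (intro exI[of _ S] exI[of _ "\<lambda>i. \<sigma>"]) (auto simp: lessThan_Suc)
  qed
  fix x assume x: "x \<in> S"
  show "isotropic (span {\<sigma> x})"
    by (auto simp: isotropic_def span_singleton lip_linear null_\<sigma>[OF x])
  show "f' x = {u + w |u w. u \<in> f x \<inter> perp (span {\<sigma> x}) \<and> w \<in> span {\<sigma> x}}" by (simp add: f'_def)
  fix L assume "curvature_sphere A S f x L"
  then have L: "L \<in> {span {csphere x (\<kappa>1 x) (\<mu>1 x)}, span {csphere x (\<kappa>2 x) (\<mu>2 x)}}"
    using principal_sections_spheres(1)[OF sections x] by blast
  have "lip (\<sigma> x) (csphere x (\<kappa>1 x) (\<mu>1 x)) \<noteq> 0" "lip (\<sigma> x) (csphere x (\<kappa>2 x) (\<mu>2 x)) \<noteq> 0"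
    using generic(2,3)[OF x] by (simp_all add: lip_linear \<sigma>_frame[OF x] sphere_value_def)
  then have "\<sigma> x \<notin> perp L" using L by (auto simp: perp_span) (auto simp: perp_def)
  then show "\<not> span {\<sigma> x} \<subseteq> perp L" using span_base[of "\<sigma> x" "{\<sigma> x}"] by blast
qed

end

section \<open>Parallel sections and trivialisations\<close>

lemma hasD_sum:
  assumes "finite I" "\<And>i. i \<in> I \<Longrightarrow> hasD \<phi> (\<sigma> i) x (d i)" "point \<phi> (coord \<phi> x) = x"
  shows "hasD \<phi> (\<lambda>y. \<Sum>i\<in>I. \<sigma> i y) x (\<lambda>v. \<Sum>i\<in>I. d i v)"
  using assms unfolding hasD_def comp_def by (auto intro: has_derivative_sum)

lemma lip_basis:
  assumes "i \<in> (Basis :: R42 set)"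
  shows "lip v i = lip i i * (v \<bullet> i)" "lip i i * lip i i = 1"
  using assms by (auto simp: Basis_prod_def lip_def inner_prod_def norm_Basis dot_square_norm)

lemma lip_basis_representation: "(\<Sum>i\<in>Basis. (lip i i * lip v i) *\<^sub>R i) = v"
proof -
  have "(\<Sum>i\<in>Basis. (lip i i * lip v i) *\<^sub>R i) = (\<Sum>i\<in>Basis. (v \<bullet> i) *\<^sub>R i)"
    by (rule sum.cong[OF refl]) (metis lip_basis mult.assoc mult_1)
  then show ?thesis by (simp add: euclidean_representation)
qed

text \<open>The adjoint of an isometry \<open>\<Phi>\<close>, which is its inverse.\<close>

definition adjoint_frame :: "(R42 \<Rightarrow> R42) \<Rightarrow> R42 \<Rightarrow> R42" where
  "adjoint_frame \<Phi> v = (\<Sum>i\<in>Basis. (lip i i * lip v (\<Phi> i)) *\<^sub>R i)"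

lemma adjoint_frame_inverse:
  assumes "linear \<Phi>" and iso: "\<And>v w. lip (\<Phi> v) (\<Phi> w) = lip v w"
  shows "linear (adjoint_frame \<Phi>)" "adjoint_frame \<Phi> (\<Phi> w) = w" "\<Phi> (adjoint_frame \<Phi> v) = v"
    "inv (adjoint_frame \<Phi>) w = \<Phi> w" "lip (adjoint_frame \<Phi> v) (adjoint_frame \<Phi> w) = lip v w"
proof -
  show "linear (adjoint_frame \<Phi>)"
    by (simp add: linear_iff adjoint_frame_def lip_linear algebra_simps sum.distrib scaleR_sum_right)
  show left: "adjoint_frame \<Phi> (\<Phi> w) = w" for w
    by (simp add: adjoint_frame_def iso lip_basis_representation)
  have "inj \<Phi>" using left by (metis injI)
  then have "surj \<Phi>" using linear_injective_imp_surjective[OF assms(1)] by blast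
  then show right: "\<Phi> (adjoint_frame \<Phi> v) = v" for v using left by (metis surj_def)
  then have "inj (adjoint_frame \<Phi>)" by (metis injI)
  then show "inv (adjoint_frame \<Phi>) w = \<Phi> w" using left by (metis inv_f_eq)
  show "lip (adjoint_frame \<Phi> v) (adjoint_frame \<Phi> w) = lip v w" using iso right by metis
qed

context weingarten_lift
begin

lemma restrict:
  assumes U: "open U" "U \<subseteq> S"
  shows "weingarten_lift A U f \<pp> \<qq> \<ff> \<tt> a b c"
proof -
  have xU: "x \<in> S" if "x \<in> U" for x using that U(2) by blast
  interpret r: legendre_lift A U f \<pp> \<qq> \<ff> \<tt>
  proof unfold_locales
    show "v = 0" if "x \<in> U" "\<phi> \<in> A" "x \<in> dom_chart \<phi>" "D \<phi> \<ff> x v = 0" "D \<phi> \<tt> x v = 0" for x \<phi> v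
      using regular[OF xU[OF that(1)] that(2-)] .
  qed (use U(1) smooth_map_subset[OF smooth_f U(2)] smooth_map_subset[OF smooth_t U(2)]
        lip_frame fibre contact xU in auto)
  show ?thesis
  proof unfold_locales
    show "b\<^sup>2 - a * c \<noteq> 0" by (rule non_tub)
    fix x assume x: "x \<in> U"
    obtain N \<kappa>1 \<mu>1 \<kappa>2 \<mu>2 where N: "x \<in> N" "principal_sections N \<kappa>1 \<mu>1 \<kappa>2 \<mu>2"
      "\<forall>y\<in>N. W_form a b c (\<kappa>1 y) (\<mu>1 y) (\<kappa>2 y) (\<mu>2 y) = 0"
      using weingarten[OF xU[OF x]] by blast
    have "r.principal_sections (N \<inter> U) \<kappa>1 \<mu>1 \<kappa>2 \<mu>2"
      unfolding r.principal_sections_def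
    proof (intro conjI)
      show "open (N \<inter> U)" using N(2) U(1) unfolding principal_sections_def by blast
    qed (use N(2) smooth_map_subset[of N _ "N \<inter> U"] in \<open>auto simp: principal_sections_def\<close>)
    then show "\<exists>N \<kappa>1 \<mu>1 \<kappa>2 \<mu>2. x \<in> N \<and> r.principal_sections N \<kappa>1 \<mu>1 \<kappa>2 \<mu>2 \<and>
        (\<forall>y\<in>N. W_form a b c (\<kappa>1 y) (\<mu>1 y) (\<kappa>2 y) (\<mu>2 y) = 0)"
      using N(1,3) x by blast
  qed
qed

text \<open>Each derivative of a parallel section is an expression in the section itself, so that one
  derivative after the other exists.\<close>

lemma parallel_smooth:
  assumes U: "open U" "U \<subseteq> S"
    and par: "\<And>x \<phi>. x \<in> U \<Longrightarrow> \<phi> \<in> A \<Longrightarrow> x \<in> dom_chart \<phi> \<Longrightarrow> hasD \<phi> \<sigma> x (\<lambda>v. - m *\<^sub>R \<eta> \<phi> x v (\<sigma> x))"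
  shows "smooth_map A U \<sigma>"
  unfolding smooth_map_def
proof
  fix \<phi> assume \<phi>: "\<phi> \<in> A"
  let ?O = "coord \<phi> ` (dom_chart \<phi> \<inter> U)"
  have O: "open ?O" by (rule open_chart_image[OF \<phi> U(1)])
  have der: "((\<sigma> \<circ> point \<phi>) has_derivative (\<lambda>v. - m *\<^sub>R \<eta> \<phi> (point \<phi> u) v (\<sigma> (point \<phi> u)))) (at u)" if "u \<in> ?O" for u
  proof -
    have u: "point \<phi> u \<in> dom_chart \<phi>" "point \<phi> u \<in> U" "coord \<phi> (point \<phi> u) = u"
      using coord_point[OF \<phi> that] by auto
    show ?thesis using par[OF u(2) \<phi> u(1)] u(3) by (simp add: hasD_def)
  qed
  have sm: "Ck_on k ?O (\<lambda>u. \<ff> (point \<phi> u))" "Ck_on k ?O (\<lambda>u. \<tt> (point \<phi> u))"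
    "Ck_on k ?O (\<lambda>u. D \<phi> \<ff> (point \<phi> u) v)" "Ck_on k ?O (\<lambda>u. D \<phi> \<tt> (point \<phi> u) v)" for k v
    using smooth_mapD[OF smooth_map_subset[OF smooth_f U(2)] \<phi>] smooth_mapD[OF smooth_map_subset[OF smooth_t U(2)] \<phi>]
      smooth_on_D[OF smooth_map_subset[OF smooth_f U(2)] U(1) \<phi>] smooth_on_D[OF smooth_map_subset[OF smooth_t U(2)] U(1) \<phi>]
    by (simp_all add: smooth_on_def comp_def)
  note bil = Ck_on_bilinear[OF bounded_bilinear_scaleR O] Ck_on_bilinear[OF bounded_bilinear_lip O]
  have "Ck_on k ?O (\<lambda>u. \<sigma> (point \<phi> u))" for k
  proof (induction k)
    case 0
    then show ?case
      using has_derivative_continuous[OF der] by (auto simp: comp_def intro!: continuous_at_imp_continuous_on)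
  next
    case (Suc k)
    show ?case
    proof (rule Ck_on_SucI[OF O])
      show "((\<lambda>u. \<sigma> (point \<phi> u)) has_derivative (\<lambda>v. - m *\<^sub>R \<eta> \<phi> (point \<phi> u) v (\<sigma> (point \<phi> u)))) (at u)"
        if "u \<in> ?O" for u using der[OF that] by (simp add: comp_def)
      fix v
      have "Ck_on k ?O (\<lambda>u. - m *\<^sub>R ((lip (\<ff> (point \<phi> u)) (\<sigma> (point \<phi> u)) *\<^sub>R
          (c *\<^sub>R D \<phi> \<ff> (point \<phi> u) v + - b *\<^sub>R D \<phi> \<tt> (point \<phi> u) v) +
        -1 *\<^sub>R lip (c *\<^sub>R D \<phi> \<ff> (point \<phi> u) v + - b *\<^sub>R D \<phi> \<tt> (point \<phi> u) v) (\<sigma> (point \<phi> u)) *\<^sub>R \<ff> (point \<phi> u)) +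
        (lip (\<tt> (point \<phi> u)) (\<sigma> (point \<phi> u)) *\<^sub>R (a *\<^sub>R D \<phi> \<tt> (point \<phi> u) v + - b *\<^sub>R D \<phi> \<ff> (point \<phi> u) v) +
        -1 *\<^sub>R lip (a *\<^sub>R D \<phi> \<tt> (point \<phi> u) v + - b *\<^sub>R D \<phi> \<ff> (point \<phi> u) v) (\<sigma> (point \<phi> u)) *\<^sub>R \<tt> (point \<phi> u))))"
        by (intro Ck_on_add[OF O] bil Ck_on_const sm Suc.IH)
      then show "Ck_on k ?O (\<lambda>u. - m *\<^sub>R \<eta> \<phi> (point \<phi> u) v (\<sigma> (point \<phi> u)))"
        by (simp add: eta_eq \<alpha>_def \<beta>_def)
    qed
  qed
  then show "smooth_on ?O (\<sigma> \<circ> point \<phi>)" by (simp add: smooth_on_def comp_def)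
qed

lemma hasD_p_of:
  assumes x: "x \<in> S" "\<phi> \<in> A" "x \<in> dom_chart \<phi>"
  shows "hasD \<phi> (p_of \<pp> \<ff> \<tt> a b m) x (\<lambda>v. - m *\<^sub>R \<eta> \<phi> x v (p_of \<pp> \<ff> \<tt> a b m x))"
    "hasD \<phi> (q_of \<qq> \<ff> \<tt> b c m) x (\<lambda>v. - m *\<^sub>R \<eta> \<phi> x v (q_of \<qq> \<ff> \<tt> b c m x))"
proof -
  have p: "\<eta> \<phi> x v (p_of \<pp> \<ff> \<tt> a b m x) = - \<beta> \<phi> x v" and q: "\<eta> \<phi> x v (q_of \<qq> \<ff> \<tt> b c m x) = - \<alpha> \<phi> x v" for v
    by (simp_all add: eta_eq p_of_def q_of_def lip_linear lip_frame[OF x(1)] alpha_beta_perp[OF x])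
  have "hasD \<phi> (\<lambda>y. \<pp> + m *\<^sub>R (- b *\<^sub>R \<ff> y + a *\<^sub>R \<tt> y)) x (\<lambda>v. 0 + m *\<^sub>R (- b *\<^sub>R D \<phi> \<ff> x v + a *\<^sub>R D \<phi> \<tt> x v))"
    by (intro hasD_add hasD_const hasD_scaleR_right hasD_f hasD_t x)
  then show "hasD \<phi> (p_of \<pp> \<ff> \<tt> a b m) x (\<lambda>v. - m *\<^sub>R \<eta> \<phi> x v (p_of \<pp> \<ff> \<tt> a b m x))"
    unfolding p by (simp add: p_of_def[abs_def] \<beta>_def algebra_simps)
  have "hasD \<phi> (\<lambda>y. \<qq> + m *\<^sub>R (c *\<^sub>R \<ff> y - b *\<^sub>R \<tt> y)) x (\<lambda>v. 0 + m *\<^sub>R (c *\<^sub>R D \<phi> \<ff> x v - b *\<^sub>R D \<phi> \<tt> x v))"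
    by (intro hasD_add hasD_diff hasD_const hasD_scaleR_right hasD_f hasD_t x)
  then show "hasD \<phi> (q_of \<qq> \<ff> \<tt> b c m) x (\<lambda>v. - m *\<^sub>R \<eta> \<phi> x v (q_of \<qq> \<ff> \<tt> b c m x))"
    unfolding q by (simp add: q_of_def[abs_def] \<alpha>_def algebra_simps)
qed

text \<open>The connection \<open>d + m \<eta>\<close> is flat as \<open>\<eta>\<close> is closed with \<open>[\<eta> \<and> \<eta>] = 0\<close>, and metric as \<open>\<eta>\<close> is skew.
  The frame \<open>\<Phi>\<close> is set to be the identity away from the domain of the parallel sections.\<close>

lemma parallel_frame:
  assumes x0: "x0 \<in> S"
  obtains U \<Phi> where "open U" "x0 \<in> U" "U \<subseteq> S" "\<And>x. linear (\<Phi> x)" "\<And>w. \<Phi> x0 w = w"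
    "\<And>x v w. lip (\<Phi> x v) (\<Phi> x w) = lip v w"
    "\<And>x \<phi> w. x \<in> U \<Longrightarrow> \<phi> \<in> A \<Longrightarrow> x \<in> dom_chart \<phi> \<Longrightarrow> hasD \<phi> (\<lambda>y. \<Phi> y w) x (\<lambda>v. - m *\<^sub>R \<eta> \<phi> x v (\<Phi> x w))"
    "\<And>x w. x \<in> U \<Longrightarrow> lip (\<Phi> x w) (p_of \<pp> \<ff> \<tt> a b m x) = lip w (p_of \<pp> \<ff> \<tt> a b m x0)"
    "\<And>x w. x \<in> U \<Longrightarrow> lip (\<Phi> x w) (q_of \<qq> \<ff> \<tt> b c m x) = lip w (q_of \<qq> \<ff> \<tt> b c m x0)"
proof -
  obtain \<phi>0 where \<phi>0: "\<phi>0 \<in> A" "x0 \<in> dom_chart \<phi>0" using chart_at by blast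
  define Y where "Y = coord \<phi>0 ` (dom_chart \<phi>0 \<inter> S)"
  define y0 where "y0 = coord \<phi>0 x0"
  define B where "B y v z = - m *\<^sub>R \<eta> \<phi>0 (point \<phi>0 y) v z" for y v z
  have Y: "open Y" "y0 \<in> Y" using open_chart_image[OF \<phi>0(1) open_S] x0 \<phi>0(2) by (auto simp: Y_def y0_def)
  have pt: "point \<phi>0 y \<in> S" "point \<phi>0 y \<in> dom_chart \<phi>0" "coord \<phi>0 (point \<phi>0 y) = y" if "y \<in> Y" for y
    using coord_point[OF \<phi>0(1), of y S] that by (auto simp: Y_def)
  have sm: "smooth_on Y (\<lambda>y. \<eta> \<phi>0 (point \<phi>0 y) v z)" for v z
    using eta_smooth[OF \<phi>0(1)] by (simp add: Y_def comp_def)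
  have DB: "frechet_derivative (\<lambda>y. B y v z) (at y) u = - m *\<^sub>R D \<phi>0 (\<lambda>x. \<eta> \<phi>0 x v z) (point \<phi>0 y) u" if "y \<in> Y" for y u v z
  proof -
    have d: "((\<lambda>y. B y v z) has_derivative (\<lambda>u. - m *\<^sub>R frechet_derivative (\<lambda>y. \<eta> \<phi>0 (point \<phi>0 y) v z) (at y) u)) (at y)"
      unfolding B_def by (intro has_derivative_scaleR_right smooth_on_has_derivative[OF Y(1) sm that])
    show ?thesis
      unfolding D_def comp_def pt(3)[OF that] frechet_derivative_at[OF d, symmetric] ..
  qed
  have "\<exists>r>0. ball y0 r \<subseteq> Y \<and> (\<forall>w. \<exists>s. s y0 = w \<and>
    (\<forall>y\<in>ball y0 r. (s has_derivative (\<lambda>v. B y v (s y))) (at y)))"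
  proof (rule frobenius[OF Y])
    fix y assume y: "y \<in> Y"
    note p = pt(1)[OF y] \<phi>0(1) pt(2)[OF y]
    show "linear (\<lambda>v. B y v z)" for z
      unfolding B_def by (intro linear_compose_scale_right eta_linear(1)[OF p])
    show "linear (B y v)" for v
      unfolding B_def[abs_def] by (intro linear_compose_scale_right eta_linear(2)[OF p])
    fix u v z
    have "D \<phi>0 (\<lambda>x. \<eta> \<phi>0 x v z) (point \<phi>0 y) u = D \<phi>0 (\<lambda>x. \<eta> \<phi>0 x u z) (point \<phi>0 y) v"
      using closed_eta p unfolding closed_form_def by (metis IntI eq_iff_diff_eq_0)
    moreover have "B y v (B y u z) = B y u (B y v z)"
      using eta_commute[OF p, of v u z] by (simp add: B_def linear_neg[OF eta_linear(2)[OF p]] linear_cmul[OF eta_linear(2)[OF p]])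
    ultimately show "frechet_derivative (\<lambda>y. B y v z) (at y) u + B y v (B y u z) =
        frechet_derivative (\<lambda>y. B y u z) (at y) v + B y u (B y v z)"
      by (simp add: DB[OF y])
  next
    show "smooth_on Y (\<lambda>y. B y v z)" for v z
      unfolding B_def by (intro smooth_on_bilinear[OF bounded_bilinear_scaleR Y(1)] smooth_on_const sm)
  qed
  then obtain r where r: "r > 0" "ball y0 r \<subseteq> Y"
    and "\<And>w. \<exists>s. s y0 = w \<and> (\<forall>y\<in>ball y0 r. (s has_derivative (\<lambda>v. B y v (s y))) (at y))" by blast
  then obtain s where s0: "\<And>w. s w y0 = w"
    and s: "\<And>w y. y \<in> ball y0 r \<Longrightarrow> (s w has_derivative (\<lambda>v. B y v (s w y))) (at y)" by metis
  define U where "U = point \<phi>0 ` ball y0 r"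
  have U: "open U" "x0 \<in> U" "U \<subseteq> S" "U \<subseteq> dom_chart \<phi>0" and cU: "\<And>x. x \<in> U \<Longrightarrow> coord \<phi>0 x \<in> ball y0 r"
  proof -
    show "open U" unfolding U_def by (rule open_point_image[OF \<phi>0(1) open_ball]) (use r(2) in \<open>auto simp: Y_def\<close>)
    show "x0 \<in> U" unfolding U_def y0_def using point_coord[OF \<phi>0] r(1) by (metis centre_in_ball image_eqI)
    show "U \<subseteq> S" "U \<subseteq> dom_chart \<phi>0" using pt r(2) by (auto simp: U_def)
    show "coord \<phi>0 x \<in> ball y0 r" if "x \<in> U" for x using that pt(3) r(2) by (auto simp: U_def)
  qed
  define \<Phi> where "\<Phi> x w = (if x \<in> U then \<Sum>i\<in>Basis. (w \<bullet> i) *\<^sub>R s i (coord \<phi>0 x) else w)" for x w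
  have lin: "linear (\<Phi> x)" for x
    by (cases "x \<in> U") (simp_all add: linear_iff \<Phi>_def inner_add_left scaleR_add_left sum.distrib scaleR_sum_right)
  have \<Phi>0: "\<Phi> x0 w = w" for w
    using U(2) by (simp add: \<Phi>_def y0_def[symmetric] s0 euclidean_representation)
  have h0: "hasD \<phi>0 (\<lambda>y. s w (coord \<phi>0 y)) x (\<lambda>v. - m *\<^sub>R \<eta> \<phi>0 x v (s w (coord \<phi>0 x)))" if x: "x \<in> U" for x w
  proof -
    have px: "point \<phi>0 (coord \<phi>0 x) = x" using point_coord[OF \<phi>0(1)] x U(4) by blast
    have "((\<lambda>y. s w (coord \<phi>0 y)) \<circ> point \<phi>0 has_derivative (\<lambda>v. B (coord \<phi>0 x) v (s w (coord \<phi>0 x)))) (at (coord \<phi>0 x))"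
      by (rule has_derivative_transform_within_open[OF s[OF cU[OF x]] open_ball cU[OF x]]) (use pt(3) r(2) in auto)
    then show ?thesis using px by (simp add: hasD_def B_def)
  qed
  have h: "hasD \<phi>0 (\<lambda>y. \<Phi> y w) x (\<lambda>v. - m *\<^sub>R \<eta> \<phi>0 x v (\<Phi> x w))" if x: "x \<in> U" for x w
  proof -
    have p: "x \<in> S" "\<phi>0 \<in> A" "x \<in> dom_chart \<phi>0" using x U \<phi>0(1) by auto
    have "hasD \<phi>0 (\<lambda>y. \<Sum>i\<in>Basis. (w \<bullet> i) *\<^sub>R s i (coord \<phi>0 y)) x (\<lambda>v. \<Sum>i\<in>Basis. (w \<bullet> i) *\<^sub>R (- m *\<^sub>R \<eta> \<phi>0 x v (s i (coord \<phi>0 x))))"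
      by (intro hasD_sum hasD_scaleR_right h0 x finite_Basis point_coord p)
    also have "(\<lambda>v. \<Sum>i\<in>Basis. (w \<bullet> i) *\<^sub>R (- m *\<^sub>R \<eta> \<phi>0 x v (s i (coord \<phi>0 x)))) = (\<lambda>v. - m *\<^sub>R \<eta> \<phi>0 x v (\<Phi> x w))"
      using x by (simp add: \<Phi>_def linear_sum[OF eta_linear(2)[OF p]] linear_cmul[OF eta_linear(2)[OF p]] scaleR_sum_right mult.commute)
    finally show ?thesis
      by (rule hasD_cong[OF _ U(1) x p(2,3)]) (simp add: \<Phi>_def)
  qed
  have const: "g x = g x0" if g: "\<And>x. x \<in> U \<Longrightarrow> hasD \<phi>0 g x (\<lambda>v. 0)" and x: "x \<in> U" for g :: "'a \<Rightarrow> real" and x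
  proof -
    have "((g \<circ> point \<phi>0) has_derivative (\<lambda>v. 0)) (at y within ball y0 r)" if y: "y \<in> ball y0 r" for y
    proof -
      have "point \<phi>0 y \<in> U" "coord \<phi>0 (point \<phi>0 y) = y" using y pt(3) r(2) by (auto simp: U_def)
      then show ?thesis using g[of "point \<phi>0 y"] by (auto simp: hasD_def intro: has_derivative_at_withinI)
    qed
    then have "\<exists>k. \<forall>y\<in>ball y0 r. (g \<circ> point \<phi>0) y = k"
      by (rule has_derivative_zero_constant[OF convex_ball])
    then obtain k where k: "\<And>y. y \<in> ball y0 r \<Longrightarrow> (g \<circ> point \<phi>0) y = k" by blast
    have "g x = k" if "x \<in> U" for x
      using k[OF cU[OF that]] point_coord[OF \<phi>0(1)] that U(4) by (auto simp: subset_eq)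
    then show ?thesis using x U(2) by simp
  qed
  have metric: "hasD \<phi>0 (\<lambda>y. lip (\<sigma> y) (\<rho> y)) x (\<lambda>v. 0)"
    if "hasD \<phi>0 \<sigma> x (\<lambda>v. - m *\<^sub>R \<eta> \<phi>0 x v (\<sigma> x))" "hasD \<phi>0 \<rho> x (\<lambda>v. - m *\<^sub>R \<eta> \<phi>0 x v (\<rho> x))" for \<sigma> \<rho> x
  proof -
    have "lip (\<sigma> x) (- m *\<^sub>R \<eta> \<phi>0 x v (\<rho> x)) + lip (- m *\<^sub>R \<eta> \<phi>0 x v (\<sigma> x)) (\<rho> x) = 0" for v
      by (simp add: lip_linear eta_skew[of \<phi>0 x v "\<sigma> x" "\<rho> x"])
    then show ?thesis using hasD_lip[OF that] by simp
  qed
  have iso: "lip (\<Phi> x v) (\<Phi> x w) = lip v w" for x v w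
  proof (cases "x \<in> U")
    case True
    from const[OF metric[OF h h] True, of v w] show ?thesis by (simp add: \<Phi>0)
  qed (simp add: \<Phi>_def)
  have pq: "lip (\<Phi> x w) (p_of \<pp> \<ff> \<tt> a b m x) = lip w (p_of \<pp> \<ff> \<tt> a b m x0)"
    "lip (\<Phi> x w) (q_of \<qq> \<ff> \<tt> b c m x) = lip w (q_of \<qq> \<ff> \<tt> b c m x0)" if x: "x \<in> U" for x w
  proof -
    have p: "x \<in> S" "x \<in> dom_chart \<phi>0" if "x \<in> U" for x using that U by auto
    show "lip (\<Phi> x w) (p_of \<pp> \<ff> \<tt> a b m x) = lip w (p_of \<pp> \<ff> \<tt> a b m x0)"
      using const[OF metric[OF h hasD_p_of(1)[OF p(1) \<phi>0(1) p(2)]] x, of w] by (simp add: \<Phi>0)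
    show "lip (\<Phi> x w) (q_of \<qq> \<ff> \<tt> b c m x) = lip w (q_of \<qq> \<ff> \<tt> b c m x0)"
      using const[OF metric[OF h hasD_p_of(2)[OF p(1) \<phi>0(1) p(2)]] x, of w] by (simp add: \<Phi>0)
  qed
  have "hasD \<phi> (\<lambda>y. \<Phi> y w) x (\<lambda>v. - m *\<^sub>R \<eta> \<phi> x v (\<Phi> x w))" if "x \<in> U" "\<phi> \<in> A" "x \<in> dom_chart \<phi>" for x \<phi> w
  proof -
    have p: "x \<in> S" "x \<in> dom_chart \<phi>0" using that(1) U by auto
    show ?thesis
      using hasD_chart_change[OF h[OF that(1)] that(2) \<phi>0(1) that(3) p(2), of w]
      by (simp add: eta_chart_change[OF p(1) that(2) \<phi>0(1) that(3) p(2), symmetric])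
  qed
  then show ?thesis using that[OF U(1-3) lin \<Phi>0 iso _ pq] by blast
qed

text \<open>The parallel sections \<open>\<Phi> w\<close> are the preimages of constant ones, so that the inverse of \<open>\<Phi>\<close> is a
  trivialisation.\<close>

lemma trivialisation_adjoint_frame:
  assumes U: "open U" "U \<subseteq> S" and lin: "\<And>x. linear (\<Phi> x)" and iso: "\<And>x v w. lip (\<Phi> x v) (\<Phi> x w) = lip v w"
    and par: "\<And>x \<phi> w. x \<in> U \<Longrightarrow> \<phi> \<in> A \<Longrightarrow> x \<in> dom_chart \<phi> \<Longrightarrow> hasD \<phi> (\<lambda>y. \<Phi> y w) x (\<lambda>v. - m *\<^sub>R \<eta> \<phi> x v (\<Phi> x w))"
  shows "trivialisation A U \<eta> m (\<lambda>x. adjoint_frame (\<Phi> x))"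
proof -
  have sm: "smooth_map A U (\<lambda>x. \<Phi> x w)" for w by (rule parallel_smooth[OF U par])
  show ?thesis
    unfolding trivialisation_def
  proof (intro conjI ballI allI impI)
    show "linear (adjoint_frame (\<Phi> x))" "lip (adjoint_frame (\<Phi> x) v) (adjoint_frame (\<Phi> x) w) = lip v w" for x v w
      using adjoint_frame_inverse[OF lin iso] by blast+
    show "smooth_map A U (\<lambda>x. adjoint_frame (\<Phi> x) w)" for w
      unfolding adjoint_frame_def
      by (intro smooth_map_sum smooth_map_scaleR smooth_map_mult smooth_map_lip smooth_map_const U(1) sm)
    fix \<sigma> :: "'a \<Rightarrow> R42" and \<phi> x v
    assume \<sigma>: "smooth_map A U \<sigma>" and \<phi>: "\<phi> \<in> A" and "x \<in> U \<inter> dom_chart \<phi>"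
    then have x: "x \<in> U" "x \<in> dom_chart \<phi>" by auto
    have "hasD \<phi> (\<lambda>y. \<Sum>i\<in>Basis. lip (\<sigma> y) (\<Phi> y i) *\<^sub>R (lip i i *\<^sub>R i)) x
      (\<lambda>v. \<Sum>i\<in>Basis. lip (\<sigma> x) (\<Phi> x i) *\<^sub>R 0 + (lip (\<sigma> x) (- m *\<^sub>R \<eta> \<phi> x v (\<Phi> x i)) + lip (D \<phi> \<sigma> x v) (\<Phi> x i)) *\<^sub>R (lip i i *\<^sub>R i))"
      by (intro hasD_sum finite_Basis point_coord \<phi> x(2) hasD_scaleR hasD_lip hasD_const
          smooth_map_hasD[OF \<sigma> U(1) x(1) \<phi> x(2)] par[OF x(1) \<phi> x(2)])
    from hasD_D[OF this, of v]
    have "D \<phi> (\<lambda>y. \<Sum>i\<in>Basis. lip (\<sigma> y) (\<Phi> y i) *\<^sub>R (lip i i *\<^sub>R i)) x v =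
      (\<Sum>i\<in>Basis. (lip (\<sigma> x) (- m *\<^sub>R \<eta> \<phi> x v (\<Phi> x i)) + lip (D \<phi> \<sigma> x v) (\<Phi> x i)) *\<^sub>R (lip i i *\<^sub>R i))" by simp
    also have "\<dots> = adjoint_frame (\<Phi> x) (D \<phi> \<sigma> x v + m *\<^sub>R \<eta> \<phi> x v (\<sigma> x))"
      unfolding adjoint_frame_def
      by (rule sum.cong[OF refl]) (simp add: lip_linear eta_skew mult.commute add.commute)
    finally show "D \<phi> (\<lambda>y. adjoint_frame (\<Phi> y) (\<sigma> y)) x v = adjoint_frame (\<Phi> x) (D \<phi> \<sigma> x v + m *\<^sub>R \<eta> \<phi> x v (\<sigma> x))"
      by (simp add: adjoint_frame_def mult.commute)
  qed
qed

end

section \<open>The admissible parameters\<close>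

lemma finite_quadratic_roots:
  fixes k0 k1 k2 :: real
  assumes "(k0, k1, k2) \<noteq> (0, 0, 0)"
  shows "finite {t. k0 + k1 * t + k2 * t * t = 0}"
proof -
  have "finite {t. poly [:k0, k1, k2:] t = 0}"
    by (rule poly_roots_finite) (use assms in auto)
  then show ?thesis by (simp add: algebra_simps)
qed

context weingarten_lift
begin

text \<open>For \<open>w \<bottom> p(m), q(m)\<close> with \<open>(w, \<ff>) = r\<close> and \<open>(w, \<tt>) = s\<close>, the component of \<open>w\<close> in
  \<open>\<langle>\<ff>, \<tt>, \<pp>, \<qq>\<rangle>\<close> is \<open>span_part x m r s\<close>, whose square is minus the Gram form of \<open>q(m), p(m)\<close> at
  \<open>(r, s)\<close>. The other component of \<open>w\<close> is spacelike.\<close>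

definition span_part where
  "span_part x m r s = (- r * lip \<qq> \<qq> - m * (b * s - c * r)) *\<^sub>R \<ff> x + (- s * lip \<pp> \<pp> - m * (b * r - a * s)) *\<^sub>R \<tt> x
    - s *\<^sub>R \<pp> - r *\<^sub>R \<qq>"

definition gram where
  "gram m r s r' s' = (lip \<qq> \<qq> - 2 * m * c) * r * r' + 2 * m * b * (r * s' + s * r') + (lip \<pp> \<pp> - 2 * m * a) * s * s'"

lemma span_part_lips:
  assumes x: "x \<in> S" and pq: "lip \<qq> \<pp> = 0"
  shows "lip (span_part x m r s) (\<ff> x) = r" "lip (span_part x m r s) (\<tt> x) = s"
    "lip (span_part x m r s) \<pp> = m * (b * r - a * s)" "lip (span_part x m r s) \<qq> = m * (b * s - c * r)"
  using pq lip_commute[of \<pp> \<qq>] by (simp_all add: span_part_def lip_linear lip_frame[OF x])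

lemma span_part_gram:
  assumes x: "x \<in> S" and pq: "lip \<qq> \<pp> = 0"
  shows "lip (span_part x m r s) (span_part x m r' s') = - gram m r s r' s'"
proof -
  note l = span_part_lips[OF x pq, THEN trans[OF lip_commute], of m r' s']
  have "lip (span_part x m r s) (span_part x m r' s') =
      (- r * lip \<qq> \<qq> - m * (b * s - c * r)) * r' + (- s * lip \<pp> \<pp> - m * (b * r - a * s)) * s'
      - s * (m * (b * r' - a * s')) - r * (m * (b * s' - c * r'))"
    unfolding span_part_def[of x m r s] lip.add_left lip.diff_left lip.scaleR_left l by simp
  then show ?thesis by (simp add: gram_def algebra_simps)
qed

lemma span_part_perp:
  assumes x: "x \<in> S" and pq: "lip \<qq> \<pp> = 0"
  shows "lip (span_part x m r s) (p_of \<pp> \<ff> \<tt> a b m x) = 0" "lip (span_part x m r s) (q_of \<qq> \<ff> \<tt> b c m x) = 0"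
  by (simp_all add: p_of_def q_of_def lip.add_right lip.diff_right lip.scaleR_right lip.minus_right
      span_part_lips[OF x pq] algebra_simps)

lemma timelike_iff:
  assumes x: "x \<in> S" and pq: "lip \<qq> \<pp> = 0"
  shows "(\<exists>w. lip w (p_of \<pp> \<ff> \<tt> a b m x) = 0 \<and> lip w (q_of \<qq> \<ff> \<tt> b c m x) = 0 \<and> lip w w < 0) \<longleftrightarrow>
    (\<exists>r s. gram m r s r s > 0)"
proof
  assume "\<exists>r s. gram m r s r s > 0"
  then obtain r s where "gram m r s r s > 0" by blast
  then show "\<exists>w. lip w (p_of \<pp> \<ff> \<tt> a b m x) = 0 \<and> lip w (q_of \<qq> \<ff> \<tt> b c m x) = 0 \<and> lip w w < 0"
    using span_part_perp[OF x pq, of m r s] span_part_gram[OF x pq, of m r s r s]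
    by (intro exI[of _ "span_part x m r s"]) simp
next
  assume "\<exists>w. lip w (p_of \<pp> \<ff> \<tt> a b m x) = 0 \<and> lip w (q_of \<qq> \<ff> \<tt> b c m x) = 0 \<and> lip w w < 0"
  then obtain w where w: "lip w (p_of \<pp> \<ff> \<tt> a b m x) = 0" "lip w (q_of \<qq> \<ff> \<tt> b c m x) = 0" "lip w w < 0" by blast
  define r where "r = lip w (\<ff> x)"
  define s where "s = lip w (\<tt> x)"
  let ?e = "span_part x m r s"
  define z where "z = w - ?e"
  have wpq: "lip w \<pp> = m * (b * r - a * s)" "lip w \<qq> = m * (b * s - c * r)"
    using w(1,2) by (simp_all add: p_of_def q_of_def lip_linear r_def s_def algebra_simps)
  have z: "lip z (\<ff> x) = 0" "lip z (\<tt> x) = 0" "lip z \<pp> = 0" "lip z \<qq> = 0"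
    by (simp_all add: z_def lip.diff_left span_part_lips[OF x pq] wpq) (simp_all add: r_def s_def)
  have ze: "lip z ?e = 0" "lip ?e z = 0"
    unfolding lip_commute[of ?e z] by (simp_all add: span_part_def lip.add_right lip.diff_right lip.scaleR_right z)
  have "lip w w = lip z z + lip ?e ?e"
  proof -
    have "w = z + ?e" by (simp add: z_def)
    then have "lip w w = lip (z + ?e) (z + ?e)" by simp
    then show ?thesis by (simp add: lip.add_left lip.add_right ze)
  qed
  then have "gram m r s r s > 0"
    using w(3) perp_f_positive(1)[OF x z(1,2)] span_part_gram[OF x pq, of m r s r s] by linarith
  then show "\<exists>r s. gram m r s r s > 0" by blast
qed

lemma real_parameters_eq:
  assumes "S = UNIV" "lip \<qq> \<pp> = 0"
  shows "real_parameters \<pp> \<qq> \<ff> \<tt> a b c = {m. m \<noteq> 0 \<and> (\<exists>r s. gram m r s r s > 0)}"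
proof -
  have "x \<in> S" for x using assms(1) by simp
  note timelike_iff[OF this assms(2)]
  then show ?thesis unfolding real_parameters_def by simp
qed

lemma open_parameters: "open {m. m \<noteq> 0 \<and> (\<exists>r s. gram m r s r s > 0)}"
proof -
  have "{m. m \<noteq> 0 \<and> (\<exists>r s. gram m r s r s > 0)} = - {0} \<inter> (\<Union>r. \<Union>s. {m. gram m r s r s > 0})" by auto
  moreover have "open {m. gram m r s r s > 0}" for r s
    unfolding gram_def by (intro open_Collect_less continuous_intros)
  ultimately show ?thesis by (simp only:) (intro open_Int open_UN ballI open_Compl closed_singleton)
qed

text \<open>The Gram form is affine in \<open>m\<close>, with slope \<open>- 2 W\<close>, and \<open>W\<close> is not zero.\<close>

lemma parameters_nonempty: "{m. m \<noteq> 0 \<and> (\<exists>r s. gram m r s r s > 0)} \<noteq> {}"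
proof -
  have g: "gram m r s r s = gram 0 r s r s - 2 * m * weingarten_value a b c r s" for m r s
    by (simp add: gram_def weingarten_value_def algebra_simps)
  obtain r s where n: "weingarten_value a b c r s \<noteq> 0"
  proof -
    have "weingarten_value a b c 1 0 = c" "weingarten_value a b c 0 1 = a" "weingarten_value a b c 1 1 = c - 2 * b + a"
      by (simp_all add: weingarten_value_def)
    then show ?thesis using that[of 1 0] that[of 0 1] that[of 1 1] non_tub by (cases "c = 0"; cases "a = 0") auto
  qed
  define h where "h = \<bar>gram 0 r s r s\<bar> + 1"
  define m where "m = - h / (2 * weingarten_value a b c r s)"
  have h: "h > 0" "gram 0 r s r s + h > 0" by (simp_all add: h_def)
  have "2 * m * weingarten_value a b c r s = - h" using n by (simp add: m_def)
  then have "gram m r s r s > 0" using g[of m r s] h(2) by simp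
  moreover have "m \<noteq> 0" using h(1) n by (simp add: m_def)
  ultimately show ?thesis by blast
qed

text \<open>Admissible directions form a non-empty open set, and each condition of genericity excludes only the
  roots of a non-zero polynomial.\<close>

lemma generic_direction:
  assumes g: "gram m r s r s > 0" and ind: "\<kappa>1 * \<mu>2 \<noteq> \<mu>1 * \<kappa>2"
    and W: "W_form a b c \<kappa>1 \<mu>1 \<kappa>2 \<mu>2 = 0"
  obtains t where "gram m 1 t 1 t > 0" "weingarten_value a b c 1 t \<noteq> 0"
    "sphere_value \<kappa>1 \<mu>1 1 t \<noteq> 0" "sphere_value \<kappa>2 \<mu>2 1 t \<noteq> 0"
    "new_\<mu> a b c \<kappa>1 \<mu>1 1 t \<noteq> 0" "new_\<mu> a b c \<kappa>2 \<mu>2 1 t \<noteq> 0"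
proof -
  have "\<exists>t. gram m 1 t 1 t > 0"
  proof (cases "r = 0")
    case False
    have "gram m r s r s = r * r * gram m 1 (s / r) 1 (s / r)"
      using False by (simp add: gram_def field_simps)
    moreover have "r * r > 0" using False not_real_square_gt_zero by blast
    ultimately have "gram m 1 (s / r) 1 (s / r) > 0" using g zero_less_mult_pos by metis
    then show ?thesis by blast
  next
    case True
    define X where "X = lip \<qq> \<qq> - 2 * m * c"
    define Y where "Y = 4 * m * b"
    define Z where "Z = lip \<pp> \<pp> - 2 * m * a"
    have "Z * (s * s) > 0" using g True by (simp add: gram_def Z_def mult.assoc)
    then have Z: "Z > 0" by (simp add: zero_less_mult_iff not_square_less_zero)
    \<comment> \<open>Large enough for \<open>Z t\<^sup>2\<close> to dominate \<open>X + Y t\<close>.\<close>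
    define t where "t = (\<bar>X\<bar> + \<bar>Y\<bar>) / Z + 1"
    have t: "t \<ge> 1" using Z by (simp add: t_def)
    have "Z * t = \<bar>X\<bar> + \<bar>Y\<bar> + Z" using Z by (simp add: t_def field_simps)
    then have "Z * t * t = \<bar>X\<bar> * t + \<bar>Y\<bar> * t + Z * t" by (simp add: algebra_simps)
    moreover have "\<bar>X\<bar> * 1 \<le> \<bar>X\<bar> * t" using t by (intro mult_left_mono) auto
    moreover have "- (\<bar>Y\<bar> * t) \<le> Y * t" using t abs_ge_minus_self[of "Y * t"] by (simp add: abs_mult)
    moreover have "Z * t > 0" using Z t by simp
    ultimately have "X + Y * t + Z * t * t > 0" using abs_ge_minus_self[of X] by linarith
    then have "gram m 1 t 1 t > 0" by (simp add: gram_def X_def Y_def Z_def algebra_simps)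
    then show ?thesis by blast
  qed
  then have ne: "{t. gram m 1 t 1 t > 0} \<noteq> {}" by blast
  have op: "open {t. gram m 1 t 1 t > 0}"
    unfolding gram_def by (intro open_Collect_less continuous_intros)
  have inf: "infinite {t. gram m 1 t 1 t > 0}" using finite_imp_not_open ne op by blast
  have "(c, - 2 * b, a) \<noteq> (0, 0, 0)" using non_tub by auto
  from finite_quadratic_roots[OF this] have "finite {t. weingarten_value a b c 1 t = 0}"
    by (simp add: weingarten_value_def)
  moreover have "finite {t. sphere_value \<kappa> \<mu> 1 t = 0}" if "(\<kappa>, \<mu>) \<noteq> (0, 0)" for \<kappa> \<mu>
    using finite_quadratic_roots[of \<kappa> \<mu> 0] that by (auto simp: sphere_value_def)
  moreover have "finite {t. new_\<mu> a b c \<kappa> \<mu> 1 t = 0}" if nz: "a * \<kappa> * \<kappa> + 2 * b * \<kappa> * \<mu> + c * \<mu> * \<mu> \<noteq> 0" for \<kappa> \<mu>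
  proof -
    have eq: "new_\<mu> a b c \<kappa> \<mu> 1 t = - (c * \<mu> + 2 * b * \<kappa>) + 2 * a * \<kappa> * t + a * \<mu> * t * t" for t
      by (simp add: value_defs algebra_simps)
    have ne: "(- (c * \<mu> + 2 * b * \<kappa>), 2 * a * \<kappa>, a * \<mu>) \<noteq> (0, 0, 0)"
    proof
      assume "(- (c * \<mu> + 2 * b * \<kappa>), 2 * a * \<kappa>, a * \<mu>) = (0, 0, 0)"
      then have "c * \<mu> + 2 * b * \<kappa> = 0" "a * \<kappa> = 0" by auto
      then have "a * \<kappa> * \<kappa> + (2 * b * \<kappa> + c * \<mu>) * \<mu> = 0" by (simp add: add.commute)
      then show False using nz by (simp add: algebra_simps)
    qed
    show ?thesis unfolding eq by (rule finite_quadratic_roots[OF ne])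
  qed
  moreover have "a * \<kappa>1 * \<kappa>1 + 2 * b * \<kappa>1 * \<mu>1 + c * \<mu>1 * \<mu>1 \<noteq> 0" by (rule conjugate_nonzero[OF ind W])
  moreover have "a * \<kappa>2 * \<kappa>2 + 2 * b * \<kappa>2 * \<mu>2 + c * \<mu>2 * \<mu>2 \<noteq> 0"
    by (rule conjugate_nonzero[of \<kappa>2 \<mu>1 \<mu>2 \<kappa>1]) (use ind W in \<open>auto simp: algebra_simps\<close>)
  moreover have "(\<kappa>1, \<mu>1) \<noteq> (0, 0)" "(\<kappa>2, \<mu>2) \<noteq> (0, 0)" using ind by auto
  ultimately have "finite ({t. weingarten_value a b c 1 t = 0} \<union> {t. sphere_value \<kappa>1 \<mu>1 1 t = 0} \<union>
      {t. sphere_value \<kappa>2 \<mu>2 1 t = 0} \<union> {t. new_\<mu> a b c \<kappa>1 \<mu>1 1 t = 0} \<union> {t. new_\<mu> a b c \<kappa>2 \<mu>2 1 t = 0})" (is "finite ?Z")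
    by (intro finite_UnI) blast+
  then have "\<not> {t. gram m 1 t 1 t > 0} \<subseteq> ?Z" using inf finite_subset by blast
  then show ?thesis using that by blast
qed

end

section \<open>Two-parameter families of null lines\<close>

text \<open>Stereographic projection: the null vectors \<open>l\<close> with \<open>(l, s\<^sub>1) = (s\<^sub>0, s\<^sub>1)\<close> in a space spanned by null
  vectors \<open>s\<^sub>0, s\<^sub>1\<close> and \<open>z\<^sub>1, z\<^sub>2 \<bottom> s\<^sub>0, s\<^sub>1\<close>.\<close>

definition stereographic :: "R42 \<Rightarrow> R42 \<Rightarrow> R42 \<Rightarrow> R42 \<Rightarrow> real^2 \<Rightarrow> R42" where
  "stereographic s0 s1 z1 z2 u = s0 + (u$1) *\<^sub>R z1 + (u$2) *\<^sub>R z2 -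
     ((lip z1 z1 * (u$1 * u$1) + lip z2 z2 * (u$2 * u$2)) / (2 * lip s0 s1)) *\<^sub>R s1"

lemma stereographic_family:
  assumes null: "lip s0 s0 = 0" "lip s1 s1 = 0" and s: "lip s0 s1 \<noteq> 0"
    and z: "lip z1 s0 = 0" "lip z1 s1 = 0" "lip z2 s0 = 0" "lip z2 s1 = 0" "lip z1 z2 = 0"
    and ind: "\<And>p q r. p *\<^sub>R z1 + q *\<^sub>R z2 + r *\<^sub>R s1 = 0 \<Longrightarrow> p = 0 \<and> q = 0"
    and V: "open V" "V \<noteq> {}"
  shows "two_parameter_family V (stereographic s0 s1 z1 z2)"
proof -
  let ?l = "stereographic s0 s1 z1 z2" and ?k = "2 * lip s0 s1"
  note lips = null z z[THEN trans[OF lip_commute]]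
  have ls1: "lip (?l u) s1 = lip s0 s1" for u
    by (simp add: stereographic_def lip_linear lips)
  have lnull: "lip (?l u) (?l u) = 0" for u
    using s by (simp add: stereographic_def lip_linear lips lip_commute[of s1 s0] field_simps)
  have l0: "?l u \<noteq> 0" for u using ls1[of u] s by (auto simp: lip_linear)
  have der: "(?l has_derivative (\<lambda>w. (w$1) *\<^sub>R z1 + (w$2) *\<^sub>R z2 -
      ((lip z1 z1 * (u$1 * w$1 + w$1 * u$1) + lip z2 z2 * (u$2 * w$2 + w$2 * u$2)) / ?k) *\<^sub>R s1)) (at u)" for u
    unfolding stereographic_def[abs_def] divide_inverse
    by (auto intro!: derivative_eq_intros bounded_linear.has_derivative[OF bounded_linear_vec_nth])
  have fd: "frechet_derivative ?l (at u) w = (w$1) *\<^sub>R z1 + (w$2) *\<^sub>R z2 -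
      ((lip z1 z1 * (u$1 * w$1 + w$1 * u$1) + lip z2 z2 * (u$2 * w$2 + w$2 * u$2)) / ?k) *\<^sub>R s1" for u w
    unfolding frechet_derivative_at[OF der, symmetric] ..
  have ind': "w = 0" if "(w$1) *\<^sub>R z1 + (w$2) *\<^sub>R z2 - r *\<^sub>R s1 = 0" for w :: "real^2" and r
    using ind[of "w$1" "w$2" "- r"] that by (simp add: vec_eq_iff forall_2)
  have sm: "smooth_on V ?l"
  proof -
    note mult = smooth_on_bilinear[OF bounded_bilinear_mult V(1)]
    have "smooth_on V (\<lambda>u. s0 + (u$1) *\<^sub>R z1 + (u$2) *\<^sub>R z2 +
       ((lip z1 z1 * (u$1 * u$1) + lip z2 z2 * (u$2 * u$2)) * (- 1 / ?k)) *\<^sub>R s1)"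
      by (intro smooth_on_add[OF V(1)] smooth_on_bilinear[OF bounded_bilinear_scaleR V(1)] mult smooth_on_const
          smooth_on_bounded_linear bounded_linear_vec_nth)
    then show ?thesis by (simp add: stereographic_def[abs_def])
  qed
  have inj: "u = u'" if e: "span {?l u} = span {?l u'}" for u u'
  proof -
    obtain k where k: "?l u = k *\<^sub>R ?l u'" using e span_base[of "?l u" "{?l u}"] by (auto simp: span_singleton)
    then have "lip s0 s1 = k * lip s0 s1" using ls1[of u] ls1[of u'] by (simp add: lip_linear)
    then have "?l u - ?l u' = 0" using k s by simp
    then have "(u - u') = 0"
      by (intro ind'[of _ "(lip z1 z1 * (u$1 * u$1) + lip z2 z2 * (u$2 * u$2)) / ?k - (lip z1 z1 * (u'$1 * u'$1) + lip z2 z2 * (u'$2 * u'$2)) / ?k"])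
        (simp add: stereographic_def algebra_simps)
    then show ?thesis by simp
  qed
  have imm: "w = 0" if e: "frechet_derivative ?l (at u) w \<in> span {?l u}" for u w
  proof -
    obtain k where k: "frechet_derivative ?l (at u) w = k *\<^sub>R ?l u" using e by (auto simp: span_singleton)
    have "lip (frechet_derivative ?l (at u) w) s1 = 0" by (simp add: fd lip_linear lips)
    then have "k = 0" using k ls1[of u] s by (simp add: lip_linear)
    then show ?thesis using k fd ind' by simp
  qed
  show ?thesis
    unfolding two_parameter_family_def lightcone_def
    by (intro conjI ballI allI impI image_subsetI CollectI V sm l0 lnull inj imm)
qed

section \<open>Existence of the Darboux transforms\<close>

context weingarten_lift
begin

text \<open>Each condition of genericity is a non-vanishing of a continuous function of the point \<open>x\<close> and the parameter
  \<open>u\<close>; it holds at \<open>(x0, 0)\<close> and hence on a product of neighbourhoods.\<close>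

lemma darboux_family:
  assumes x0: "x0 \<in> S" and pq: "lip \<qq> \<pp> = 0" and m: "m \<noteq> 0" and g: "gram m r s r s > 0"
  shows "\<exists>U T V l. open U \<and> x0 \<in> U \<and> trivialisation A U \<eta> m T \<and> two_parameter_family V l \<and>
    (\<forall>u\<in>V. \<exists>f' \<ff>' \<tt>'. darboux_transform A U f \<eta> m (\<lambda>x. span {inv (T x) (l u)}) f' \<and>
       umbilic_free_lw_surface A U f' \<pp> \<qq> \<ff>' \<tt>' a b c)"
proof (rule parallel_frame[OF x0, of m])
  fix U0 \<Phi> assume U0: "open U0" "x0 \<in> U0" "U0 \<subseteq> S" and lin: "\<And>x. linear (\<Phi> x)" and \<Phi>0: "\<And>w. \<Phi> x0 w = w"
    and iso: "\<And>x v w. lip (\<Phi> x v) (\<Phi> x w) = lip v w"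
    and par: "\<And>x \<phi> w. x \<in> U0 \<Longrightarrow> \<phi> \<in> A \<Longrightarrow> x \<in> dom_chart \<phi> \<Longrightarrow> hasD \<phi> (\<lambda>y. \<Phi> y w) x (\<lambda>v. - m *\<^sub>R \<eta> \<phi> x v (\<Phi> x w))"
    and \<Phi>p: "\<And>x w. x \<in> U0 \<Longrightarrow> lip (\<Phi> x w) (p_of \<pp> \<ff> \<tt> a b m x) = lip w (p_of \<pp> \<ff> \<tt> a b m x0)"
    and \<Phi>q: "\<And>x w. x \<in> U0 \<Longrightarrow> lip (\<Phi> x w) (q_of \<qq> \<ff> \<tt> b c m x) = lip w (q_of \<qq> \<ff> \<tt> b c m x0)"
  obtain N \<kappa>1 \<mu>1 \<kappa>2 \<mu>2 where N: "x0 \<in> N" and ps: "principal_sections N \<kappa>1 \<mu>1 \<kappa>2 \<mu>2"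
    and W: "\<And>y. y \<in> N \<Longrightarrow> W_form a b c (\<kappa>1 y) (\<mu>1 y) (\<kappa>2 y) (\<mu>2 y) = 0"
    using weingarten[OF x0] by blast
  have psN: "open N" "smooth_map A N \<kappa>1" "smooth_map A N \<mu>1" "smooth_map A N \<kappa>2" "smooth_map A N \<mu>2"
    and ind0: "\<kappa>1 x0 * \<mu>2 x0 \<noteq> \<mu>1 x0 * \<kappa>2 x0"
    using ps N unfolding principal_sections_def by blast+
  obtain t where t: "gram m 1 t 1 t > 0" and gen: "weingarten_value a b c 1 t \<noteq> 0"
    "sphere_value (\<kappa>1 x0) (\<mu>1 x0) 1 t \<noteq> 0" "sphere_value (\<kappa>2 x0) (\<mu>2 x0) 1 t \<noteq> 0"
    "new_\<mu> a b c (\<kappa>1 x0) (\<mu>1 x0) 1 t \<noteq> 0" "new_\<mu> a b c (\<kappa>2 x0) (\<mu>2 x0) 1 t \<noteq> 0"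
    by (rule generic_direction[OF g ind0 W[OF N]])
  obtain \<phi> where \<phi>: "\<phi> \<in> A" "x0 \<in> dom_chart \<phi>" using chart_at by blast
  obtain \<xi>1 \<xi>2 where \<xi>: "lip \<xi>1 \<xi>2 = 0" "lip \<xi>1 \<xi>1 > 0" "lip \<xi>2 \<xi>2 > 0"
    "\<And>z. z \<in> {\<ff> x0, \<tt> x0, \<pp>, \<qq>} \<Longrightarrow> lip \<xi>1 z = 0 \<and> lip \<xi>2 z = 0"
    using weingarten_frame[OF x0 \<phi>] by metis
  \<comment> \<open>The generic null vector \<open>s0\<close>, its mirror image \<open>s1\<close>, and two directions orthogonal to both.\<close>
  define \<gamma> where "\<gamma> = gram m 1 t 1 t"
  define \<epsilon> where "\<epsilon> = sqrt (\<gamma> / lip \<xi>1 \<xi>1) *\<^sub>R \<xi>1"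
  define e where "e = span_part x0 m 1 t"
  \<comment> \<open>\<open>(- Y, X)\<close> is conjugate to \<open>(1, t)\<close> for the Gram form.\<close>
  define X where "X = lip \<qq> \<qq> - 2 * m * c + 2 * m * b * t"
  define Y where "Y = 2 * m * b + (lip \<pp> \<pp> - 2 * m * a) * t"
  define z2 where "z2 = span_part x0 m (- Y) X"
  define s0 where "s0 = e + \<epsilon>"
  define s1 where "s1 = e - \<epsilon>"
  have \<gamma>: "\<gamma> > 0" "\<gamma> = X + t * Y" using t by (simp_all add: \<gamma>_def gram_def X_def Y_def algebra_simps)
  have ee: "lip e e = - \<gamma>" "lip e z2 = 0" "lip z2 e = 0"
  proof -
    show "lip e e = - \<gamma>" by (simp add: e_def \<gamma>_def span_part_gram[OF x0 pq])
    show "lip e z2 = 0" unfolding e_def z2_def span_part_gram[OF x0 pq] by (simp add: gram_def X_def Y_def algebra_simps)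
    then show "lip z2 e = 0" by (simp add: lip_commute)
  qed
  have \<xi>0: "lip \<xi>1 (span_part x0 m p q) = 0" "lip \<xi>2 (span_part x0 m p q) = 0" for p q
    using \<xi>(4) by (simp_all add: span_part_def lip_linear)
  have \<epsilon>: "lip \<epsilon> \<epsilon> = \<gamma>" "lip \<epsilon> e = 0" "lip \<epsilon> z2 = 0" "lip \<epsilon> \<xi>2 = 0" "lip e \<epsilon> = 0" "lip z2 \<epsilon> = 0" "lip \<xi>2 \<epsilon> = 0"
    "lip \<epsilon> (\<ff> x0) = 0" "lip \<epsilon> (\<tt> x0) = 0" "lip \<epsilon> \<pp> = 0" "lip \<epsilon> \<qq> = 0"
  proof -
    show "lip \<epsilon> \<epsilon> = \<gamma>" using \<gamma>(1) \<xi>(2) by (simp add: \<epsilon>_def lip_linear flip: mult.assoc)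
    show 1: "lip \<epsilon> e = 0" "lip \<epsilon> z2 = 0" "lip \<epsilon> \<xi>2 = 0"
      by (simp_all add: \<epsilon>_def e_def z2_def lip_linear \<xi>0 \<xi>(1))
    then show "lip e \<epsilon> = 0" "lip z2 \<epsilon> = 0" "lip \<xi>2 \<epsilon> = 0" by (simp_all add: lip_commute[of _ \<epsilon>])
    show "lip \<epsilon> (\<ff> x0) = 0" "lip \<epsilon> (\<tt> x0) = 0" "lip \<epsilon> \<pp> = 0" "lip \<epsilon> \<qq> = 0"
      using \<xi>(4) by (simp_all add: \<epsilon>_def lip_linear)
  qed
  have \<xi>e: "lip \<xi>2 e = 0" "lip \<xi>2 z2 = 0" by (simp_all add: e_def z2_def \<xi>0)
  define l where "l = stereographic s0 s1 \<xi>2 z2"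
  have fam: "two_parameter_family V l" if V: "open V" "V \<noteq> {}" for V
    unfolding l_def
  proof (rule stereographic_family[OF _ _ _ _ _ _ _ _ _ V])
    show "lip s0 s0 = 0" "lip s1 s1 = 0" by (simp_all add: s0_def s1_def lip_linear ee \<epsilon>)
    show "lip s0 s1 \<noteq> 0" using \<gamma>(1) by (simp add: s0_def s1_def lip_linear ee \<epsilon>)
    show "lip \<xi>2 s0 = 0" "lip \<xi>2 s1 = 0" "lip z2 s0 = 0" "lip z2 s1 = 0" "lip \<xi>2 z2 = 0"
      by (simp_all add: s0_def s1_def lip_linear ee \<epsilon> \<xi>e)
    fix p q r assume z: "p *\<^sub>R \<xi>2 + q *\<^sub>R z2 + r *\<^sub>R s1 = 0"
    have "p * lip \<xi>2 \<xi>2 = 0"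
      using arg_cong[OF z, of "lip \<xi>2"] by (simp add: s1_def lip_linear \<epsilon> \<xi>e)
    moreover have "- q * Y + r = 0" "q * X + r * t = 0"
      using arg_cong[OF z, of "\<lambda>v. lip v (\<ff> x0)"] arg_cong[OF z, of "\<lambda>v. lip v (\<tt> x0)"] \<xi>(4)
      by (simp_all add: s1_def lip_linear \<epsilon> e_def z2_def span_part_lips[OF x0 pq])
    then have "q * (X + t * Y) = 0" by algebra
    then have "q = 0" using \<gamma> by simp
    ultimately show "p = 0 \<and> q = 0" using \<xi>(3) by simp
  qed
  have "two_parameter_family UNIV l" using fam by blast
  then have "l u \<in> lightcone" and lcont: "continuous_on UNIV l" for u
    unfolding two_parameter_family_def using smooth_on_continuous by blast+
  then have lnull: "lip (l u) (l u) = 0" for u by (simp add: lightcone_def)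
  have lpq: "lip (l u) (p_of \<pp> \<ff> \<tt> a b m x0) = 0" "lip (l u) (q_of \<qq> \<ff> \<tt> b c m x0) = 0" for u
  proof -
    have "lip v (p_of \<pp> \<ff> \<tt> a b m x0) = 0 \<and> lip v (q_of \<qq> \<ff> \<tt> b c m x0) = 0" if "v \<in> {e, \<epsilon>, \<xi>2, z2}" for v
      using that \<xi>(4) span_part_perp[OF x0 pq] \<epsilon> by (auto simp: e_def z2_def) (simp_all add: p_of_def q_of_def lip_linear \<epsilon> \<xi>(4))
    then show "lip (l u) (p_of \<pp> \<ff> \<tt> a b m x0) = 0" "lip (l u) (q_of \<qq> \<ff> \<tt> b c m x0) = 0"
      by (simp_all add: l_def stereographic_def s0_def s1_def lip.add_left lip.diff_left lip.scaleR_left)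
  qed
  define B1 where "B1 y = lip (\<Phi> (fst y) (l (snd y))) (\<ff> (fst y))" for y
  define B2 where "B2 y = lip (\<Phi> (fst y) (l (snd y))) (\<tt> (fst y))" for y
  \<comment> \<open>The product of all conditions of genericity, at \<open>(x, u)\<close>.\<close>
  define P where "P y = weingarten_value a b c (B1 y) (B2 y) *
    (sphere_value (\<kappa>1 (fst y)) (\<mu>1 (fst y)) (B1 y) (B2 y) * sphere_value (\<kappa>2 (fst y)) (\<mu>2 (fst y)) (B1 y) (B2 y) *
    (new_\<mu> a b c (\<kappa>1 (fst y)) (\<mu>1 (fst y)) (B1 y) (B2 y) * new_\<mu> a b c (\<kappa>2 (fst y)) (\<mu>2 (fst y)) (B1 y) (B2 y)))" for y
  define U1 where "U1 = U0 \<inter> N"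
  have U1: "open U1" "x0 \<in> U1" using U0 N psN(1) by (auto simp: U1_def)
  have contP: "continuous_on (U1 \<times> UNIV) P"
  proof -
    have f: "continuous_on (U1 \<times> UNIV) (\<lambda>y. h (fst y))" if "continuous_on U1 h" for h :: "'a \<Rightarrow> 'z::topological_space"
      by (rule continuous_on_compose2[OF that continuous_on_fst[OF continuous_on_id]]) auto
    have k: "continuous_on U1 \<kappa>1" "continuous_on U1 \<mu>1" "continuous_on U1 \<kappa>2" "continuous_on U1 \<mu>2"
      using psN(2-)[THEN smooth_map_continuous_on[OF _ psN(1)]] by (auto simp: U1_def intro: continuous_on_subset)
    have ft: "continuous_on U1 \<ff>" "continuous_on U1 \<tt>"
      using smooth_map_continuous_on[OF smooth_f open_S] smooth_map_continuous_on[OF smooth_t open_S] U0(3)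
      by (auto simp: U1_def intro: continuous_on_subset)
    have "smooth_map A U0 (\<lambda>x. \<Phi> x w)" for w by (rule parallel_smooth[OF U0(1,3) par])
    then have \<Phi>c: "continuous_on U1 (\<lambda>x. \<Phi> x w)" for w
      unfolding U1_def by (rule continuous_on_subset[OF smooth_map_continuous_on[OF _ U0(1)]]) simp
    have \<Phi>l: "\<Phi> x w = (\<Sum>i\<in>Basis. (w \<bullet> i) *\<^sub>R \<Phi> x i)" for x w
      using arg_cong[OF euclidean_representation[of w, symmetric], of "\<Phi> x"] lin[of x]
      by (simp add: linear_sum linear_cmul)
    have "continuous_on (U1 \<times> UNIV) (\<lambda>y. l (snd y))"
      by (rule continuous_on_compose2[OF lcont continuous_on_snd[OF continuous_on_id]]) auto
    then have "continuous_on (U1 \<times> UNIV) (\<lambda>y. \<Phi> (fst y) (l (snd y)))"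
      unfolding \<Phi>l[of _ "l _"] by (intro continuous_intros f \<Phi>c)
    then have "continuous_on (U1 \<times> UNIV) B1" "continuous_on (U1 \<times> UNIV) B2"
      unfolding B1_def B2_def by (intro bounded_bilinear.continuous_on[OF bounded_bilinear_lip] f ft; assumption)+
    then show ?thesis
      unfolding P_def value_defs by (intro continuous_intros f k)
  qed
  have "open ((U1 \<times> UNIV) \<inter> P -` (- {0}))"
    using contP U1(1) by (intro continuous_open_preimage) (auto intro: open_Times)
  moreover have "(x0, 0) \<in> (U1 \<times> UNIV) \<inter> P -` (- {0})"
  proof -
    have "l 0 = s0" by (simp add: l_def stereographic_def)
    then have "B1 (x0, 0) = 1" "B2 (x0, 0) = t"
      by (simp_all add: B1_def B2_def \<Phi>0 s0_def lip_linear e_def \<epsilon> span_part_lips[OF x0 pq])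
    then show ?thesis using U1(2) gen by (simp add: P_def)
  qed
  ultimately obtain U V where UV: "open U" "open V" "(x0, 0) \<in> U \<times> V" "U \<times> V \<subseteq> (U1 \<times> UNIV) \<inter> P -` (- {0})"
    by (rule open_prod_elim)
  have x0U: "x0 \<in> U" and V0: "0 \<in> V" using UV(3) by auto
  have UU: "U \<subseteq> U0" "U \<subseteq> N" "U \<subseteq> S" using UV(4) V0 U0(3) by (auto simp: U1_def)
  define T where "T x = adjoint_frame (\<Phi> x)" for x
  have parU: "hasD \<phi> (\<lambda>y. \<Phi> y w) x (\<lambda>v. - m *\<^sub>R \<eta> \<phi> x v (\<Phi> x w))" if "x \<in> U" "\<phi> \<in> A" "x \<in> dom_chart \<phi>" for x \<phi> w
    using par that UU(1) by blast
  have Tinv: "inv (T x) w = \<Phi> x w" for x w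
    unfolding T_def by (rule adjoint_frame_inverse(4)[OF lin iso])
  have "trivialisation A U \<eta> m T"
    unfolding T_def by (rule trivialisation_adjoint_frame[OF UV(1) UU(3) lin iso parU])
  moreover have "\<exists>f' \<ff>' \<tt>'. darboux_transform A U f \<eta> m (\<lambda>x. span {inv (T x) (l u)}) f' \<and>
       umbilic_free_lw_surface A U f' \<pp> \<qq> \<ff>' \<tt>' a b c" if u: "u \<in> V" for u
  proof -
    interpret w: weingarten_lift A U f \<pp> \<qq> \<ff> \<tt> a b c by (rule restrict[OF UV(1) UU(3)])
    interpret d: darboux_lift A U f \<pp> \<qq> \<ff> \<tt> a b c m "\<lambda>x. \<Phi> x (l u)" \<kappa>1 \<mu>1 \<kappa>2 \<mu>2
    proof unfold_locales
      show "m \<noteq> 0" by (rule m)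
      show "smooth_map A U (\<lambda>x. \<Phi> x (l u))" by (rule parallel_smooth[OF UV(1) UU(3) parU])
      show "w.principal_sections U \<kappa>1 \<mu>1 \<kappa>2 \<mu>2"
        using ps UU(2) UV(1) psN(2-)[THEN smooth_map_subset[OF _ UU(2)]]
        unfolding principal_sections_def w.principal_sections_def by blast
      fix x assume x: "x \<in> U"
      show "lip (\<Phi> x (l u)) (\<Phi> x (l u)) = 0" by (simp add: iso lnull)
      show "lip (\<Phi> x (l u)) (p_of \<pp> \<ff> \<tt> a b m x) = 0" "lip (\<Phi> x (l u)) (q_of \<qq> \<ff> \<tt> b c m x) = 0"
        using x UU(1) by (simp_all add: \<Phi>p \<Phi>q lpq subset_eq)
      show "W_form a b c (\<kappa>1 x) (\<mu>1 x) (\<kappa>2 x) (\<mu>2 x) = 0"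
        using W x UU(2) by blast
      show "D \<phi> (\<lambda>x. \<Phi> x (l u)) x v = - m *\<^sub>R \<eta> \<phi> x v (\<Phi> x (l u))" if "\<phi> \<in> A" "x \<in> dom_chart \<phi>" for \<phi> v
        by (rule hasD_D[OF parU[OF x that]])
    qed
    interpret d: generic_darboux_lift A U f \<pp> \<qq> \<ff> \<tt> a b c m "\<lambda>x. \<Phi> x (l u)" \<kappa>1 \<mu>1 \<kappa>2 \<mu>2
    proof unfold_locales
      fix x assume x: "x \<in> U"
      have "P (x, u) \<noteq> 0" using UV(4) x u by auto
      moreover have "d.A1 x = B1 (x, u)" "d.A2 x = B2 (x, u)" by (simp_all add: d.A1_def d.A2_def B1_def B2_def)
      ultimately show "weingarten_value a b c (d.A1 x) (d.A2 x) \<noteq> 0"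
        "sphere_value (\<kappa>1 x) (\<mu>1 x) (d.A1 x) (d.A2 x) \<noteq> 0" "sphere_value (\<kappa>2 x) (\<mu>2 x) (d.A1 x) (d.A2 x) \<noteq> 0"
        "new_\<mu> a b c (\<kappa>1 x) (\<mu>1 x) (d.A1 x) (d.A2 x) \<noteq> 0" "new_\<mu> a b c (\<kappa>2 x) (\<mu>2 x) (d.A1 x) (d.A2 x) \<noteq> 0"
        by (simp_all add: P_def)
    qed
    show ?thesis unfolding Tinv using d.transform_darboux d.transform_lw by blast
  qed
  moreover have "two_parameter_family V l" using fam UV(2) V0 by blast
  ultimately show ?thesis using UV(1) x0U by blast
qed

end

theorem theorem6p20:
  fixes A :: "('p::{t2_space,second_countable_topology}) chart set"
    and f :: "'p vbundle"
    and \<pp> \<qq> :: R42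
    and \<ff> \<tt> :: "'p \<Rightarrow> R42"
    and a b c :: real
  defines "\<eta> \<equiv> eta_mid \<ff> \<tt> a b c"
    and "M \<equiv> real_parameters \<pp> \<qq> \<ff> \<tt> a b c"
  assumes "smooth_surface A"
    and "space_form_vectors \<pp> \<qq>"
    and "umbilic_free_lw_surface A UNIV f \<pp> \<qq> \<ff> \<tt> a b c"
    and "non_tubular a b c"
  shows "omega_surface A UNIV f \<eta> \<and> open M \<and> M \<noteq> {} \<and>
    (\<forall>m\<in>M. \<forall>x0. \<exists>U T V l. open U \<and> x0 \<in> U \<and> trivialisation A U \<eta> m T \<and>
       two_parameter_family V l \<and>
       (\<forall>u\<in>V. \<exists>f' \<ff>' \<tt>'.
          darboux_transform A U f \<eta> m (\<lambda>x. span {inv (T x) (l u)}) f' \<and>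
          umbilic_free_lw_surface A U f' \<pp> \<qq> \<ff>' \<tt>' a b c))"
proof -
  interpret weingarten_lift A UNIV f \<pp> \<qq> \<ff> \<tt> a b c
    by (rule weingarten_liftI[OF assms(3) open_UNIV assms(5,6)])
  have pq: "lip \<qq> \<pp> = 0" using assms(4) by (simp add: space_form_vectors_def)
  have M: "M = {m. m \<noteq> 0 \<and> (\<exists>r s. gram m r s r s > 0)}"
    unfolding M_def by (rule real_parameters_eq[OF refl pq])
  have family: "\<exists>U T V l. open U \<and> x0 \<in> U \<and> trivialisation A U \<eta> m T \<and> two_parameter_family V l \<and>
       (\<forall>u\<in>V. \<exists>f' \<ff>' \<tt>'. darboux_transform A U f \<eta> m (\<lambda>x. span {inv (T x) (l u)}) f' \<and>
          umbilic_free_lw_surface A U f' \<pp> \<qq> \<ff>' \<tt>' a b c)" if mM: "m \<in> M" for m x0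
  proof -
    obtain r s where "m \<noteq> 0" "gram m r s r s > 0" using mM unfolding M by blast
    from darboux_family[OF UNIV_I pq this] show ?thesis unfolding \<eta>_def .
  qed
  show ?thesis
    using omega_surface_eta open_parameters parameters_nonempty
    unfolding M[symmetric] \<eta>_def[symmetric] by (intro conjI ballI allI family)
qed

end
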